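(* Let $p$ be an odd prime, let $G$ be a finite $p$-group, and let $V$ be a faithful $\mathbb{F}_pG$-module such that every non-identity element of $\Omega_1(Z(G))$ acts on $V$ with minimal polynomial $X^p-1$. If $G$ satisfies either of the following conditions: (1) $G$ is of maximal class; (2) the $p$-rank of $G$ is at most $p$; then $V$ is not an $F$-module.
   Context: Modules are finite-dimensional right modules, and $*$ denotes the module action. For $H\leq G$, $C_V(H)=\{v\in V \mid v*h=v \text{ for all } h\in H\}$ and $j_H(V)=\dfrac{|H|\,|C_V(H)|}{|V|}$. An offender of $G$ on $V$ is a non-trivial elementary abelian $p$-subgroup $E\leq G$ with $j_E(V)\geq 1$. $V$ is an $F$-module if $G$ has an offender on $V$. $\Omega_1(Z(G))$ is the subgroup of the center generated by the elements of order dividing $p$. The rank of an elementary abelian $p$-group is its dimension as an $\mathbb{F}_p$-vector space; the $p$-rank of a finite group is the maximum of the ranks of its elementary abelian $p$-subgroups. A group of order $p^n$ ($n\geq 2$) is of maximal class if its nilpotence class is $n-1$ (so groups of order $p^2$ are of maximal class). *)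

theory Defs
  imports
    "HOL-Algebra.Generated_Groups"
    "HOL-Algebra.FiniteProduct"
    "HOL-Computational_Algebra.Polynomial"
    "HOL-Computational_Algebra.Primes"
begin

text \<open>
  A finite-dimensional right module for the group algebra of \<open>G\<close> over the field with \<open>p\<close>
  elements.  The field is the type \<open>'k\<close>, the module is the whole type \<open>'v\<close>, and \<open>act v g\<close> is
  the product of \<open>v\<close> by \<open>g\<close> on the right; its values for \<open>g\<close> outside \<open>carrier G\<close> are irrelevant.
\<close>

locale right_FpG_module =
  group G + vector_space scale
  for p :: nat
    and G :: "('g, 'm) monoid_scheme" (structure)
    and scale :: "'k::field \<Rightarrow> 'v::ab_group_add \<Rightarrow> 'v"
    and act :: "'v \<Rightarrow> 'g \<Rightarrow> 'v" +
  assumes prime_p: "prime p"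
    and card_field: "card (UNIV :: 'k set) = p"
    and finite_dimensional: "\<exists>B. finite_dimensional_vector_space scale B"
    and act_linear: "g \<in> carrier G \<Longrightarrow> Vector_Spaces.linear scale scale (\<lambda>v. act v g)"
    and act_one: "act v \<one> = v"
    and act_mult: "g \<in> carrier G \<Longrightarrow> h \<in> carrier G \<Longrightarrow> act v (g \<otimes> h) = act (act v g) h"

definition faithful_action :: "('g, 'm) monoid_scheme \<Rightarrow> ('v \<Rightarrow> 'g \<Rightarrow> 'v) \<Rightarrow> bool" where
  "faithful_action G act \<longleftrightarrow> (\<forall>g\<in>carrier G. (\<forall>v. act v g = v) \<longrightarrow> g = \<one>\<^bsub>G\<^esub>)"

definition poly_endo ::
    "('k::field \<Rightarrow> 'v::ab_group_add \<Rightarrow> 'v) \<Rightarrow> 'k poly \<Rightarrow> ('v \<Rightarrow> 'v) \<Rightarrow> 'v \<Rightarrow> 'v" where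
  "poly_endo scale f T v = (\<Sum>i\<le>degree f. scale (coeff f i) ((T ^^ i) v))"

definition is_minimal_polynomial ::
    "('k::field \<Rightarrow> 'v::ab_group_add \<Rightarrow> 'v) \<Rightarrow> ('v \<Rightarrow> 'v) \<Rightarrow> 'k poly \<Rightarrow> bool" where
  "is_minimal_polynomial scale T f \<longleftrightarrow>
     lead_coeff f = 1 \<and>
     (\<forall>v. poly_endo scale f T v = 0) \<and>
     (\<forall>h. h \<noteq> 0 \<longrightarrow> (\<forall>v. poly_endo scale h T v = 0) \<longrightarrow> degree f \<le> degree h)"

definition p_group :: "nat \<Rightarrow> ('g, 'm) monoid_scheme \<Rightarrow> bool" where
  "p_group p G \<longleftrightarrow> group G \<and> (\<exists>n. card (carrier G) = p ^ n)"

definition center :: "('g, 'm) monoid_scheme \<Rightarrow> 'g set" where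
  "center G = {z \<in> carrier G. \<forall>g\<in>carrier G. z \<otimes>\<^bsub>G\<^esub> g = g \<otimes>\<^bsub>G\<^esub> z}"

definition Omega1_center :: "nat \<Rightarrow> ('g, 'm) monoid_scheme \<Rightarrow> 'g set" where
  "Omega1_center p G = generate G {z \<in> center G. z [^]\<^bsub>G\<^esub> p = \<one>\<^bsub>G\<^esub>}"

text \<open>The indexing starts at 0 with the whole group, so that a nilpotent group has class \<open>c\<close> when
  \<open>c\<close> is the least index of a trivial term.\<close>

primrec lower_central :: "('g, 'm) monoid_scheme \<Rightarrow> nat \<Rightarrow> 'g set" where
  "lower_central G 0 = carrier G"
| "lower_central G (Suc i) =
     generate G (\<Union>x\<in>lower_central G i. \<Union>y\<in>carrier G.
       {x \<otimes>\<^bsub>G\<^esub> y \<otimes>\<^bsub>G\<^esub> inv\<^bsub>G\<^esub> x \<otimes>\<^bsub>G\<^esub> inv\<^bsub>G\<^esub> y})"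

definition has_nilpotence_class :: "('g, 'm) monoid_scheme \<Rightarrow> nat \<Rightarrow> bool" where
  "has_nilpotence_class G c \<longleftrightarrow>
     lower_central G c = {\<one>\<^bsub>G\<^esub>} \<and> (\<forall>i<c. lower_central G i \<noteq> {\<one>\<^bsub>G\<^esub>})"

definition maximal_class :: "nat \<Rightarrow> ('g, 'm) monoid_scheme \<Rightarrow> bool" where
  "maximal_class p G \<longleftrightarrow>
     (\<exists>n\<ge>2. card (carrier G) = p ^ n \<and> has_nilpotence_class G (n - 1))"

definition elementary_abelian_subgroup ::
    "nat \<Rightarrow> ('g, 'm) monoid_scheme \<Rightarrow> 'g set \<Rightarrow> bool" where
  "elementary_abelian_subgroup p G E \<longleftrightarrow>
     subgroup E G \<and>
     (\<forall>x\<in>E. \<forall>y\<in>E. x \<otimes>\<^bsub>G\<^esub> y = y \<otimes>\<^bsub>G\<^esub> x) \<and>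
     (\<forall>x\<in>E. x [^]\<^bsub>G\<^esub> p = \<one>\<^bsub>G\<^esub>)"

text \<open>A basis of \<open>E\<close> as a vector space over the field with \<open>p\<close> elements, written multiplicatively:
  every element of \<open>E\<close> is a linear combination of \<open>B\<close> for exactly one family of coefficients,
  these being represented by \<open>0, \<dots>, p - 1\<close>.\<close>

definition Fp_basis :: "nat \<Rightarrow> ('g, 'm) monoid_scheme \<Rightarrow> 'g set \<Rightarrow> 'g set \<Rightarrow> bool" where
  "Fp_basis p G E B \<longleftrightarrow>
     B \<subseteq> E \<and>
     bij_betw (\<lambda>c. finprod (G\<lparr>carrier := E\<rparr>) (\<lambda>b. b [^]\<^bsub>G\<^esub> c b) B)
       (B \<rightarrow>\<^sub>E {0..<p}) E"

definition Fp_rank :: "nat \<Rightarrow> ('g, 'm) monoid_scheme \<Rightarrow> 'g set \<Rightarrow> nat" where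
  "Fp_rank p G E = card (SOME B. Fp_basis p G E B)"

definition p_rank :: "nat \<Rightarrow> ('g, 'm) monoid_scheme \<Rightarrow> nat" where
  "p_rank p G = Max (Fp_rank p G ` {E. elementary_abelian_subgroup p G E})"

definition fixed_points :: "('v \<Rightarrow> 'g \<Rightarrow> 'v) \<Rightarrow> 'g set \<Rightarrow> 'v set" where
  "fixed_points act H = {v. \<forall>h\<in>H. act v h = v}"

definition j_value :: "('v \<Rightarrow> 'g \<Rightarrow> 'v) \<Rightarrow> 'g set \<Rightarrow> real" where
  "j_value act H =
     real (card H) * real (card (fixed_points act H)) / real (card (UNIV :: 'v set))"

definition offender ::
    "nat \<Rightarrow> ('g, 'm) monoid_scheme \<Rightarrow> ('v \<Rightarrow> 'g \<Rightarrow> 'v) \<Rightarrow> 'g set \<Rightarrow> bool" where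
  "offender p G act E \<longleftrightarrow>
     elementary_abelian_subgroup p G E \<and> E \<noteq> {\<one>\<^bsub>G\<^esub>} \<and> j_value act E \<ge> 1"

definition F_module ::
    "nat \<Rightarrow> ('g, 'm) monoid_scheme \<Rightarrow> ('v \<Rightarrow> 'g \<Rightarrow> 'v) \<Rightarrow> bool" where
  "F_module p G act \<longleftrightarrow> (\<exists>E. offender p G act E)"

end

theory Submission
  imports Defs "HOL-Algebra.Group_Action" "HOL-Number_Theory.Residues"
begin

text \<open>An F-module has an offender \<open>E\<close> all of whose elements act quadratically, by Timmesfeld's
  replacement argument.  If \<open>e\<close> acts quadratically and \<open>c = [e, g]\<close> commutes with \<open>e\<close> and \<open>g\<close>, then \<open>c\<close>
  acts quadratically as well.  As no non-identity central element does, \<open>E\<close> centralizes the second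
  center and meets it trivially.  On the quotient of the module by the fixed points of \<open>E\<close>, whose
  dimension is at most the rank of \<open>E\<close>, the operator \<open>z - 1\<close> with \<open>z\<close> central of order \<open>p\<close> has nilpotency
  index at least \<open>p - 1\<close>; hence \<open>E\<close> has rank at least \<open>p - 1\<close>.

  If the \<open>p\<close>-rank is at most \<open>p\<close>, then \<open>E\<close> together with the central elements of order \<open>p\<close> is a maximal
  elementary abelian subgroup, so it contains the non-central elements of order \<open>p\<close> of the second
  center, and such elements exist: a contradiction.

  If the group is of maximal class and order \<open>p\<^sup>n\<close> with \<open>n \<ge> p + 3\<close>, then \<open>E\<close> lies in the term of order
  \<open>p\<^sup>p\<close> of the lower central series and so has rank at most \<open>p - 2\<close>.  This is a weak form of Blackburn's
  theorem on elements of order \<open>p\<close>: by the Hall--Witt identity, no two consecutive two-step centralizers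
  differ from the first one, so some \<open>s\<close> lies outside of all those relevant to an element \<open>f\<close>, and the
  product of the conjugates of \<open>f\<close> by \<open>1, s, \<dots>, s\<^bsup>p-1\<^esup>\<close>, evaluated by a Hall--Petrescu formula, shows that
  \<open>f\<^sup>p \<noteq> 1\<close> whenever \<open>f\<close> is not deep in the series.  For \<open>n \<le> p + 1\<close> it suffices
  to count; for \<open>n = p + 2\<close> counting leaves an abelian maximal subgroup, where the same product is used.\<close>

text \<open>In characteristic p, \<open>X^p - 1\<close> is \<open>(X - 1)^p\<close>, so the
  hypothesis says that \<open>z - 1\<close> has nilpotency index exactly p for every central z of
  order p. This bounds the rank r of \<open>E\<close> through the normal closure of
  \<open>E\<close>: a central z commutes with all conjugates of \<open>E\<close>, so
  \<open>(z - 1)^r\<close> maps the module into the vectors fixed by that closure. The closure is a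
  non-trivial normal subgroup of a p-group, so z can be chosen inside it; then
  \<open>(z - 1)^(r + 1) = 0\<close>, and r is at least \<open>p - 1\<close>. In maximal class,
  \<open>E\<close> meets the term \<open>lcs G (n - 2)\<close> of order \<open>p^2\<close>
  trivially, so a subgroup containing both has order at least \<open>p^(p + 1)\<close>. Hence a term
  of order \<open>p^p\<close> is deep enough for a contradiction, and the computation of p-th powers
  aims at placing \<open>E\<close> there.\<close>

hide_const (open) up_ring.coeff up_ring.monom Group_Action.faithful_action

section \<open>Commutators\<close>

context group
begin

text \<open>Right conjugation fits the right module. The generators \<open>x y x^-1 y^-1\<close> of
  the lower central series are \<open>comm (inv x) (inv y)\<close> in this convention, so the same
  terms result.\<close>

definition conj_by :: "'a \<Rightarrow> 'a \<Rightarrow> 'a" where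
  "conj_by x g = inv g \<otimes> x \<otimes> g"

definition comm :: "'a \<Rightarrow> 'a \<Rightarrow> 'a" where
  "comm x y = inv x \<otimes> inv y \<otimes> x \<otimes> y"

lemma conj_by_closed [simp, intro]: "x \<in> carrier G \<Longrightarrow> g \<in> carrier G \<Longrightarrow> conj_by x g \<in> carrier G"
  by (simp add: conj_by_def)

lemma comm_closed [simp, intro]: "x \<in> carrier G \<Longrightarrow> y \<in> carrier G \<Longrightarrow> comm x y \<in> carrier G"
  by (simp add: comm_def)

lemma cancel_inv_left: "x \<in> carrier G \<Longrightarrow> y \<in> carrier G \<Longrightarrow> inv x \<otimes> (x \<otimes> y) = y"
  by (simp add: m_assoc[symmetric])

lemma cancel_left_inv: "x \<in> carrier G \<Longrightarrow> y \<in> carrier G \<Longrightarrow> x \<otimes> (inv x \<otimes> y) = y"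
  by (simp add: m_assoc[symmetric])

lemmas group_word = m_assoc inv_mult_group cancel_inv_left cancel_left_inv comm_def conj_by_def

lemma comm_mult_left:
  assumes "x \<in> carrier G" "y \<in> carrier G" "z \<in> carrier G"
  shows "comm (x \<otimes> y) z = conj_by (comm x z) y \<otimes> comm y z"
  using assms by (simp add: group_word)

lemma inv_comm: "x \<in> carrier G \<Longrightarrow> y \<in> carrier G \<Longrightarrow> inv (comm x y) = comm y x"
  by (simp add: group_word)

lemma conj_by_eq: "x \<in> carrier G \<Longrightarrow> g \<in> carrier G \<Longrightarrow> conj_by x g = x \<otimes> comm x g"
  by (simp add: group_word)

lemma conj_by_mult:
  "x \<in> carrier G \<Longrightarrow> y \<in> carrier G \<Longrightarrow> g \<in> carrier G \<Longrightarrow>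
    conj_by (x \<otimes> y) g = conj_by x g \<otimes> conj_by y g"
  by (simp add: group_word)

lemma conj_by_inv:
  "x \<in> carrier G \<Longrightarrow> g \<in> carrier G \<Longrightarrow> conj_by (inv x) g = inv (conj_by x g)"
  by (simp add: group_word)

lemma conj_by_conj_by:
  "x \<in> carrier G \<Longrightarrow> g \<in> carrier G \<Longrightarrow> h \<in> carrier G \<Longrightarrow>
    conj_by (conj_by x g) h = conj_by x (g \<otimes> h)"
  by (simp add: group_word)

lemma conj_by_one [simp]: "x \<in> carrier G \<Longrightarrow> conj_by x \<one> = x"
  by (simp add: group_word)

lemma one_conj_by [simp]: "g \<in> carrier G \<Longrightarrow> conj_by \<one> g = \<one>"
  by (simp add: group_word)

lemma conj_by_pow:
  fixes n :: nat
  assumes "x \<in> carrier G" "g \<in> carrier G"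
  shows "conj_by (x [^] n) g = conj_by x g [^] n"
  using assms by (induction n) (simp_all add: conj_by_mult)

lemma comm_eq_one_iff:
  assumes "x \<in> carrier G" "y \<in> carrier G"
  shows "comm x y = \<one> \<longleftrightarrow> x \<otimes> y = y \<otimes> x"
proof -
  have "comm x y = inv (y \<otimes> x) \<otimes> (x \<otimes> y)" using assms by (simp add: group_word)
  then show ?thesis using assms
    by (metis (full_types) inv_closed inv_equality inv_inv l_inv m_closed)
qed

lemma comm_self [simp]: "x \<in> carrier G \<Longrightarrow> comm x x = \<one>"
  by (simp add: comm_eq_one_iff)

lemma hall_witt:
  assumes "x \<in> carrier G" "y \<in> carrier G" "z \<in> carrier G"
  shows "conj_by (comm (comm x (inv y)) z) y \<otimes> conj_by (comm (comm y (inv z)) x) z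
      \<otimes> conj_by (comm (comm z (inv x)) y) x = \<one>"
  using assms by (simp add: group_word)

lemma normal_conj_by:
  assumes "K \<lhd> G" "k \<in> K" "g \<in> carrier G"
  shows "conj_by k g \<in> K"
  unfolding conj_by_def using normal.inv_op_closed1[OF assms(1,3,2)] .

lemma normal_conj_by_iff:
  assumes "K \<lhd> G" "x \<in> carrier G" "g \<in> carrier G"
  shows "conj_by x g \<in> K \<longleftrightarrow> x \<in> K"
proof
  assume "conj_by x g \<in> K"
  then have "conj_by (conj_by x g) (inv g) \<in> K" using normal_conj_by assms by blast
  then show "x \<in> K" using assms by (simp add: conj_by_conj_by)
qed (use assms normal_conj_by in blast)

lemma normalI_conj_by:
  assumes "subgroup N G" and "\<And>x g. x \<in> N \<Longrightarrow> g \<in> carrier G \<Longrightarrow> conj_by x g \<in> N"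
  shows "N \<lhd> G"
proof -
  have "g \<otimes> x \<otimes> inv g \<in> N" if "g \<in> carrier G" "x \<in> N" for g x
    using assms(2)[of x "inv g"] that by (simp add: conj_by_def)
  then show ?thesis using assms(1) normal_inv_iff by blast
qed

lemma normal_comm_left:
  assumes "K \<lhd> G" "k \<in> K" "g \<in> carrier G"
  shows "comm k g \<in> K"
proof -
  have K: "subgroup K G" using assms(1) by (rule normal_imp_subgroup)
  then have "k \<in> carrier G" using assms(2) subgroup.mem_carrier by metis
  then have "comm k g = inv k \<otimes> conj_by k g" using assms(3) by (simp add: group_word)
  then show ?thesis using normal_conj_by[OF assms] K assms(2)
    by (simp add: subgroup.m_closed subgroup.m_inv_closed)
qed

lemma normal_comm_swap:
  assumes "K \<lhd> G" "x \<in> carrier G" "y \<in> carrier G"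
  shows "comm x y \<in> K \<longleftrightarrow> comm y x \<in> K"
  using assms inv_comm normal_imp_subgroup[OF assms(1)]
  by (metis comm_closed subgroup.m_inv_closed)

lemma normal_comm_inv_left:
  assumes "K \<lhd> G" "x \<in> carrier G" "y \<in> carrier G"
  shows "comm (inv x) y \<in> K \<longleftrightarrow> comm x y \<in> K"
proof -
  have "comm (inv x) y = conj_by (inv (comm x y)) (inv x)" using assms by (simp add: group_word)
  then show ?thesis using assms normal_conj_by_iff[OF assms(1)]
    by (metis comm_closed inv_closed inv_inv normal_imp_subgroup subgroup.m_inv_closed)
qed

lemma normal_comm_inv_right:
  assumes "K \<lhd> G" "x \<in> carrier G" "y \<in> carrier G"
  shows "comm x (inv y) \<in> K \<longleftrightarrow> comm x y \<in> K"
  using assms normal_comm_swap normal_comm_inv_left by (metis inv_closed)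

lemma normal_mult_iff:
  assumes "K \<lhd> G" "k \<in> K" "x \<in> carrier G"
  shows "k \<otimes> x \<in> K \<longleftrightarrow> x \<in> K" and "x \<otimes> k \<in> K \<longleftrightarrow> x \<in> K"
proof -
  have K: "subgroup K G" using assms(1) by (rule normal_imp_subgroup)
  have k: "k \<in> carrier G" using K assms(2) subgroup.mem_carrier by metis
  show "k \<otimes> x \<in> K \<longleftrightarrow> x \<in> K"
    using K k assms by (metis cancel_inv_left subgroup.m_closed subgroup.m_inv_closed)
  show "x \<otimes> k \<in> K \<longleftrightarrow> x \<in> K"
    using K k assms by (metis inv_solve_right m_closed subgroup.m_closed subgroup.m_inv_closed)
qed

text \<open>Modulo \<open>K\<close> this is a centralizer. Through it a commutator relation checked
  on generators spreads to the group they generate.\<close>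

lemma subgroup_comm_in:
  assumes K: "K \<lhd> G" and X: "X \<subseteq> carrier G"
  shows "subgroup {y \<in> carrier G. \<forall>x\<in>X. comm y x \<in> K} G"
proof (rule subgroupI)
  have Ks: "subgroup K G" using K by (rule normal_imp_subgroup)
  show "{y \<in> carrier G. \<forall>x\<in>X. comm y x \<in> K} \<noteq> {}"
  proof -
    have "comm \<one> x = \<one>" if "x \<in> X" for x using X that by (simp add: comm_def subset_iff)
    then show ?thesis using subgroup.one_closed[OF Ks] by auto
  qed
  fix a assume a: "a \<in> {y \<in> carrier G. \<forall>x\<in>X. comm y x \<in> K}"
  then show "inv a \<in> {y \<in> carrier G. \<forall>x\<in>X. comm y x \<in> K}"
    using X normal_comm_inv_left[OF K] by auto
  fix b assume b: "b \<in> {y \<in> carrier G. \<forall>x\<in>X. comm y x \<in> K}"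
  have "comm (a \<otimes> b) x \<in> K" if "x \<in> X" for x
  proof -
    have "x \<in> carrier G" using that X by auto
    then show ?thesis
      using a b that comm_mult_left normal_conj_by[OF K] subgroup.m_closed[OF Ks] by simp
  qed
  then show "a \<otimes> b \<in> {y \<in> carrier G. \<forall>x\<in>X. comm y x \<in> K}" using a b by auto
qed auto

lemma subgroup_comm_in_right:
  assumes "K \<lhd> G" and "X \<subseteq> carrier G"
  shows "subgroup {y \<in> carrier G. \<forall>x\<in>X. comm x y \<in> K} G"
proof -
  have "{y \<in> carrier G. \<forall>x\<in>X. comm x y \<in> K} = {y \<in> carrier G. \<forall>x\<in>X. comm y x \<in> K}"
    using assms normal_comm_swap by blast
  then show ?thesis using subgroup_comm_in[OF assms] by simp
qed

text \<open>Two factors of the Hall-Witt identity are conjugates of elements of \<open>K\<close>, so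
  the third lies in \<open>K\<close> too. Working with elements instead of subgroups keeps track of
  single commutators, as the study of two-step centralizers requires.\<close>

lemma three_subgroups:
  assumes K: "K \<lhd> G" and xyz: "x \<in> carrier G" "y \<in> carrier G" "z \<in> carrier G"
    and A: "comm (comm x (inv y)) z \<in> K" and C: "comm (comm z (inv x)) y \<in> K"
  shows "comm (comm y (inv z)) x \<in> K"
proof -
  have Ks: "subgroup K G" using K by (rule normal_imp_subgroup)
  define a b c where "a = conj_by (comm (comm x (inv y)) z) y"
    and "b = conj_by (comm (comm y (inv z)) x) z"
    and "c = conj_by (comm (comm z (inv x)) y) x"
  have a: "a \<in> K" and c: "c \<in> K" using K xyz A C by (auto simp: a_def c_def intro: normal_conj_by)
  have b: "b \<in> carrier G" using xyz by (simp add: b_def)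
  have "a \<otimes> b \<otimes> c = \<one>" unfolding a_def b_def c_def using xyz by (rule hall_witt)
  then have "a \<otimes> b \<otimes> c \<in> K" using subgroup.one_closed[OF Ks] by simp
  then have "a \<otimes> b \<in> K" using normal_mult_iff(2)[OF K c] a b Ks
    by (meson m_closed subgroup.mem_carrier)
  then have "b \<in> K" using normal_mult_iff(1)[OF K a b] by simp
  then show ?thesis unfolding b_def using xyz normal_conj_by_iff[OF K] by simp
qed

end

section \<open>The lower central series\<close>

text \<open>Both index 0 and index 1 give the whole group, so that the commutator of the terms with indices
  \<open>i\<close> and \<open>j\<close> lies in the term with index \<open>i + j\<close> without side conditions.\<close>

definition lcs :: "('g, 'm) monoid_scheme \<Rightarrow> nat \<Rightarrow> 'g set" where
  "lcs G k = lower_central G (k - 1)"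

context group
begin

lemma lcs_0 [simp]: "lcs G 0 = carrier G" and lcs_1 [simp]: "lcs G (Suc 0) = carrier G"
  by (simp_all add: lcs_def)

lemma lower_central_normal: "lower_central G i \<lhd> G"
proof (induction i)
  case 0
  then show ?case by (simp add: normal_self)
next
  case (Suc i)
  note N = Suc.IH
  have sub: "lower_central G i \<subseteq> carrier G"
    using N normal_imp_subgroup subgroup.subset by blast
  show ?case unfolding lower_central.simps
  proof (rule normal_generateI)
    show "(\<Union>x\<in>lower_central G i. \<Union>y\<in>carrier G. {x \<otimes> y \<otimes> inv x \<otimes> inv y}) \<subseteq> carrier G"
      using sub by auto
    fix h g
    assume h: "h \<in> (\<Union>x\<in>lower_central G i. \<Union>y\<in>carrier G. {x \<otimes> y \<otimes> inv x \<otimes> inv y})"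
      and g: "g \<in> carrier G"
    from h obtain x y where x: "x \<in> lower_central G i" and y: "y \<in> carrier G"
      and h: "h = x \<otimes> y \<otimes> inv x \<otimes> inv y" by auto
    have xc: "x \<in> carrier G" using x sub by auto
    have "g \<otimes> h \<otimes> inv g = conj_by x (inv g) \<otimes> conj_by y (inv g) \<otimes> inv (conj_by x (inv g))
        \<otimes> inv (conj_by y (inv g))"
      using xc y g h by (simp add: group_word)
    moreover have "conj_by x (inv g) \<in> lower_central G i"
      using normal_conj_by[OF N x] g by simp
    ultimately show "g \<otimes> h \<otimes> inv g \<in> (\<Union>x\<in>lower_central G i. \<Union>y\<in>carrier G. {x \<otimes> y \<otimes> inv x \<otimes> inv y})"
      using y g by blast
  qed
qed

lemma lcs_normal: "lcs G i \<lhd> G"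
  unfolding lcs_def by (rule lower_central_normal)

lemma lcs_subgroup: "subgroup (lcs G i) G"
  using lcs_normal by (rule normal_imp_subgroup)

lemma lcs_carrier: "x \<in> lcs G i \<Longrightarrow> x \<in> carrier G"
  using lcs_subgroup subgroup.mem_carrier by metis

lemma lcs_subset_carrier: "lcs G i \<subseteq> carrier G"
  using lcs_carrier by blast

text \<open>The case \<open>i = 0\<close> is excluded because \<open>lcs G 1\<close> is the whole
  group, not the derived subgroup.\<close>

lemma lcs_Suc_least:
  assumes "1 \<le> i" and H: "subgroup H G" and "\<And>x g. x \<in> lcs G i \<Longrightarrow> g \<in> carrier G \<Longrightarrow> comm x g \<in> H"
  shows "lcs G (Suc i) \<subseteq> H"
proof -
  have i: "lcs G (Suc i) = generate G (\<Union>x\<in>lcs G i. \<Union>y\<in>carrier G. {x \<otimes> y \<otimes> inv x \<otimes> inv y})"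
    using \<open>1 \<le> i\<close> by (cases i) (simp_all add: lcs_def)
  have "x \<otimes> y \<otimes> inv x \<otimes> inv y \<in> H" if "x \<in> lcs G i" "y \<in> carrier G" for x y
  proof -
    have "x \<otimes> y \<otimes> inv x \<otimes> inv y = comm (inv x) (inv y)"
      using that lcs_carrier by (simp add: comm_def)
    then show ?thesis using assms(3)[of "inv x" "inv y"] that lcs_subgroup
      by (simp add: subgroup.m_inv_closed)
  qed
  then show ?thesis unfolding i by (intro generate_subgroup_incl[OF _ H]) auto
qed

lemma comm_lcs_Suc:
  assumes "x \<in> lcs G i" "g \<in> carrier G"
  shows "comm x g \<in> lcs G (Suc i)"
proof (cases i)
  case 0
  then show ?thesis using assms by simp
next
  case (Suc j)
  have x: "x \<in> carrier G" using assms(1) by (rule lcs_carrier)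
  have "comm x g = inv x \<otimes> inv g \<otimes> inv (inv x) \<otimes> inv (inv g)"
    using x assms by (simp add: comm_def)
  moreover have "inv x \<in> lcs G i" using assms(1) lcs_subgroup by (simp add: subgroup.m_inv_closed)
  ultimately have "comm x g \<in> (\<Union>x\<in>lcs G i. \<Union>y\<in>carrier G. {x \<otimes> y \<otimes> inv x \<otimes> inv y})"
    using assms(2) by blast
  then show ?thesis using Suc by (simp add: lcs_def generate.incl)
qed

lemma lcs_Suc_subset: "lcs G (Suc i) \<subseteq> lcs G i"
proof (cases "1 \<le> i")
  case True
  then show ?thesis
    using lcs_Suc_least[OF True lcs_subgroup] normal_comm_left[OF lcs_normal] by blast
next
  case False
  then have "i = 0" by simp
  then show ?thesis by simp
qed

lemma lcs_antimono: "i \<le> j \<Longrightarrow> lcs G j \<subseteq> lcs G i"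
  using lift_Suc_antimono_le[of "lcs G"] lcs_Suc_subset by blast

lemma lcs_antimonoD: "x \<in> lcs G j \<Longrightarrow> i \<le> j \<Longrightarrow> x \<in> lcs G i"
  using lcs_antimono by blast

lemma lcs_m_closed: "x \<in> lcs G i \<Longrightarrow> y \<in> lcs G i \<Longrightarrow> x \<otimes> y \<in> lcs G i"
  using lcs_subgroup by (simp add: subgroup.m_closed)

lemma lcs_inv_closed: "x \<in> lcs G i \<Longrightarrow> inv x \<in> lcs G i"
  using lcs_subgroup by (simp add: subgroup.m_inv_closed)

lemma lcs_one_closed [simp]: "\<one> \<in> lcs G i"
  using lcs_subgroup by (simp add: subgroup.one_closed)

lemma comm_lcs: "x \<in> lcs G i \<Longrightarrow> y \<in> lcs G j \<Longrightarrow> comm x y \<in> lcs G (i + j)"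
proof (induction j arbitrary: i x y)
  case 0
  then show ?case using normal_comm_left[OF lcs_normal] by simp
next
  case (Suc j)
  show ?case
  proof (cases "j = 0")
    case True
    then show ?thesis using Suc.prems comm_lcs_Suc by simp
  next
    case False
    let ?H = "{w \<in> carrier G. \<forall>x\<in>lcs G i. comm w x \<in> lcs G (i + Suc j)}"
    have "lcs G (Suc j) \<subseteq> ?H"
    proof (rule lcs_Suc_least)
      show "subgroup ?H G"
        by (intro subgroup_comm_in lcs_normal lcs_subset_carrier)
      fix y g assume y: "y \<in> lcs G j" and g: "g \<in> carrier G"
      have yc: "y \<in> carrier G" using y by (rule lcs_carrier)
      have "comm (comm y g) x \<in> lcs G (i + Suc j)" if x: "x \<in> lcs G i" for x
      proof -
        have xc: "x \<in> carrier G" using x by (rule lcs_carrier)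
        \<comment> \<open>The generators \<open>comm y g\<close> of the next term enter
          \<open>three_subgroups\<close> with \<open>inv g\<close> as third element; the two other
          commutators are reached by the induction hypothesis, once at \<open>i\<close> and once at
          \<open>i + 1\<close>.\<close>
        have "comm (comm y (inv (inv g))) x \<in> lcs G (i + Suc j)"
        proof (rule three_subgroups[OF lcs_normal xc yc])
          show "inv g \<in> carrier G" using g by simp
          show "comm (comm x (inv y)) (inv g) \<in> lcs G (i + Suc j)"
            using comm_lcs_Suc[OF Suc.IH[OF x lcs_inv_closed[OF y]]] g by simp
          have "comm (inv g) (inv x) \<in> lcs G (Suc i)"
            using normal_comm_swap[OF lcs_normal] comm_lcs_Suc[OF lcs_inv_closed[OF x], of "inv g"] xc g
            by (meson inv_closed)
          then show "comm (comm (inv g) (inv x)) y \<in> lcs G (i + Suc j)"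
            using Suc.IH[of _ "Suc i", OF _ y] by simp
        qed
        then show ?thesis using g by simp
      qed
      then show "comm y g \<in> ?H" using yc g by simp
    qed (use False in simp)
    then show ?thesis using Suc.prems normal_comm_swap[OF lcs_normal] lcs_carrier by blast
  qed
qed

lemma normal_if_lcs_2:
  assumes M: "subgroup M G" "lcs G 2 \<subseteq> M"
  shows "M \<lhd> G"
proof (rule normalI_conj_by[OF M(1)])
  fix x g assume x: "x \<in> M" and g: "g \<in> carrier G"
  have xc: "x \<in> carrier G" using M(1) x by (rule subgroup.mem_carrier)
  have "comm x g \<in> M" using comm_lcs_Suc[of x 1 g] xc g M(2) by (auto simp: numeral_2_eq_2)
  then show "conj_by x g \<in> M" using conj_by_eq[OF xc g] x M(1) by (simp add: subgroup.m_closed)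
qed

lemma comm_lcs_le:
  assumes "x \<in> lcs G i" "y \<in> lcs G j" "k \<le> i + j"
  shows "comm x y \<in> lcs G k"
  using comm_lcs[OF assms(1,2)] assms(3) by (rule lcs_antimonoD)

end

section \<open>Finite p-groups\<close>

lemma card_image_le_card_image:
  assumes "finite A" and "\<And>x y. x \<in> A \<Longrightarrow> y \<in> A \<Longrightarrow> f x = f y \<Longrightarrow> g x = g y"
  shows "card (g ` A) \<le> card (f ` A)"
proof -
  have "g x = g (inv_into A f (f x))" if "x \<in> A" for x
    using that assms(2) f_inv_into_f[of "f x" f A] inv_into_into[of "f x" f A] by (metis imageI)
  then have "g ` A = (\<lambda>u. g (inv_into A f u)) ` f ` A"
    unfolding image_image by (rule image_cong[OF refl])
  then show ?thesis using card_image_le[OF finite_imageI[OF assms(1)]] by metis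
qed

context group
begin

lemma subgroup_card_dvd:
  assumes "subgroup H G" "subgroup K G" "H \<subseteq> K"
  shows "card H dvd card K"
proof -
  interpret K: group "G\<lparr>carrier := K\<rparr>" using assms(2) by (rule subgroup_imp_group)
  have "subgroup H (G\<lparr>carrier := K\<rparr>)" using assms by (simp add: subgroup_incl)
  then have "card (rcosets\<^bsub>G\<lparr>carrier := K\<rparr>\<^esub> H) * card H = card K"
    using K.lagrange by (simp add: Coset.order_def)
  then show ?thesis by (metis dvd_triv_right)
qed

text \<open>Orders are powers of p, so a subgroup that grows beyond \<open>H\<close> grows by a
  factor of at least p and already exhausts \<open>K\<close>. The index enters as an inequality
  because that is what coset counting supplies.\<close>

lemma prime_index_subgroup_eq:
  assumes "finite (carrier G)" "prime p" "subgroup H G" "subgroup L G" "subgroup K G"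
    and "H \<subseteq> L" "L \<subseteq> K" "L \<noteq> H" "card K \<le> p * card H" "card K = p ^ n"
  shows "L = K"
proof -
  have fin: "finite K" "finite L" using assms by (meson finite_subset subgroup.subset)+
  have dv: "card H dvd p ^ n" "card L dvd p ^ n"
    using subgroup_card_dvd[of H K] subgroup_card_dvd[of L K] assms by auto
  obtain a where a: "card H = p ^ a" using dv(1) assms(2) divides_primepow_nat by metis
  obtain b where b: "card L = p ^ b" using dv(2) assms(2) divides_primepow_nat by metis
  note abc = a b
  have "card H < card L" using fin assms by (simp add: psubset_card_mono psubset_eq)
  then have "a < b" using abc assms(2) by (metis power_less_imp_less_exp prime_gt_1_nat)
  then have "p * card H \<le> card L" using abc assms(2)
    by (metis Suc_leI power_Suc power_increasing prime_ge_1_nat)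
  then have "card K \<le> card L" using assms(9) by linarith
  then show ?thesis using fin assms(7) by (simp add: card_seteq)
qed

end

text \<open>Orbits under a p-group have p-power length, so with x as the only fixed point
  \<open>card E\<close> would be 1 modulo p. In the application x is the identity and the second
  fixed point is a non-trivial central element.\<close>

lemma (in group_action) fixed_points_mod_p:
  assumes G: "card (carrier G) = p ^ n" and p: "prime p" and fin: "finite E" and dv: "p dvd card E"
    and x: "x \<in> E" "\<And>g. g \<in> carrier G \<Longrightarrow> \<phi> g x = x"
  shows "\<exists>y\<in>E. y \<noteq> x \<and> (\<forall>g\<in>carrier G. \<phi> g y = y)"
proof (rule ccontr)
  assume neg: "\<not> ?thesis"
  have part: "partition E (orbits G E \<phi>)" by (rule orbit_partition)
  have finG: "finite (carrier G)" using G p by (metis card.infinite not_prime_0 power_not_zero)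
  have orb: "p dvd card R" if R: "R \<in> orbits G E \<phi>" "x \<notin> R" for R
  proof -
    obtain y where y: "y \<in> E" "R = orbit G \<phi> y" using R by (auto simp: orbits_def)
    have yR: "y \<in> R" using y orbit_refl by simp
    have "card R * card (stabilizer G \<phi> y) = p ^ n"
      using orbit_stabilizer_theorem[OF y(1)] G y by (simp add: Coset.order_def)
    then have "card R dvd p ^ n" by (metis dvd_triv_left)
    then obtain k where k: "card R = p ^ k" using p divides_primepow_nat by metis
    have "card R \<noteq> 1"
    proof
      assume "card R = 1"
      then obtain u where "R = {u}" by (auto simp: card_1_singleton_iff)
      then have "R = {y}" using yR by auto
      then have "\<forall>g\<in>carrier G. \<phi> g y = y" using y by (auto simp: orbit_def)
      then have "y = x" using neg y by auto
      then show False using yR R by simp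
    qed
    then have "k \<noteq> 0" using k by auto
    then show ?thesis using k by simp
  qed
  have ox: "orbit G \<phi> x = {x}"
    using x orbit_refl[OF x(1)] by (auto simp: orbit_def)
  have ox_in: "{x} \<in> orbits G E \<phi>" using ox x by (auto simp: orbits_def)
  have finO: "finite (orbits G E \<phi>)"
    using fin by (simp add: orbits_def Setcompr_eq_image)
  have "card E = sum card (orbits G E \<phi>)"
  proof -
    have "E = \<Union> (orbits G E \<phi>)"
      using part by (auto simp: partition_def)
    moreover have "card (\<Union> (orbits G E \<phi>)) = sum card (orbits G E \<phi>)"
    proof (rule card_Union_disjoint)
      show "pairwise disjnt (orbits G E \<phi>)"
        using part unfolding partition_def pairwise_def disjnt_def by blast
      show "\<And>A. A \<in> orbits G E \<phi> \<Longrightarrow> finite A"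
        using fin part unfolding partition_def by (meson finite_subset)
    qed
    ultimately show ?thesis by simp
  qed
  also have "\<dots> = 1 + sum card (orbits G E \<phi> - {{x}})"
    using sum.remove[OF finO ox_in, of card] by simp
  finally have "card E = 1 + sum card (orbits G E \<phi> - {{x}})" .
  moreover have "p dvd sum card (orbits G E \<phi> - {{x}})"
  proof (rule dvd_sum)
    fix R assume R: "R \<in> orbits G E \<phi> - {{x}}"
    have "x \<notin> R"
    proof
      assume "x \<in> R"
      then show False using part R ox_in x(1) unfolding partition_def by blast
    qed
    then show "p dvd card R" using orb R by simp
  qed
  ultimately have "p dvd 1" using dv by (metis dvd_add_left_iff)
  then show False using p by simp
qed

lemma (in group) normal_meets_center:
  assumes G: "card (carrier G) = p ^ n" and p: "prime p" and N: "N \<lhd> G" and "N \<noteq> {\<one>}"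
  shows "\<exists>z\<in>N. z \<noteq> \<one> \<and> z \<in> center G"
proof -
  have Ns: "subgroup N G" using N by (rule normal_imp_subgroup)
  have sub: "N \<subseteq> carrier G" using Ns by (rule subgroup.subset)
  have finG: "finite (carrier G)" using G p by (metis card.infinite not_prime_0 power_not_zero)
  then have fin: "finite N" using sub by (rule finite_subset[rotated])
  \<comment> \<open>The restriction to \<open>N\<close> makes \<open>\<phi> g\<close> extensional,
    as membership in \<open>BijGroup N\<close> demands.\<close>
  define \<phi> where "\<phi> g = (\<lambda>x \<in> N. g \<otimes> x \<otimes> inv g)" for g
  have conj: "g \<otimes> x \<otimes> inv g \<in> N" if "g \<in> carrier G" "x \<in> N" for g x
    using normal.inv_op_closed2[OF N that] .
  have mult: "\<phi> (g \<otimes> h) x = \<phi> g (\<phi> h x)" if "g \<in> carrier G" "h \<in> carrier G" "x \<in> N" for g h x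
  proof -
    have "x \<in> carrier G" using that sub by auto
    then show ?thesis using that conj[OF that(2,3)] conj[of "g \<otimes> h" x]
      by (simp add: \<phi>_def m_assoc inv_mult_group)
  qed
  have one: "\<phi> \<one> x = x" if "x \<in> N" for x
    using that sub by (auto simp: \<phi>_def)
  have clos: "\<phi> g x \<in> N" if "g \<in> carrier G" "x \<in> N" for g x
    using that conj by (simp add: \<phi>_def)
  have bij: "\<phi> g \<in> Bij N" if g: "g \<in> carrier G" for g
  proof -
    have "bij_betw (\<phi> g) N N"
      by (rule bij_betw_byWitness[where f' = "\<phi> (inv g)"])
        (use g clos mult one in \<open>auto simp: mult[symmetric]\<close>)
    then show ?thesis by (simp add: Bij_def \<phi>_def)
  qed
  interpret group_action G N \<phi>
  proof (unfold group_action_def, rule group_hom.intro)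
    show "group_hom_axioms G (BijGroup N) \<phi>"
    proof (rule group_hom_axioms.intro, rule homI)
      show "\<phi> g \<in> carrier (BijGroup N)" if "g \<in> carrier G" for g
        using bij that by (simp add: BijGroup_def)
      fix g h assume gh: "g \<in> carrier G" "h \<in> carrier G"
      have "\<phi> (g \<otimes> h) = compose N (\<phi> g) (\<phi> h)"
      proof
        fix x show "\<phi> (g \<otimes> h) x = compose N (\<phi> g) (\<phi> h) x"
          using mult[OF gh] by (cases "x \<in> N") (auto simp: compose_def \<phi>_def)
      qed
      then show "\<phi> (g \<otimes> h) = \<phi> g \<otimes>\<^bsub>BijGroup N\<^esub> \<phi> h"
        using bij gh by (simp add: BijGroup_def)
    qed
  qed (simp_all add: group_axioms group_BijGroup)
  have "card N dvd p ^ n" using subgroup_card_dvd[OF Ns subgroup_self sub] G by simp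
  then obtain k where k: "card N = p ^ k" using p divides_primepow_nat by metis
  have one_N: "\<one> \<in> N" using Ns by (rule subgroup.one_closed)
  have "card N \<noteq> 1"
  proof
    assume "card N = 1"
    then obtain u where "N = {u}" by (auto simp: card_1_singleton_iff)
    then show False using one_N \<open>N \<noteq> {\<one>}\<close> by auto
  qed
  then have "p dvd card N" using k by (cases k) auto
  from fixed_points_mod_p[OF G p fin this one_N]
  obtain z where z: "z \<in> N" "z \<noteq> \<one>" "\<And>g. g \<in> carrier G \<Longrightarrow> \<phi> g z = z"
    using one_N by (auto simp: \<phi>_def)
  have zc: "z \<in> carrier G" using z sub by auto
  have "z \<otimes> g = g \<otimes> z" if g: "g \<in> carrier G" for g
  proof -
    have "g \<otimes> z \<otimes> inv g = z" using z(1) z(3)[OF g] by (simp add: \<phi>_def)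
    then show ?thesis using g zc by (metis inv_solve_right m_closed)
  qed
  then show ?thesis using z zc by (auto simp: center_def)
qed

section \<open>Polynomial sequences in a filtered group\<close>

context group
begin

definition seq_diff :: "(nat \<Rightarrow> 'a) \<Rightarrow> nat \<Rightarrow> 'a" where
  "seq_diff g m = inv (g m) \<otimes> g (Suc m)"

text \<open>The depth \<open>d\<close> truncates the usual definition of a polynomial sequence, which allows to prove
  closure under products by induction on \<open>d\<close>.\<close>

primrec seq_poly :: "(nat \<Rightarrow> 'a set) \<Rightarrow> nat \<Rightarrow> nat \<Rightarrow> (nat \<Rightarrow> 'a) \<Rightarrow> bool" where
  "seq_poly F 0 k g \<longleftrightarrow> (\<forall>m. g m \<in> F k)"
| "seq_poly F (Suc d) k g \<longleftrightarrow> (\<forall>m. g m \<in> F k) \<and> seq_poly F d (Suc k) (seq_diff g)"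

lemma seq_polyD: "seq_poly F d k g \<Longrightarrow> g m \<in> F k"
  by (cases d) auto

lemma seq_poly_SucD: "seq_poly F (Suc d) k g \<Longrightarrow> seq_poly F d k g"
  by (induction d arbitrary: k g) (auto dest: seq_polyD)

lemma seq_poly_diffD: "seq_poly F d k g \<Longrightarrow> i \<le> d \<Longrightarrow> (seq_diff ^^ i) g m \<in> F (k + i)"
proof (induction i arbitrary: d k g)
  case 0
  then show ?case using seq_polyD by simp
next
  case (Suc i)
  then obtain e where "d = Suc e" by (cases d) auto
  then show ?case using Suc.IH[of e "Suc k" "seq_diff g"] Suc.prems
    by (simp add: funpow_swap1)
qed

lemma seq_polyI: "(\<And>i m. i \<le> d \<Longrightarrow> (seq_diff ^^ i) g m \<in> F (k + i)) \<Longrightarrow> seq_poly F d k g"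
proof (induction d arbitrary: k g)
  case 0
  then show ?case using 0[of 0] by simp
next
  case (Suc d)
  have "seq_poly F d (Suc k) (seq_diff g)"
  proof (rule Suc.IH)
    fix i m assume "i \<le> d"
    then show "(seq_diff ^^ i) (seq_diff g) m \<in> F (Suc k + i)"
      using Suc.prems[of "Suc i" m] by (simp add: funpow_swap1)
  qed
  then show ?case using Suc.prems[of 0] by simp
qed

end

text \<open>The commutator condition gains one more than an ordinary filtration would; this makes the
  top difference of a product the product of the top differences.\<close>

locale filtered_group = group G for G (structure) +
  fixes F :: "nat \<Rightarrow> 'a set"
  assumes F_normal: "F k \<lhd> G"
    and F_Suc: "F (Suc k) \<subseteq> F k"
    and F_comm: "x \<in> F i \<Longrightarrow> y \<in> F j \<Longrightarrow> comm x y \<in> F (Suc (i + j))"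
begin

lemma F_antimono: "i \<le> j \<Longrightarrow> F j \<subseteq> F i"
  using lift_Suc_antimono_le[of F] F_Suc by blast

lemma F_subgroup: "subgroup (F k) G"
  using F_normal by (rule normal_imp_subgroup)

lemma F_carrier [simp]: "x \<in> F k \<Longrightarrow> x \<in> carrier G"
  using F_subgroup subgroup.mem_carrier by metis

lemma F_m_closed: "x \<in> F k \<Longrightarrow> y \<in> F k \<Longrightarrow> x \<otimes> y \<in> F k"
  using F_subgroup by (simp add: subgroup.m_closed)

lemma F_inv_closed: "x \<in> F k \<Longrightarrow> inv x \<in> F k"
  using F_subgroup by (simp add: subgroup.m_inv_closed)

lemma seq_poly_carrier: "seq_poly F d k g \<Longrightarrow> g m \<in> carrier G"
  using seq_polyD F_carrier by blast

lemma seq_poly_mono: "seq_poly F d k g \<Longrightarrow> j \<le> k \<Longrightarrow> seq_poly F d j g"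
  by (induction d arbitrary: j k g) (use F_antimono in \<open>fastforce\<close>)+

text \<open>This is the theorem of Lazard and Leibman. Products cannot be treated alone: the
  difference of a product contains a conjugate, hence a commutator, and the difference of a
  commutator is a product of commutators that involve differences. The depth \<open>d\<close> drops
  in both cases, so a joint induction succeeds.\<close>

lemma seq_poly_closed:
  "(\<forall>k g h. seq_poly F d k g \<longrightarrow> seq_poly F d k h \<longrightarrow> seq_poly F d k (\<lambda>m. g m \<otimes> h m)) \<and>
   (\<forall>i j g h. seq_poly F d i g \<longrightarrow> seq_poly F d j h \<longrightarrow>
      seq_poly F d (Suc (i + j)) (\<lambda>m. comm (g m) (h m)))"
proof (induction d)
  case 0
  show ?case using F_m_closed F_inv_closed F_comm by simp
next
  case (Suc d)
  have M: "seq_poly F d k (\<lambda>m. g m \<otimes> h m)" if "seq_poly F d k g" "seq_poly F d k h" for k g h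
    using Suc that by blast
  have C: "seq_poly F d (Suc (i + j)) (\<lambda>m. comm (g m) (h m))"
    if "seq_poly F d i g" "seq_poly F d j h" for i j g h
    using Suc that by blast
  have C': "seq_poly F d l (\<lambda>m. comm (g m) (h m))"
    if "seq_poly F d i g" "seq_poly F d j h" "l \<le> Suc (i + j)" for i j l g h
    using C[OF that(1,2)] that(3) by (rule seq_poly_mono)
  have J: "seq_poly F d k (\<lambda>m. conj_by (g m) (h m))"
    if g: "seq_poly F d k g" and h: "seq_poly F d j h" for k j g h
  proof -
    have "(\<lambda>m. conj_by (g m) (h m)) = (\<lambda>m. g m \<otimes> comm (g m) (h m))"
      using g h conj_by_eq seq_poly_carrier by blast
    then show ?thesis using M[OF g C'[OF g h]] by simp
  qed
  show ?case
  proof (intro conjI allI impI)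
    fix k g h assume g: "seq_poly F (Suc d) k g" and h: "seq_poly F (Suc d) k h"
    have gc: "g m \<in> carrier G" and hc: "h m \<in> carrier G" for m
      using g h seq_poly_carrier by blast+
    have "seq_diff (\<lambda>m. g m \<otimes> h m) = (\<lambda>m. conj_by (seq_diff g m) (h m) \<otimes> seq_diff h m)"
      using gc hc by (intro ext) (simp add: seq_diff_def group_word)
    moreover have "seq_poly F d (Suc k) (\<lambda>m. conj_by (seq_diff g m) (h m) \<otimes> seq_diff h m)"
      using g h J[of "Suc k" "seq_diff g" k h] seq_poly_SucD[OF h] by (intro M) auto
    ultimately show "seq_poly F (Suc d) k (\<lambda>m. g m \<otimes> h m)"
      using seq_polyD[OF g] seq_polyD[OF h] F_m_closed by simp
  next
    fix i j g h assume g: "seq_poly F (Suc d) i g" and h: "seq_poly F (Suc d) j h"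
    define a b q where "a = seq_diff g" and "b = seq_diff h" and "q m = comm (g m) (h m)" for m
    have gc: "g m \<in> carrier G" and hc: "h m \<in> carrier G" for m
      using g h seq_poly_carrier by blast+
    then have abc: "a m \<in> carrier G" "b m \<in> carrier G" "q m \<in> carrier G" for m
      by (simp_all add: a_def b_def q_def seq_diff_def)
    have a: "seq_poly F d (Suc i) a" and b: "seq_poly F d (Suc j) b" using g h by (simp_all add: a_def b_def)
    have g': "seq_poly F d i g" and h': "seq_poly F d j h" using g h seq_poly_SucD by blast+
    have q: "seq_poly F d (Suc (i + j)) q" unfolding q_def by (rule C[OF g' h'])
    \<comment> \<open>The next value of \<open>q\<close> is the commutator of \<open>g a\<close> and
      \<open>h b\<close>. Once \<open>q\<close> is removed from the left, every remaining factor
      involves a difference \<open>a\<close> or \<open>b\<close>.\<close>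
    let ?X = "\<lambda>m. conj_by (conj_by (comm (g m) (b m)) (a m)) (q m)"
    let ?Y = "\<lambda>m. comm (q m) (b m \<otimes> a m)"
    let ?Z = "\<lambda>m. comm (a m) (b m) \<otimes> conj_by (comm (a m) (h m)) (b m)"
    have "seq_diff q m = ?X m \<otimes> (?Y m \<otimes> ?Z m)" for m
    proof -
      have "g (Suc m) = g m \<otimes> a m" "h (Suc m) = h m \<otimes> b m"
        using gc hc by (simp_all add: a_def b_def seq_diff_def cancel_left_inv)
      then have "seq_diff q m = inv (q m) \<otimes> comm (g m \<otimes> a m) (h m \<otimes> b m)"
        by (simp add: seq_diff_def q_def)
      also have "\<dots> = ?X m \<otimes> (?Y m \<otimes> ?Z m)"
        using gc[of m] hc[of m] abc[of m] by (simp add: q_def group_word)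
      finally show ?thesis .
    qed
    then have "seq_diff q = (\<lambda>m. ?X m \<otimes> (?Y m \<otimes> ?Z m))" by (rule ext)
    moreover have "seq_poly F d (Suc (Suc (i + j))) (\<lambda>m. ?X m \<otimes> (?Y m \<otimes> ?Z m))"
    proof (intro M)
      show "seq_poly F d (Suc (Suc (i + j))) ?X"
        by (rule J[OF J[OF C'[OF g' b] a] q]) simp
      \<comment> \<open>Here \<open>a\<close> and \<open>b\<close> count at level 0 only; the extra
        one in \<open>F_comm\<close> supplies the gain over the level of \<open>q\<close>.\<close>
      show "seq_poly F d (Suc (Suc (i + j))) ?Y"
        by (rule C'[OF q M[OF seq_poly_mono[OF b, of 0] seq_poly_mono[OF a, of 0]]]) simp_all
      show "seq_poly F d (Suc (Suc (i + j))) (\<lambda>m. comm (a m) (b m))"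
        by (rule C'[OF a b]) simp
      show "seq_poly F d (Suc (Suc (i + j))) (\<lambda>m. conj_by (comm (a m) (h m)) (b m))"
        by (rule J[OF C'[OF a h'] b]) simp
    qed
    ultimately have "seq_poly F d (Suc (Suc (i + j))) (seq_diff q)"
      by (simp only:)
    then show "seq_poly F (Suc d) (Suc (i + j)) (\<lambda>m. comm (g m) (h m))"
      using seq_polyD[OF q] by (simp add: q_def[symmetric])
  qed
qed

lemma seq_poly_mult: "seq_poly F d k g \<Longrightarrow> seq_poly F d k h \<Longrightarrow> seq_poly F d k (\<lambda>m. g m \<otimes> h m)"
  using seq_poly_closed by blast

lemma seq_poly_comm:
  "seq_poly F d i g \<Longrightarrow> seq_poly F d j h \<Longrightarrow> l \<le> Suc (i + j) \<Longrightarrow>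
    seq_poly F d l (\<lambda>m. comm (g m) (h m))"
  using seq_poly_closed seq_poly_mono by blast

text \<open>The first difference of the product is \<open>a (c b)\<close> with
  \<open>c = [a, h]\<close>. The extra one in \<open>F_comm\<close> puts \<open>c\<close> one level
  deeper than \<open>a\<close> and \<open>b\<close>, so its top difference falls into the error
  term.\<close>

lemma seq_diff_funpow_mult:
  assumes "seq_poly F d k g" "seq_poly F d k h"
  shows "\<exists>w\<in>F (Suc (k + d)).
    (seq_diff ^^ d) (\<lambda>m. g m \<otimes> h m) m = (seq_diff ^^ d) g m \<otimes> (seq_diff ^^ d) h m \<otimes> w"
  using assms
proof (induction d arbitrary: k g h)
  case 0
  then show ?case using subgroup.one_closed[OF F_subgroup]
    by (intro bexI[of _ \<one>]) (simp_all add: F_carrier[of _ k])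
next
  case (Suc d)
  let ?a = "seq_diff g" and ?b = "seq_diff h"
  have a: "seq_poly F d (Suc k) ?a" and b: "seq_poly F d (Suc k) ?b" using Suc.prems by simp_all
  have h': "seq_poly F d k h" using Suc.prems seq_poly_SucD by blast
  let ?c = "\<lambda>m. comm (?a m) (h m)"
  have c: "seq_poly F d (Suc k) ?c" and c': "seq_poly F d (Suc (Suc k)) ?c"
    by (rule seq_poly_comm[OF a h'], simp)+
  have gc: "g m \<in> carrier G" and hc: "h m \<in> carrier G" for m
    using Suc.prems seq_poly_carrier by blast+
  then have abc: "?a m \<in> carrier G" "?b m \<in> carrier G" for m by (simp_all add: seq_diff_def)
  have eq: "seq_diff (\<lambda>m. g m \<otimes> h m) = (\<lambda>m. ?a m \<otimes> (?c m \<otimes> ?b m))"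
    using gc hc by (intro ext) (simp add: seq_diff_def group_word)
  obtain w1 where w1: "w1 \<in> F (Suc (Suc k + d))"
    "(seq_diff ^^ d) (\<lambda>m. ?a m \<otimes> (?c m \<otimes> ?b m)) m
      = (seq_diff ^^ d) ?a m \<otimes> (seq_diff ^^ d) (\<lambda>m. ?c m \<otimes> ?b m) m \<otimes> w1"
    using Suc.IH[OF a seq_poly_mult[OF c b]] by blast
  obtain w2 where w2: "w2 \<in> F (Suc (Suc k + d))"
    "(seq_diff ^^ d) (\<lambda>m. ?c m \<otimes> ?b m) m
      = (seq_diff ^^ d) ?c m \<otimes> (seq_diff ^^ d) ?b m \<otimes> w2"
    using Suc.IH[OF c b] by blast
  let ?A = "(seq_diff ^^ d) ?a m" and ?B = "(seq_diff ^^ d) ?b m" and ?C = "(seq_diff ^^ d) ?c m"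
  have C: "?C \<in> F (Suc (Suc k + d))" using seq_poly_diffD[OF c', of d] by simp
  have A: "?A \<in> carrier G" and B: "?B \<in> carrier G"
    using seq_poly_diffD[OF a, of d] seq_poly_diffD[OF b, of d] by (auto intro: F_carrier)
  have "?A \<otimes> (?C \<otimes> ?B \<otimes> w2) \<otimes> w1 = ?A \<otimes> ?B \<otimes> (conj_by ?C ?B \<otimes> w2 \<otimes> w1)"
    using A B F_carrier[OF C] F_carrier[OF w1(1)] F_carrier[OF w2(1)] by (simp add: group_word)
  moreover have "conj_by ?C ?B \<otimes> w2 \<otimes> w1 \<in> F (Suc (Suc k + d))"
    using normal_conj_by[OF F_normal C B] w1(1) w2(1) by (intro F_m_closed)
  ultimately show ?case using w1(2) w2(2)
    by (simp add: funpow_swap1 eq) blast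
qed

text \<open>At the first index where it is non-trivial, a sequence equals its own Newton
  coefficient; for a polynomial sequence this puts the value into \<open>F i\<close>.\<close>

lemma seq_diff_vanish:
  assumes "\<And>m. m < i \<Longrightarrow> g m = \<one>" "\<And>m. g m \<in> carrier G"
  shows "(seq_diff ^^ i) g 0 = g i"
  using assms
proof (induction i arbitrary: g)
  case (Suc i)
  have "(seq_diff ^^ i) (seq_diff g) 0 = seq_diff g i"
    by (rule Suc.IH) (use Suc.prems in \<open>auto simp: seq_diff_def\<close>)
  moreover have "seq_diff g i = g (Suc i)" using Suc.prems by (simp add: seq_diff_def)
  ultimately show ?case by (simp add: funpow_Suc_right del: funpow.simps)
qed simp

lemma seq_diff_power_binomial:
  assumes "a \<in> carrier G"
  shows "seq_diff (\<lambda>m. a [^] (m choose Suc i)) = (\<lambda>m. a [^] (m choose i))"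
  using assms by (simp add: seq_diff_def nat_pow_mult[symmetric] add.commute[of "_ choose i"] cancel_inv_left fun_eq_iff)

lemma seq_diff_one: "seq_diff (\<lambda>m. \<one>) = (\<lambda>m. \<one>)"
  by (simp add: seq_diff_def fun_eq_iff)

lemma seq_diff_const: "a \<in> carrier G \<Longrightarrow> seq_diff (\<lambda>m. a) = (\<lambda>m. \<one>)"
  by (simp add: seq_diff_def fun_eq_iff)

lemma funpow_seq_diff_one: "(seq_diff ^^ i) (\<lambda>m. \<one>) = (\<lambda>m. \<one>)"
  by (induction i) (simp_all add: seq_diff_one)

lemma funpow_seq_diff_power_binomial:
  assumes "a \<in> carrier G"
  shows "(seq_diff ^^ j) (\<lambda>m. a [^] (m choose i)) = (if j \<le> i then (\<lambda>m. a [^] (m choose (i - j))) else (\<lambda>m. \<one>))"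
proof (induction j arbitrary: i)
  case (Suc j)
  show ?case
  proof (cases i)
    case 0
    then show ?thesis using assms
      by (simp add: funpow_swap1 seq_diff_const funpow_seq_diff_one)
  next
    case (Suc l)
    then show ?thesis using assms Suc.IH[of l]
      by (simp add: funpow_swap1 seq_diff_power_binomial)
  qed
qed simp

lemma seq_poly_power_binomial:
  assumes "a \<in> F i"
  shows "seq_poly F d 0 (\<lambda>m. a [^] (m choose i))"
proof (rule seq_polyI)
  fix j m
  have "a [^] n \<in> F j" if "j \<le> i" for n :: nat
    using assms F_antimono[OF that] F_subgroup
    by (induction n) (auto intro: F_m_closed subgroup.one_closed)
  then show "(seq_diff ^^ j) (\<lambda>m. a [^] (m choose i)) m \<in> F (0 + j)"
    using assms subgroup.one_closed[OF F_subgroup]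
    by (simp add: funpow_seq_diff_power_binomial)
qed

text \<open>A Hall--Petrescu formula at the prime \<open>p\<close>: in the expansion of \<open>g\<close> as a product of
  factors \<open>a\<^sub>i\<close> to the power \<open>m choose i\<close> with \<open>a\<^sub>i \<in> F i\<close>, at \<open>m = p\<close> every factor with \<open>1 < i < p\<close>
  is a power of a \<open>p\<close>-th power, and \<open>a\<^sub>p\<close> is the \<open>p\<close>-th difference up to \<open>F (p + 1)\<close>.\<close>

lemma seq_poly_value_prime:
  assumes p: "prime p" and K: "K \<lhd> G" and FK: "F (Suc p) \<subseteq> K"
    and pow: "\<And>a. a \<in> F 2 \<Longrightarrow> a [^] p \<in> K"
    and g: "seq_poly F p 0 g" and g0: "g 0 = \<one>"
  shows "\<exists>k\<in>K. g p = g 1 [^] p \<otimes> (seq_diff ^^ p) g 0 \<otimes> k"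
proof -
  have Ks: "subgroup K G" using K by (rule normal_imp_subgroup)
  have Kc: "x \<in> carrier G" if "x \<in> K" for x using Ks that by (rule subgroup.mem_carrier)
  have p1: "1 < p" using p by (rule prime_gt_1_nat)
  have gc: "g m \<in> carrier G" for m using g by (rule seq_poly_carrier)
  \<comment> \<open>One factor is split off: the inverse of \<open>h i\<close> to the power
    \<open>m choose i\<close> cancels the value at i and leaves the earlier trivial values alone.
    The p-th difference of this correction vanishes since i is less than p.\<close>
  have peel: "\<exists>h'. seq_poly F p 0 h' \<and> (\<forall>m\<le>i. h' m = \<one>)
      \<and> (\<exists>w\<in>F (Suc p). (seq_diff ^^ p) h' 0 = (seq_diff ^^ p) h 0 \<otimes> w)
      \<and> h p = h i [^] (p choose i) \<otimes> h' p \<and> h i \<in> F i"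
    if h: "seq_poly F p 0 h" and van: "\<forall>m<i. h m = \<one>" and i: "i < p" for h i
  proof -
    have hc: "h m \<in> carrier G" for m using h by (rule seq_poly_carrier)
    have "(seq_diff ^^ i) h 0 = h i" using van hc by (intro seq_diff_vanish) auto
    then have a: "h i \<in> F i" using seq_poly_diffD[OF h, of i 0] i by simp
    define e where "e m = inv (h i) [^] (m choose i)" for m :: nat
    have ia: "inv (h i) \<in> F i" using a by (rule F_inv_closed)
    have e: "seq_poly F p 0 e" unfolding e_def by (rule seq_poly_power_binomial[OF ia])
    define h' where "h' m = e m \<otimes> h m" for m
    have h': "seq_poly F p 0 h'" unfolding h'_def by (rule seq_poly_mult[OF e h])
    have ec: "e m \<in> carrier G" for m using e by (rule seq_poly_carrier)
    have "h' m = \<one>" if "m \<le> i" for m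
      using that van hc by (cases "m = i") (auto simp: h'_def e_def binomial_eq_0)
    moreover have "\<exists>w\<in>F (Suc p). (seq_diff ^^ p) h' 0 = (seq_diff ^^ p) h 0 \<otimes> w"
    proof -
      have "(seq_diff ^^ p) e 0 = \<one>"
        unfolding e_def using i hc by (simp add: funpow_seq_diff_power_binomial)
      then show ?thesis
        using seq_diff_funpow_mult[OF e h, of 0] seq_poly_diffD[OF h, of p 0] unfolding h'_def by auto
    qed
    moreover have "h p = h i [^] (p choose i) \<otimes> h' p"
    proof -
      have "h i [^] (p choose i) \<otimes> e p = \<one>"
        unfolding e_def nat_pow_inv[OF hc] using hc by (intro r_inv nat_pow_closed)
      then show ?thesis using hc ec by (simp add: h'_def m_assoc[symmetric])
    qed
    ultimately show ?thesis using h' a by blast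
  qed
  have main: "\<exists>h. seq_poly F p 0 h \<and> (\<forall>m\<le>i. h m = \<one>)
      \<and> (\<exists>w\<in>F (Suc p). (seq_diff ^^ p) h 0 = (seq_diff ^^ p) g 0 \<otimes> w)
      \<and> (\<exists>k\<in>K. g p = g 1 [^] p \<otimes> k \<otimes> h p)" if "1 \<le> i" "i < p" for i
    using that
  proof (induction i rule: dec_induct)
    case base
    have "\<forall>m<1. g m = \<one>" using g0 by simp
    from peel[OF g this p1] obtain h' where
      "seq_poly F p 0 h'" "\<forall>m\<le>1. h' m = \<one>"
      "\<exists>w\<in>F (Suc p). (seq_diff ^^ p) h' 0 = (seq_diff ^^ p) g 0 \<otimes> w"
      "g p = g 1 [^] (p choose 1) \<otimes> h' p" by blast
    moreover have "p choose 1 = p" by simp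
    moreover have "h' p \<in> carrier G" using calculation(1) by (rule seq_poly_carrier)
    ultimately have "seq_poly F p 0 h'" "\<forall>m\<le>1. h' m = \<one>"
      "\<exists>w\<in>F (Suc p). (seq_diff ^^ p) h' 0 = (seq_diff ^^ p) g 0 \<otimes> w"
      "g p = g 1 [^] p \<otimes> \<one> \<otimes> h' p"
      using gc r_one[of "g 1 [^] p"] by (simp_all del: One_nat_def)
    then show ?case using subgroup.one_closed[OF Ks] by blast
  next
    case (step i)
    have "i < p" using step.prems by simp
    from step.IH[OF this] obtain h w k where h: "seq_poly F p 0 h" "\<forall>m\<le>i. h m = \<one>"
      and w: "w \<in> F (Suc p)" "(seq_diff ^^ p) h 0 = (seq_diff ^^ p) g 0 \<otimes> w"
      and k: "k \<in> K" "g p = g 1 [^] p \<otimes> k \<otimes> h p" by blast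
    from \<open>Suc i < p\<close> h(2) have "\<forall>m<Suc i. h m = \<one>" by simp
    have i1: "1 \<le> i" using step.hyps by simp
    from peel[OF h(1) \<open>\<forall>m<Suc i. h m = \<one>\<close> \<open>Suc i < p\<close>]
    obtain h' w' where h': "seq_poly F p 0 h'" "\<forall>m\<le>Suc i. h' m = \<one>"
      and w': "w' \<in> F (Suc p)" "(seq_diff ^^ p) h' 0 = (seq_diff ^^ p) h 0 \<otimes> w'"
      and eq: "h p = h (Suc i) [^] (p choose Suc i) \<otimes> h' p" and a: "h (Suc i) \<in> F (Suc i)" by blast
    have ac: "h (Suc i) \<in> carrier G" using a by simp
    have "p dvd (p choose Suc i)" using p \<open>Suc i < p\<close> by (intro dvd_choose_prime) auto
    then obtain c where c: "p choose Suc i = p * c" by blast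
    have "h (Suc i) [^] p \<in> K"
      using pow a F_antimono[of 2 "Suc i"] i1 by auto
    then have kk: "h (Suc i) [^] (p choose Suc i) \<in> K"
      using ac Ks unfolding c nat_pow_pow[OF ac, symmetric]
      by (induction c) (auto intro: subgroup.m_closed subgroup.one_closed)
    have "g p = g 1 [^] p \<otimes> (k \<otimes> h (Suc i) [^] (p choose Suc i)) \<otimes> h' p"
      using k(2) eq gc Kc[OF k(1)] ac seq_poly_carrier[OF h'(1)] by (simp add: m_assoc)
    moreover have "k \<otimes> h (Suc i) [^] (p choose Suc i) \<in> K"
      using k(1) kk Ks by (simp add: subgroup.m_closed)
    moreover have "(seq_diff ^^ p) h' 0 = (seq_diff ^^ p) g 0 \<otimes> (w \<otimes> w')"
      using w w' seq_poly_diffD[OF g, of p 0] F_carrier[OF w(1)] F_carrier[OF w'(1)] by (simp add: m_assoc)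
    moreover have "w \<otimes> w' \<in> F (Suc p)" using w w' F_m_closed by blast
    ultimately show ?case using h' by blast
  qed
  \<comment> \<open>Up to p only the value at p itself is left, and it equals the p-th difference at
    0.\<close>
  have "1 \<le> p - 1" "p - 1 < p" using p1 by auto
  from main[OF this] obtain h w k where h: "seq_poly F p 0 h" "\<forall>m\<le>p - 1. h m = \<one>"
    and w: "w \<in> F (Suc p)" "(seq_diff ^^ p) h 0 = (seq_diff ^^ p) g 0 \<otimes> w"
    and k: "k \<in> K" "g p = g 1 [^] p \<otimes> k \<otimes> h p" by blast
  let ?D = "(seq_diff ^^ p) g 0"
  have "h p = ?D \<otimes> w"
    using seq_diff_vanish[of p h] h seq_poly_carrier[OF h(1)] w(2) by auto
  moreover have Dc: "?D \<in> carrier G" using seq_poly_diffD[OF g, of p 0] by auto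
  ultimately have "g p = g 1 [^] p \<otimes> ?D \<otimes> (conj_by k ?D \<otimes> w)"
    using k Kc F_carrier[OF w(1)] gc by (simp add: group_word)
  moreover have "conj_by k ?D \<otimes> w \<in> K"
    using normal_conj_by[OF K k(1) Dc] w(1) FK Ks by (auto intro: subgroup.m_closed)
  ultimately show ?thesis by blast
qed

end

section \<open>Groups of maximal class\<close>

text \<open>Cut the interval into blocks of two neighbours; each block holds at most one element of
  \<open>B\<close>.\<close>

lemma card_no_consecutive:
  fixes B :: "nat set"
  assumes "B \<subseteq> {a..<a + l}" and "\<And>i. i \<in> B \<Longrightarrow> Suc i \<notin> B"
  shows "card B \<le> (l + 1) div 2"
proof -
  have "inj_on (\<lambda>i. (i - a) div 2) B"
  proof (rule inj_onI)
    fix i j assume ij: "i \<in> B" "j \<in> B" "(i - a) div 2 = (j - a) div 2"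
    have "a \<le> i" "a \<le> j" using ij assms(1) by auto
    then obtain k l where kl: "i = a + k" "j = a + l" by (auto simp: le_iff_add)
    then have "k div 2 = l div 2" using ij(3) by simp
    then have "k = l \<or> l = Suc k \<or> k = Suc l" by presburger
    then have "i = j \<or> j = Suc i \<or> i = Suc j" using kl by auto
    then show "i = j" using ij assms(2) by blast
  qed
  moreover have "(\<lambda>i. (i - a) div 2) ` B \<subseteq> {..<(l + 1) div 2}"
  proof (rule image_subsetI)
    fix i assume "i \<in> B"
    then have "a \<le> i" "i < a + l" using assms(1) by auto
    then obtain k where "i = a + k" "k < l" by (auto simp: le_iff_add)
    moreover have "k div 2 < (l + 1) div 2" if "k < l" using that by presburger
    ultimately show "(i - a) div 2 \<in> {..<(l + 1) div 2}" by simp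
  qed
  ultimately show ?thesis
    using card_inj_on_le[of _ B "{..<(l + 1) div 2}"] by simp
qed

context group
begin

lemma subgroup_nat_pow_closed:
  fixes k :: nat
  assumes "subgroup H G" "x \<in> H"
  shows "x [^] k \<in> H"
  using assms by (induction k) (auto intro: subgroup.m_closed subgroup.one_closed)

lemma card_rcosets_le:
  assumes "finite (carrier G)" and H: "subgroup H G" and \<phi>: "\<And>g h. g \<in> carrier G \<Longrightarrow> h \<in> carrier G \<Longrightarrow> \<phi> g = \<phi> h \<Longrightarrow> g \<otimes> inv h \<in> H"
  shows "card (carrier G) \<le> card (\<phi> ` carrier G) * card H"
proof -
  have "rcosets H = (\<lambda>g. H #> g) ` carrier G" by (auto simp: RCOSETS_def)
  moreover have "card ((\<lambda>g. H #> g) ` carrier G) \<le> card (\<phi> ` carrier G)"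
  proof (rule card_image_le_card_image[OF assms(1)])
    fix g h assume gh: "g \<in> carrier G" "h \<in> carrier G" "\<phi> g = \<phi> h"
    then have "g \<otimes> inv h \<in> H" by (rule \<phi>)
    then have "g \<in> H #> h" using gh H
      by (simp add: subgroup.rcos_module_rev[OF H group_axioms])
    then show "H #> g = H #> h" using repr_independence[OF _ gh(2) H] by simp
  qed
  ultimately have "card (rcosets H) * card H \<le> card (\<phi> ` carrier G) * card H" by simp
  then show ?thesis unfolding lagrange[OF H] Coset.order_def .
qed

lemma card_cosets_in_subgroup:
  assumes "finite (carrier G)" "subgroup K G" "subgroup L G" "K \<subseteq> L"
  shows "card ((\<lambda>y. K #> y) ` L) * card K = card L"
proof -
  interpret L: group "G\<lparr>carrier := L\<rparr>" using assms(3) by (rule subgroup_imp_group)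
  have "subgroup K (G\<lparr>carrier := L\<rparr>)" using assms by (simp add: subgroup_incl)
  from L.lagrange[OF this] have "card (rcosets\<^bsub>G\<lparr>carrier := L\<rparr>\<^esub> K) * card K = card L"
    by (simp add: Coset.order_def)
  moreover have "rcosets\<^bsub>G\<lparr>carrier := L\<rparr>\<^esub> K = (\<lambda>y. K #> y) ` L"
    by (auto simp: RCOSETS_def)
  ultimately show ?thesis by simp
qed

lemma pow_coprime_in_subgroup:
  fixes k :: nat
  assumes c: "c \<in> carrier G" and H: "subgroup H G" and G: "card (carrier G) = p ^ n" and p: "prime p"
    and k: "c [^] k \<in> H" "0 < k" "k < p"
  shows "c \<in> H"
proof -
  have "coprime k p" using p k by (metis coprime_commute nat_dvd_not_less prime_imp_coprime)
  then have "coprime k (p ^ n)" by simp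
  then obtain a where a: "[k * a = Suc 0] (mod p ^ n)" using cong_solve_coprime_nat by blast
  have "c [^] (p ^ n) = \<one>" using pow_order_eq_1[OF c] G by (simp add: Coset.order_def)
  then have *: "c [^] (p ^ n * q) = \<one>" for q using c by (simp add: nat_pow_pow[symmetric])
  have red: "c [^] m = c [^] (m mod p ^ n)" for m :: nat
  proof -
    have "c [^] m = c [^] (p ^ n * (m div p ^ n) + m mod p ^ n)" by simp
    also have "\<dots> = c [^] (m mod p ^ n)" using * c by (simp only: nat_pow_mult[symmetric]) simp
    finally show ?thesis .
  qed
  have "c [^] (k * a) = c [^] (1::nat)" using red[of "k * a"] red[of 1] a by (simp add: cong_def)
  then have "c = (c [^] k) [^] a" using c by (simp add: nat_pow_pow)
  then show ?thesis using k(1) H by (metis subgroup_nat_pow_closed)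
qed

end

section \<open>Orders of the lower central terms, and two-step centralizers\<close>

locale maximal_class_group = group G for G (structure) +
  fixes p n :: nat
  assumes p: "prime p" and n2: "2 \<le> n" and card_G: "card (carrier G) = p ^ n"
    and class_G: "has_nilpotence_class G (n - 1)"
begin

lemma finite_G: "finite (carrier G)"
  using card_G p by (metis card.infinite not_prime_0 power_not_zero)

lemma finite_subgroup: "subgroup H G \<Longrightarrow> finite H"
  using finite_G by (meson finite_subset subgroup.subset)

lemma lcs_n: "n \<le> i \<Longrightarrow> lcs G i = {\<one>}"
proof -
  assume "n \<le> i"
  moreover have "lcs G n = {\<one>}" using class_G by (simp add: has_nilpotence_class_def lcs_def)
  ultimately show ?thesis using lcs_antimono[of n i] lcs_one_closed[of i] by auto
qed

lemma lcs_ne: "i < n \<Longrightarrow> lcs G i \<noteq> {\<one>}"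
proof -
  assume "i < n"
  then have "i - 1 < n - 1" using n2 by auto
  then show ?thesis using class_G unfolding has_nilpotence_class_def lcs_def by blast
qed

lemma lcs_strict:
  assumes "1 \<le> i" "i < n"
  shows "lcs G (Suc i) \<noteq> lcs G i"
proof
  assume eq: "lcs G (Suc i) = lcs G i"
  have "lcs G (i + j) = lcs G i" for j
  proof (induction j)
    case (Suc j)
    have "lcs G (Suc i) = lcs G (Suc (i + j))"
      using Suc assms(1) by (cases i) (simp_all add: lcs_def)
    then show ?case using eq by simp
  qed simp
  from this[of "n - i"] show False using assms lcs_n[of n] lcs_ne[OF assms(2)] by simp
qed

lemma lcs_strictD:
  assumes "1 \<le> i" "i < n"
  obtains x where "x \<in> lcs G i" "x \<notin> lcs G (Suc i)"
  using lcs_strict[OF assms] lcs_Suc_subset by blast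

lemma card_subgroup_eq_power:
  assumes "subgroup H G"
  obtains a where "card H = p ^ a" "a \<le> n"
proof -
  have "card H dvd p ^ n"
    using subgroup_card_dvd[OF assms subgroup_self] subgroup.subset[OF assms] card_G by simp
  then show ?thesis using that p divides_primepow_nat by metis
qed

lemma proper_subgroup_card_le:
  assumes "subgroup H G" "subgroup K G" "H \<subseteq> K" "H \<noteq> K"
  shows "p * card H \<le> card K"
proof -
  obtain a where a: "card H = p ^ a" using card_subgroup_eq_power[OF assms(1)] .
  obtain b where b: "card K = p ^ b" using card_subgroup_eq_power[OF assms(2)] .
  have "card H < card K" using assms finite_subgroup by (simp add: psubset_card_mono psubset_eq)
  then have "a < b" using a b p by (metis power_less_imp_less_exp prime_gt_1_nat)
  then show ?thesis using a b p
    by (metis Suc_leI power_Suc power_increasing prime_ge_1_nat)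
qed

text \<open>If the index were at most p, one element g would generate the group modulo
  \<open>lcs G 2\<close>. As g commutes with itself, all commutators would lie in
  \<open>lcs G 3\<close>, and the series would stall before reaching the bottom.\<close>

lemma card_lcs_2: "card (lcs G 2) \<le> p ^ (n - 2)"
proof (rule ccontr)
  assume neg: "\<not> ?thesis"
  obtain a where a: "card (lcs G 2) = p ^ a" using card_subgroup_eq_power[OF lcs_subgroup] .
  have p1: "1 < p" using p by (rule prime_gt_1_nat)
  have "n - 2 < a" using neg a p1 by (simp add: not_le)
  then have "p ^ (n - 1) \<le> card (lcs G 2)" using a p1 n2 by (simp add: power_increasing)
  moreover have "p ^ n = p * p ^ (n - 1)" using n2 by (cases n) auto
  ultimately have le: "card (carrier G) \<le> p * card (lcs G 2)" using card_G by simp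
  have n3: "2 < n"
  proof (rule ccontr)
    assume "\<not> 2 < n"
    then have "card (lcs G 2) = 1" using lcs_n[of 2] n2 by simp
    then show False using neg p1 by (simp add: not_le)
  qed
  obtain g where g: "g \<in> carrier G" "g \<notin> lcs G 2" using lcs_strictD[of 1] n3 by (auto simp: numeral_2_eq_2)
  have gen: "H = carrier G" if "subgroup H G" "lcs G 2 \<subseteq> H" "g \<in> H" for H
    using prime_index_subgroup_eq[OF finite_G p lcs_subgroup that(1) subgroup_self that(2) _ _ le card_G]
      that g subgroup.subset by blast
  have comm2: "comm y x \<in> lcs G 3" if "y \<in> lcs G 2" "x \<in> carrier G" for x y
    using comm_lcs_Suc[OF that] by (simp add: numeral_3_eq_3 numeral_2_eq_2)
  have "{y \<in> carrier G. \<forall>x\<in>{g}. comm y x \<in> lcs G 3} = carrier G"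
    by (rule gen[OF subgroup_comm_in[OF lcs_normal]]) (use g comm2 lcs_carrier in auto)
  then have "comm y g \<in> lcs G 3" if "y \<in> carrier G" for y using that by blast
  then have "comm g y \<in> lcs G 3" if "y \<in> carrier G" for y
    using that g normal_comm_swap[OF lcs_normal] by blast
  then have "{y \<in> carrier G. \<forall>x\<in>carrier G. comm y x \<in> lcs G 3} = carrier G"
    by (intro gen[OF subgroup_comm_in[OF lcs_normal]]) (use g comm2 lcs_carrier in auto)
  then have "lcs G (Suc 1) \<subseteq> lcs G 3"
    by (intro lcs_Suc_least lcs_subgroup) auto
  then have "lcs G (Suc 2) = lcs G 2" using lcs_Suc_subset[of 2] by (auto simp: numeral_3_eq_3 numeral_2_eq_2)
  then show False using lcs_strict[of 2] n3 by simp
qed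

text \<open>Each of the \<open>n - 2\<close> strict inclusions below \<open>lcs G 2\<close> costs a
  factor of at least p, and \<open>card_lcs_2\<close> leaves room for exactly that many. The upper
  bound is carried down from \<open>lcs G 2\<close>, the lower bound up from the trivial
  term.\<close>

lemma card_lcs:
  assumes "2 \<le> i" "i \<le> n"
  shows "card (lcs G i) = p ^ (n - i)"
proof (rule antisym)
  have p1: "1 < p" using p by (rule prime_gt_1_nat)
  have step: "p * card (lcs G (Suc i)) \<le> card (lcs G i)" if "1 \<le> i" "i < n" for i
    using proper_subgroup_card_le[OF lcs_subgroup lcs_subgroup lcs_Suc_subset lcs_strict[OF that]] .
  show "card (lcs G i) \<le> p ^ (n - i)"
    using assms
  proof (induction i rule: dec_induct)
    case base
    then show ?case using card_lcs_2 by simp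
  next
    case (step i)
    have "p * card (lcs G (Suc i)) \<le> p ^ (n - i)"
      using \<open>\<And>i. 1 \<le> i \<Longrightarrow> i < n \<Longrightarrow> p * card (lcs G (Suc i)) \<le> card (lcs G i)\<close>[of i] step by fastforce
    moreover have "n - i = Suc (n - Suc i)" using step by simp
    ultimately show ?case using p1 by simp
  qed
  show "p ^ (n - i) \<le> card (lcs G i)"
    using assms(2,1)
  proof (induction i rule: inc_induct)
    case base
    then show ?case using lcs_n[of n] by simp
  next
    case (step i)
    have "p * card (lcs G (Suc i)) \<le> card (lcs G i)"
      using \<open>\<And>i. 1 \<le> i \<Longrightarrow> i < n \<Longrightarrow> p * card (lcs G (Suc i)) \<le> card (lcs G i)\<close>[of i] step by simp
    moreover have "p ^ (n - Suc i) \<le> card (lcs G (Suc i))" using step by simp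
    moreover have "n - i = Suc (n - Suc i)" using step by simp
    ultimately show ?case by (metis mult_le_mono2 order_trans power_Suc)
  qed
qed

lemma lcs_subset_subgroup:
  assumes "2 \<le> i" "i < n" and x: "x \<in> lcs G i" "x \<notin> lcs G (Suc i)"
    and H: "subgroup H G" "lcs G (Suc i) \<subseteq> H" "x \<in> H"
  shows "lcs G i \<subseteq> H"
proof -
  have "n - i = Suc (n - Suc i)" using assms by simp
  then have "card (lcs G i) \<le> p * card (lcs G (Suc i))" using card_lcs[of i] card_lcs[of "Suc i"] assms by simp
  then have "H \<inter> lcs G i = lcs G i"
    using card_lcs[of i] assms lcs_Suc_subset[of i]
    by (intro prime_index_subgroup_eq[OF finite_G p lcs_subgroup[of "Suc i"] _ lcs_subgroup, where n = "n - i"]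
        subgroups_Inter_pair lcs_subgroup) auto
  then show ?thesis by blast
qed

text \<open>The two-step centralizer of \<open>lcs G i / lcs G (i + 2)\<close>. The last one,
  \<open>two_step (n - 2)\<close>, is the full centralizer of \<open>lcs G (n - 2)\<close>, because
  \<open>lcs G n\<close> is trivial.\<close>

definition two_step :: "nat \<Rightarrow> 'a set" where
  "two_step i = {g \<in> carrier G. \<forall>x\<in>lcs G i. comm x g \<in> lcs G (i + 2)}"

lemma two_step_subgroup: "subgroup (two_step i) G"
  unfolding two_step_def by (intro subgroup_comm_in_right lcs_normal lcs_subset_carrier)

lemma lcs_2_two_step: "lcs G 2 \<subseteq> two_step i"
  unfolding two_step_def using comm_lcs lcs_carrier by blast

lemma two_step_carrier: "g \<in> two_step i \<Longrightarrow> g \<in> carrier G"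
  unfolding two_step_def by blast

lemma two_stepD: "g \<in> two_step i \<Longrightarrow> x \<in> lcs G i \<Longrightarrow> comm x g \<in> lcs G (i + 2)"
  unfolding two_step_def by blast

lemma two_step_proper:
  assumes "1 \<le> i" "i + 2 \<le> n"
  shows "two_step i \<noteq> carrier G"
proof
  assume *: "two_step i = carrier G"
  have "lcs G (Suc i) \<subseteq> lcs G (Suc (Suc i))"
  proof (rule lcs_Suc_least[OF assms(1) lcs_subgroup])
    fix x g assume "x \<in> lcs G i" "g \<in> carrier G"
    then show "comm x g \<in> lcs G (Suc (Suc i))" using * two_stepD[of g i x] by simp
  qed
  then show False using lcs_strict[of "Suc i"] lcs_Suc_subset[of "Suc i"] assms by auto
qed

text \<open>The factor \<open>lcs G i / lcs G (i + 1)\<close> has order p, so a single x of exact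
  depth i tests the condition for the whole term.\<close>

lemma in_two_step:
  assumes "2 \<le> i" "i < n" "x \<in> lcs G i" "x \<notin> lcs G (Suc i)" and g: "g \<in> carrier G" "comm x g \<in> lcs G (i + 2)"
  shows "g \<in> two_step i"
proof -
  let ?H = "{y \<in> carrier G. \<forall>h\<in>{g}. comm y h \<in> lcs G (i + 2)}"
  have "lcs G i \<subseteq> ?H"
  proof (rule lcs_subset_subgroup[OF assms(1-4)])
    show "subgroup ?H G" using g by (intro subgroup_comm_in lcs_normal) auto
    show "lcs G (Suc i) \<subseteq> ?H" using comm_lcs_Suc[of _ "Suc i" g] g lcs_carrier by auto
    show "x \<in> ?H" using assms lcs_carrier by blast
  qed
  then show ?thesis using g unfolding two_step_def by blast
qed

text \<open>This measures depth: commutation with an element outside \<open>two_step i\<close> moves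
  exact depth i to exact depth \<open>i + 1\<close>, so what commutes with such an element too well
  must lie deeper than i.\<close>

lemma comm_not_in_lcs:
  assumes "2 \<le> i" "i < n" "x \<in> lcs G i" "x \<notin> lcs G (Suc i)" "g \<in> carrier G" "g \<notin> two_step i"
  shows "comm x g \<notin> lcs G (Suc (Suc i))"
  using in_two_step assms by force

lemma maximal_subgroup_pow:
  assumes M: "subgroup M G" "lcs G 2 \<subseteq> M" "card (carrier G) \<le> p * card M" and g: "g \<in> carrier G"
  shows "g [^] p \<in> M"
proof -
  have N: "M \<lhd> G" using M(1,2) by (rule normal_if_lcs_2)
  interpret N: normal M G by (rule N)
  interpret Q: group "G Mod M" by (rule N.factorgroup_is_group)
  have "Coset.order (G Mod M) * card M = p ^ n"
    using lagrange[OF M(1)] card_G by (simp add: Coset.order_def FactGroup_def)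
  moreover have "p ^ n \<le> p * card M" using M card_G by simp
  moreover have "card M > 0" using M finite_subgroup subgroup.one_closed by (metis card_gt_0_iff empty_iff)
  ultimately have "Coset.order (G Mod M) \<le> p" by (metis mult_le_cancel2)
  moreover have "Coset.order (G Mod M) dvd p ^ n" using \<open>Coset.order (G Mod M) * card M = p ^ n\<close> by (metis dvd_triv_left)
  ultimately obtain k where k: "Coset.order (G Mod M) = p ^ k" using p divides_primepow_nat by metis
  have "k \<le> 1" using k \<open>Coset.order (G Mod M) \<le> p\<close> p
    by (metis power_increasing_iff power_one_right prime_gt_1_nat)
  then have "Coset.order (G Mod M) dvd p" using k by (cases k) auto
  then obtain q where q: "p = Coset.order (G Mod M) * q" by blast
  have c: "M #> g \<in> carrier (G Mod M)" using g by (simp add: carrier_FactGroup)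
  have "(M #> g) [^]\<^bsub>G Mod M\<^esub> p = \<one>\<^bsub>G Mod M\<^esub>"
    using Q.pow_order_eq_1[OF c] c by (subst q) (simp add: Q.nat_pow_pow[symmetric] del: one_FactGroup)
  then have "M #> (g [^] p) = M" using N.FactGroup_pow[OF g] by simp
  then show ?thesis using rcos_self[OF _ M(1), of "g [^] p"] g by simp
qed

end

text \<open>From order \<open>p\<^sup>4\<close> on, the first two-step centralizer is a maximal subgroup.\<close>

locale maximal_class_group4 = maximal_class_group +
  assumes n4: "4 \<le> n"
begin

abbreviation (input) P :: "'a set" where "P \<equiv> two_step 2"

text \<open>For x of exact depth 2 the commutators \<open>[x, g]\<close> take at most p values
  modulo \<open>lcs G 4\<close>, and these separate the cosets of \<open>P\<close>.\<close>

lemma P_index: "card (carrier G) \<le> p * card P"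
proof -
  obtain x where x: "x \<in> lcs G 2" "x \<notin> lcs G (Suc 2)" using lcs_strictD[of 2] n4 by auto
  have xc: "x \<in> carrier G" using x lcs_carrier by blast
  define \<phi> where "\<phi> g = lcs G 4 #> comm x g" for g
  have "card (carrier G) \<le> card (\<phi> ` carrier G) * card P"
  proof (rule card_rcosets_le[OF finite_G two_step_subgroup])
    fix g h assume gh: "g \<in> carrier G" "h \<in> carrier G" and eq: "\<phi> g = \<phi> h"
    have "comm x g \<in> lcs G 4 #> comm x g"
      using rcos_self[OF _ lcs_subgroup] gh xc by simp
    then have "comm x g \<in> lcs G 4 #> comm x h" using eq unfolding \<phi>_def by metis
    then have "comm x g \<otimes> inv (comm x h) \<in> lcs G 4"
      using subgroup.rcos_module_imp[OF lcs_subgroup group_axioms] gh xc by simp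
    \<comment> \<open>Two conjugations are needed because \<open>[x, g h^-1]\<close> is a conjugate
      of \<open>[x, h]^-1 [x, g]\<close>.\<close>
    then have "conj_by (comm x g \<otimes> inv (comm x h)) (comm x h) \<in> lcs G 4"
      using normal_conj_by[OF lcs_normal] gh xc by blast
    then have "conj_by (conj_by (comm x g \<otimes> inv (comm x h)) (comm x h)) (inv h) \<in> lcs G 4"
      using normal_conj_by[OF lcs_normal] gh xc by blast
    moreover have "conj_by (conj_by (comm x g \<otimes> inv (comm x h)) (comm x h)) (inv h) = comm x (g \<otimes> inv h)"
      using gh xc by (simp add: group_word)
    ultimately have "comm x (g \<otimes> inv h) \<in> lcs G (2 + 2)" by simp
    then show "g \<otimes> inv h \<in> P"
      using in_two_step[of 2 x "g \<otimes> inv h"] x gh n4 by simp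
  qed
  moreover have "card (\<phi> ` carrier G) \<le> p"
  proof -
    have "\<phi> ` carrier G \<subseteq> (\<lambda>y. lcs G 4 #> y) ` lcs G 3"
      using comm_lcs_Suc[OF x(1)] by (auto simp: \<phi>_def numeral_3_eq_3 numeral_2_eq_2)
    then have "card (\<phi> ` carrier G) \<le> card ((\<lambda>y. lcs G 4 #> y) ` lcs G 3)"
      using finite_subgroup[OF lcs_subgroup] by (intro card_mono) auto
    moreover have "card ((\<lambda>y. lcs G 4 #> y) ` lcs G 3) * card (lcs G 4) = card (lcs G 3)"
      by (intro card_cosets_in_subgroup finite_G lcs_subgroup lcs_antimono) simp
    moreover have "card (lcs G 3) = p * card (lcs G 4)"
    proof -
      have "n - 3 = Suc (n - 4)" using n4 by simp
      then show ?thesis using card_lcs[of 3] card_lcs[of 4] n4 by simp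
    qed
    moreover have "card (lcs G 4) > 0"
      using card_lcs[of 4] n4 p by (simp add: prime_gt_0_nat)
    ultimately show ?thesis by (metis mult_right_cancel not_gr_zero)
  qed
  ultimately show ?thesis by (meson mult_le_mono1 order_trans)
qed

lemma P_neq_lcs_2: "P \<noteq> lcs G 2"
proof
  assume "P = lcs G 2"
  then have "p ^ n \<le> p * p ^ (n - 2)" using P_index card_G card_lcs[of 2] n4 by simp
  moreover have "p ^ n = p * (p * p ^ (n - 2))" using n4
    by (metis add_2_eq_Suc le_add_diff_inverse n2 power_Suc)
  moreover have "0 < p ^ (n - 2)" "1 < p" using prime_gt_1_nat[OF p] by auto
  ultimately show False by simp
qed

lemma P_proper: "P \<noteq> carrier G"
  using two_step_proper[of 2] n4 by simp

text \<open>The steps from \<open>lcs G 2\<close> to \<open>P\<close> and from \<open>P\<close> to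
  the group have index p, so c fills the first and s the second.\<close>

lemma two_generators:
  assumes H: "subgroup H G" "lcs G 2 \<subseteq> H" and c: "c \<in> P" "c \<notin> lcs G 2" "c \<in> H"
    and s: "s \<in> carrier G" "s \<notin> P" "s \<in> H"
  shows "H = carrier G"
proof -
  have cP: "p * card P \<le> card (carrier G)"
    using proper_subgroup_card_le[OF two_step_subgroup subgroup_self _ P_proper] two_step_carrier by blast
  have "card P \<le> p * card (lcs G 2)"
  proof -
    have "p * card P \<le> p * (p * p ^ (n - 2))"
      using cP card_G n4 by (metis add_2_eq_Suc le_add_diff_inverse n2 power_Suc)
    then show ?thesis using p card_lcs[of 2] n4 by (simp add: prime_gt_0_nat)
  qed
  moreover obtain a where a: "card P = p ^ a" using card_subgroup_eq_power[OF two_step_subgroup] .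
  ultimately have "H \<inter> P = P"
    using H c lcs_2_two_step
    by (intro prime_index_subgroup_eq[OF finite_G p lcs_subgroup[of 2] _ two_step_subgroup, where n = a]
        subgroups_Inter_pair two_step_subgroup) auto
  then have "P \<subseteq> H" by blast
  then show ?thesis
    using prime_index_subgroup_eq[OF finite_G p two_step_subgroup H(1) subgroup_self _ _ _ P_index card_G]
      s subgroup.subset[OF H(1)] by blast
qed

lemma two_step_generators:
  assumes "2 \<le> i" "i + 2 \<le> n" and c: "c \<in> P" "c \<notin> lcs G 2" "c \<in> two_step i"
    and s: "s \<in> carrier G" "s \<notin> P"
  shows "s \<notin> two_step i"
  using two_generators[OF two_step_subgroup lcs_2_two_step c s] two_step_proper[of i] assms by auto

text \<open>If c and s commuted modulo \<open>lcs G 3\<close>, the quotient by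
  \<open>lcs G 3\<close> would be abelian and the series would stall at index 2. Three uses of
  \<open>two_generators\<close> spread the relation to all pairs of elements.\<close>

lemma comm_generators:
  assumes c: "c \<in> P" "c \<notin> lcs G 2" and s: "s \<in> carrier G" "s \<notin> P"
  shows "comm c s \<notin> lcs G 3"
proof
  assume *: "comm c s \<in> lcs G 3"
  have cc: "c \<in> carrier G" using c two_step_carrier by blast
  have comm2: "comm y x \<in> lcs G 3" if "y \<in> lcs G 2" "x \<in> carrier G" for x y
    using comm_lcs_Suc[OF that] by (simp add: numeral_3_eq_3 numeral_2_eq_2)
  have "{y \<in> carrier G. \<forall>x\<in>{s}. comm y x \<in> lcs G 3} = carrier G"
    by (rule two_generators[OF subgroup_comm_in[OF lcs_normal] _ c _ s])
      (use s cc * comm2 lcs_carrier in auto)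
  then have s': "comm s y \<in> lcs G 3" if "y \<in> carrier G" for y
    using that s normal_comm_swap[OF lcs_normal] by blast
  have "{y \<in> carrier G. \<forall>x\<in>{c}. comm y x \<in> lcs G 3} = carrier G"
    by (rule two_generators[OF subgroup_comm_in[OF lcs_normal] _ c _ s])
      (use s s' cc * comm2 lcs_carrier in auto)
  then have c': "comm c y \<in> lcs G 3" if "y \<in> carrier G" for y
    using that cc normal_comm_swap[OF lcs_normal] by blast
  have "{y \<in> carrier G. \<forall>x\<in>carrier G. comm y x \<in> lcs G 3} = carrier G"
    by (rule two_generators[OF subgroup_comm_in[OF lcs_normal] _ c _ s])
      (use s s' c' cc * comm2 lcs_carrier in auto)
  then have "lcs G (Suc 1) \<subseteq> lcs G 3"
    by (intro lcs_Suc_least lcs_subgroup) auto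
  then have "lcs G (Suc 2) = lcs G 2" using lcs_Suc_subset[of 2] by (auto simp: numeral_3_eq_3 numeral_2_eq_2)
  then show False using lcs_strict[of 2] n4 by simp
qed

lemma ex_generators:
  obtains c s where "c \<in> P" "c \<notin> lcs G 2" "s \<in> carrier G" "s \<notin> P"
  using P_neq_lcs_2 P_proper lcs_2_two_step[of 2] two_step_carrier[of _ 2] by blast

lemma pow_in_lcs_2:
  assumes "s \<in> carrier G" "s \<notin> P"
  shows "s [^] p \<in> lcs G 2"
proof (rule ccontr)
  assume neg: "s [^] p \<notin> lcs G 2"
  have "s [^] p \<in> P"
    by (rule maximal_subgroup_pow[OF two_step_subgroup lcs_2_two_step P_index assms(1)])
  then have "comm (s [^] p) s \<notin> lcs G 3" using comm_generators neg assms by blast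
  moreover have "comm (s [^] p) s = \<one>"
    using assms by (simp add: comm_eq_one_iff nat_pow_Suc2[symmetric])
  ultimately show False by simp
qed

text \<open>Hall-Witt is used twice. Suppose c escapes \<open>two_step (i + 1)\<close> and let v
  have exact depth i. Applied to c, v and s, the identity shows that \<open>[v, w]\<close> with
  \<open>w = [s^-1, c^-1]\<close> has exact depth \<open>i + 2\<close>; applied to c, v and w, it
  shows that c centralizes \<open>[v, w]\<close> up to depth \<open>i + 4\<close>. Hence c lies in
  \<open>two_step (i + 2)\<close>.\<close>

lemma two_step_next:
  assumes c: "c \<in> P" "c \<notin> lcs G 2" and i: "2 \<le> i" "i + 4 \<le> n" and ci: "c \<in> two_step i"
  shows "c \<in> two_step (i + 1) \<or> c \<in> two_step (i + 2)"
proof (rule ccontr)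
  assume neg: "\<not> ?thesis"
  obtain s where s: "s \<in> carrier G" "s \<notin> P" using ex_generators by blast
  have cc: "c \<in> carrier G" using c two_step_carrier by blast
  obtain v where v: "v \<in> lcs G i" "v \<notin> lcs G (Suc i)" using lcs_strictD[of i] i by auto
  have vc: "v \<in> carrier G" using v lcs_carrier by blast
  have "s \<notin> two_step i" using two_step_generators[OF i(1) _ c ci s] i by simp
  then have vs: "comm v s \<notin> lcs G (Suc (Suc i))" using comm_not_in_lcs[OF i(1) _ v s(1)] i by simp
  have vs': "comm v s \<in> lcs G (Suc i)" using comm_lcs_Suc[OF v(1) s(1)] .
  have vsc: "comm (comm v s) c \<notin> lcs G (i + 3)"
    using comm_not_in_lcs[OF _ _ vs' vs cc] neg i by (auto simp: numeral_3_eq_3)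
  define w where "w = comm (inv s) (inv c)"
  have w: "w \<in> lcs G 2" unfolding w_def
    using comm_lcs_Suc[of "inv s" 1 "inv c"] s cc by (simp add: numeral_2_eq_2)
  have wc: "w \<in> carrier G" using w lcs_carrier by blast
  have "comm v c \<in> lcs G (i + 2)" using two_stepD[OF ci v(1)] .
  then have cv: "comm c (inv v) \<in> lcs G (i + 2)"
    using normal_comm_swap[OF lcs_normal] normal_comm_inv_left[OF lcs_normal] cc vc by (metis inv_closed)
  have q: "comm v w \<in> lcs G (i + 2)" using comm_lcs[OF v(1) w] .
  have q': "comm v w \<notin> lcs G (i + 3)"
  proof
    assume *: "comm v w \<in> lcs G (i + 3)"
    have "comm (comm v (inv (inv s))) c \<in> lcs G (i + 3)"
    proof (rule three_subgroups[OF lcs_normal cc vc])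
      show "inv s \<in> carrier G" using s by simp
      show "comm (comm c (inv v)) (inv s) \<in> lcs G (i + 3)"
        using comm_lcs_Suc[OF cv, of "inv s"] s by (simp add: numeral_3_eq_3)
      show "comm (comm (inv s) (inv c)) v \<in> lcs G (i + 3)"
        using * normal_comm_swap[OF lcs_normal vc wc] by (simp add: w_def)
    qed
    then show False using vsc s by simp
  qed
  have "comm (comm v (inv (inv w))) c \<in> lcs G (i + 4)"
  proof (rule three_subgroups[OF lcs_normal cc vc])
    show "inv w \<in> carrier G" using wc by simp
    show "comm (comm c (inv v)) (inv w) \<in> lcs G (i + 4)"
      by (rule comm_lcs_le[OF cv lcs_inv_closed[OF w]]) simp
    have "comm w c \<in> lcs G 4" using two_stepD[OF c(1) w] by simp
    then have "comm (inv w) (inv c) \<in> lcs G 4"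
      using normal_comm_inv_left[OF lcs_normal] normal_comm_inv_right[OF lcs_normal] cc wc by simp
    then show "comm (comm (inv w) (inv c)) v \<in> lcs G (i + 4)"
      by (rule comm_lcs_le[OF _ v(1)]) simp
  qed
  moreover have "i + 4 = i + 2 + 2" by simp
  ultimately have "comm (comm v w) c \<in> lcs G (i + 2 + 2)" using wc by (simp only: inv_inv)
  then have "c \<in> two_step (i + 2)"
    using in_two_step[of "i + 2" "comm v w" c] q q' cc i by (simp add: numeral_3_eq_3)
  then show False using neg by simp
qed

text \<open>In the first of these identities v is replaced by w itself, so the term
  \<open>[w, w]\<close> disappears, and \<open>[w, s]\<close>, of exact depth 3, is centralized by c
  up to depth 5. The count in \<open>few_escape\<close> depends on this better start.\<close>

lemma two_step_3:
  assumes c: "c \<in> P" "c \<notin> lcs G 2"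
  shows "c \<in> two_step 3"
proof -
  obtain s where s: "s \<in> carrier G" "s \<notin> P" using ex_generators by blast
  have cc: "c \<in> carrier G" using c two_step_carrier by blast
  define w where "w = comm (inv s) (inv c)"
  have w: "w \<in> lcs G 2" unfolding w_def
    using comm_lcs_Suc[of "inv s" 1 "inv c"] s cc by (simp add: numeral_2_eq_2)
  have wc: "w \<in> carrier G" using w lcs_carrier by blast
  have "comm s c \<notin> lcs G 3" using comm_generators[OF c s] normal_comm_swap[OF lcs_normal cc s(1)] by blast
  then have w': "w \<notin> lcs G 3" unfolding w_def
    using normal_comm_inv_left[OF lcs_normal] normal_comm_inv_right[OF lcs_normal] cc s by simp
  have ws: "comm w s \<in> lcs G 3" "comm w s \<notin> lcs G 4"
    using comm_lcs_Suc[OF w s(1)] comm_not_in_lcs[of 2 w s] w w' s n4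
    by (simp_all add: eval_nat_numeral)
  have "comm w c \<in> lcs G 4" using two_stepD[OF c(1) w] by simp
  then have cw: "comm c (inv w) \<in> lcs G 4"
    using normal_comm_swap[OF lcs_normal] normal_comm_inv_left[OF lcs_normal] cc wc by (metis inv_closed)
  have "comm (comm w (inv (inv s))) c \<in> lcs G 5"
  proof (rule three_subgroups[OF lcs_normal cc wc])
    show "inv s \<in> carrier G" using s by simp
    show "comm (comm c (inv w)) (inv s) \<in> lcs G 5"
      using comm_lcs_Suc[OF cw, of "inv s"] s by (simp add: eval_nat_numeral)
    show "comm (comm (inv s) (inv c)) w \<in> lcs G 5"
      using wc by (simp add: w_def[symmetric])
  qed
  then have "comm (comm w s) c \<in> lcs G (3 + 2)" using s by simp
  then show ?thesis using in_two_step[of 3 "comm w s" c] ws cc n4 by (simp add: eval_nat_numeral)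
qed

lemma two_step_alternate:
  assumes c: "c \<in> P" "c \<notin> lcs G 2" and i: "2 \<le> i" "i + 3 \<le> n"
  shows "c \<in> two_step i \<or> c \<in> two_step (Suc i)"
  using i
proof (induction i rule: dec_induct)
  case base
  then show ?case using c by simp
next
  case (step i)
  then show ?case using two_step_next[OF c, of i] by auto
qed

text \<open>If \<open>c\<close> escapes only few of the centralizers then one of the \<open>p\<close> elements \<open>s c\<^sup>t\<close> escapes them all,
  because each of those few contains at most one of them.\<close>

lemma ex_generic:
  assumes c: "c \<in> P" "c \<notin> lcs G 2" and I: "I \<subseteq> {2..n - 2}"
    and few: "card {i \<in> I. c \<notin> two_step i} < p"
  shows "\<exists>s\<in>carrier G. s \<notin> P \<and> (\<forall>i\<in>I. s \<notin> two_step i)"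
proof (rule ccontr)
  assume neg: "\<not> ?thesis"
  obtain s where s: "s \<in> carrier G" "s \<notin> P" using ex_generators by blast
  have cc: "c \<in> carrier G" using c two_step_carrier by blast
  let ?B = "{i \<in> I. c \<notin> two_step i}"
  have "\<exists>i\<in>?B. s \<otimes> c [^] t \<in> two_step i" for t :: nat
  proof -
    have ct: "c [^] t \<in> two_step i" if "c \<in> two_step i" for i
      using subgroup_nat_pow_closed[OF two_step_subgroup that] .
    have strip: "s \<in> two_step i" if "s \<otimes> c [^] t \<in> two_step i" "c \<in> two_step i" for i
    proof -
      have "(s \<otimes> c [^] t) \<otimes> inv (c [^] t) \<in> two_step i"
        using that ct two_step_subgroup by (meson subgroup.m_closed subgroup.m_inv_closed)
      then show ?thesis using s cc by (simp add: m_assoc)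
    qed
    have "s \<otimes> c [^] t \<notin> P" using strip c s by blast
    then obtain i where i: "i \<in> I" "s \<otimes> c [^] t \<in> two_step i" using neg s cc by blast
    have "c \<notin> two_step i"
    proof
      assume ci: "c \<in> two_step i"
      then have "s \<in> two_step i" using strip i by blast
      moreover have "i \<in> {2..n - 2}" using i I by blast
      then have "2 \<le> i" "i + 2 \<le> n" using n4 by auto
      ultimately show False using two_step_generators[OF _ _ c ci s] by blast
    qed
    then show ?thesis using i by blast
  qed
  then have "\<forall>t :: nat. \<exists>i. i \<in> ?B \<and> s \<otimes> c [^] t \<in> two_step i" by blast
  from choice[OF this] obtain f :: "nat \<Rightarrow> nat"
    where f: "\<And>t. f t \<in> ?B" "\<And>t. s \<otimes> c [^] t \<in> two_step (f t)" by blast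
  have "finite I" using I finite_subset by blast
  then have "\<not> inj_on f {..<p}"
    using few f(1) card_inj_on_le[of f "{..<p}" ?B] by auto
  then obtain t t' where t: "t < t'" "t' < p" "f t = f t'"
    unfolding inj_on_def by (metis lessThan_iff linorder_neqE_nat)
  let ?H = "two_step (f t)"
  have "inv (s \<otimes> c [^] t) \<otimes> (s \<otimes> c [^] t') \<in> ?H"
    using f(2)[of t] f(2)[of t'] t(3) two_step_subgroup by (metis subgroup.m_closed subgroup.m_inv_closed)
  moreover have "c [^] t' = c [^] t \<otimes> c [^] (t' - t)" using cc t by (simp add: nat_pow_mult)
  ultimately have "c [^] (t' - t) \<in> ?H" using s cc by (simp add: group_word)
  then have "c \<in> ?H"
    using pow_coprime_in_subgroup[OF cc two_step_subgroup card_G p] t by auto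
  then show False using f(1) by blast
qed

text \<open>\<open>s [^] p\<close> commutes with s, whereas s moves every exact depth from 2 to p;
  so \<open>s [^] p\<close> has none of these depths.\<close>

lemma generic_pow:
  assumes s: "s \<in> carrier G" "s \<notin> P" and gen: "\<And>i. 2 \<le> i \<Longrightarrow> i \<le> p \<Longrightarrow> s \<notin> two_step i" and np: "p + 2 \<le> n"
    and j: "2 \<le> j" "j \<le> Suc p"
  shows "s [^] p \<in> lcs G j"
  using j
proof (induction j rule: dec_induct)
  case base
  then show ?case using pow_in_lcs_2[OF s] by simp
next
  case (step j)
  show ?case
  proof (rule ccontr)
    assume "s [^] p \<notin> lcs G (Suc j)"
    then have "comm (s [^] p) s \<notin> lcs G (Suc (Suc j))"
      using step gen np s by (intro comm_not_in_lcs) auto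
    moreover have "comm (s [^] p) s = \<one>"
      using s by (simp add: comm_eq_one_iff nat_pow_Suc2[symmetric])
    ultimately show False by simp
  qed
qed

end

section \<open>Powers in groups of maximal class\<close>

context group
begin

text \<open>The term at p controls \<open>f [^] p\<close> from two sides: the differences are
  conjugates of iterated commutators, so the Hall-Petrescu formula expands it, and its commutator
  with s is computed in \<open>comm_norm_seq\<close>.\<close>

primrec norm_seq :: "'a \<Rightarrow> 'a \<Rightarrow> nat \<Rightarrow> 'a" where
  "norm_seq f s 0 = \<one>"
| "norm_seq f s (Suc m) = norm_seq f s m \<otimes> conj_by f (s [^] m)"

primrec iter_comm :: "'a \<Rightarrow> 'a \<Rightarrow> nat \<Rightarrow> 'a" where
  "iter_comm f s 0 = f"
| "iter_comm f s (Suc i) = comm (iter_comm f s i) s"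

lemma norm_seq_closed [simp]: "f \<in> carrier G \<Longrightarrow> s \<in> carrier G \<Longrightarrow> norm_seq f s m \<in> carrier G"
  by (induction m) auto

lemma iter_comm_closed [simp]: "f \<in> carrier G \<Longrightarrow> s \<in> carrier G \<Longrightarrow> iter_comm f s m \<in> carrier G"
  by (induction m) auto

lemma norm_seq_eq:
  assumes "f \<in> carrier G" "s \<in> carrier G"
  shows "norm_seq f s m = (f \<otimes> inv s) [^] m \<otimes> s [^] m"
proof (induction m)
  case (Suc m)
  have "norm_seq f s (Suc m) = (f \<otimes> inv s) [^] m \<otimes> s [^] m \<otimes> conj_by f (s [^] m)"
    using Suc by simp
  also have "\<dots> = (f \<otimes> inv s) [^] m \<otimes> f \<otimes> s [^] m"
    using assms by (simp add: group_word)
  also have "\<dots> = (f \<otimes> inv s) [^] Suc m \<otimes> s [^] Suc m"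
    using assms unfolding nat_pow_Suc2[OF assms(2)] by (simp add: group_word)
  finally show ?case .
qed simp

lemma conj_by_norm_seq:
  assumes "f \<in> carrier G" "s \<in> carrier G"
  shows "conj_by (norm_seq f s m) s = inv f \<otimes> norm_seq f s m \<otimes> conj_by f (s [^] m)"
proof (induction m)
  case (Suc m)
  have "conj_by (norm_seq f s (Suc m)) s = conj_by (norm_seq f s m) s \<otimes> conj_by f (s [^] Suc m)"
    using assms by (simp add: conj_by_mult conj_by_conj_by)
  then show ?case using assms Suc by (simp add: m_assoc)
qed (use assms in simp)

text \<open>Conjugation by s shifts the product, dropping the first factor f and appending the next
  conjugate. At \<open>m = p\<close>, if \<open>s [^] p\<close> is deep, the product commutes with s
  almost as well as with f.\<close>

lemma comm_norm_seq:
  assumes "f \<in> carrier G" "s \<in> carrier G"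
  shows "comm (norm_seq f s m) s = comm (norm_seq f s m) f \<otimes> comm f (s [^] m)"
proof -
  let ?g = "norm_seq f s m"
  have "comm ?g s = inv ?g \<otimes> conj_by ?g s" using assms by (simp add: group_word)
  also have "\<dots> = comm ?g f \<otimes> comm f (s [^] m)"
    unfolding conj_by_norm_seq[OF assms] using assms by (simp add: group_word)
  finally show ?thesis .
qed

lemma seq_diff_conj_by:
  assumes "x \<in> carrier G" "s \<in> carrier G"
  shows "seq_diff (\<lambda>m. conj_by x (s [^] m)) = (\<lambda>m. conj_by (comm x s) (s [^] m))"
proof
  fix m
  have "conj_by x (s [^] Suc m) = conj_by (conj_by x s) (s [^] m)"
    unfolding nat_pow_Suc2[OF assms(2)] using assms by (simp add: conj_by_conj_by)
  then show "seq_diff (\<lambda>m. conj_by x (s [^] m)) m = conj_by (comm x s) (s [^] m)"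
    using assms by (simp add: seq_diff_def conj_by_inv[symmetric] conj_by_mult[symmetric] del: nat_pow_Suc)
      (simp add: group_word)
qed

lemma seq_diff_norm_seq:
  assumes "f \<in> carrier G" "s \<in> carrier G"
  shows "(seq_diff ^^ Suc i) (norm_seq f s) = (\<lambda>m. conj_by (iter_comm f s i) (s [^] m))"
proof (induction i)
  case 0
  show ?case using assms by (simp add: seq_diff_def fun_eq_iff cancel_inv_left)
next
  case (Suc i)
  have "(seq_diff ^^ Suc (Suc i)) (norm_seq f s) = seq_diff (\<lambda>m. conj_by (iter_comm f s i) (s [^] m))"
    using Suc by simp
  then show ?case using assms by (simp add: seq_diff_conj_by)
qed

end

text \<open>The level of \<open>iter_comm f s i\<close> is \<open>i + 1\<close> because f already
  appears as a first difference; the p-th difference is therefore the commutator of f with only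
  \<open>p - 1\<close> copies of s.\<close>

lemma (in filtered_group) norm_seq_prime:
  assumes p: "prime p" and K: "K \<lhd> G" and FK: "F (Suc p) \<subseteq> K"
    and pow: "\<And>a. a \<in> F 2 \<Longrightarrow> a [^] p \<in> K"
    and f: "f \<in> F 0" and s: "s \<in> carrier G" and it: "\<And>i. iter_comm f s i \<in> F (Suc i)"
  shows "\<exists>k\<in>K. norm_seq f s p = f [^] p \<otimes> iter_comm f s (p - 1) \<otimes> k"
proof -
  have fc: "f \<in> carrier G" using f by simp
  have norm0: "norm_seq f s m \<in> F 0" for m
  proof (induction m)
    case (Suc m)
    then show ?case using F_m_closed normal_conj_by[OF F_normal f] s by simp
  qed (simp add: subgroup.one_closed[OF F_subgroup])
  have "seq_poly F p 0 (norm_seq f s)"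
  proof (rule seq_polyI)
    fix i m
    show "(seq_diff ^^ i) (norm_seq f s) m \<in> F (0 + i)"
    proof (cases i)
      case 0
      then show ?thesis using norm0 by simp
    next
      case (Suc j)
      then show ?thesis
        unfolding Suc seq_diff_norm_seq[OF fc s] using normal_conj_by[OF F_normal it] s by simp
    qed
  qed
  from seq_poly_value_prime[OF p K FK pow this]
  obtain k where "k \<in> K" "norm_seq f s p = norm_seq f s 1 [^] p \<otimes> (seq_diff ^^ p) (norm_seq f s) 0 \<otimes> k"
    by auto
  moreover have "(seq_diff ^^ p) (norm_seq f s) 0 = iter_comm f s (p - 1)"
    using seq_diff_norm_seq[OF fc s, of "p - 1"] prime_gt_0_nat[OF p] fc s by simp
  ultimately show ?thesis using fc by auto
qed

section \<open>Exact depth of p-th powers when the order is at least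
  \<open>p^(p + 3)\<close>\<close>

locale maximal_class_group_large = maximal_class_group4 +
  assumes odd_p: "odd p" and np: "p + 3 \<le> n"
begin

lemma p3: "3 \<le> p"
  using p odd_p prime_ge_2_nat[OF p] by (cases "p = 2") auto

text \<open>For \<open>p = 2 k + 1\<close>, non-consecutive indices number at most
  \<open>k - 1\<close> among 4 to p and at most \<open>k + 1\<close> among p neighbours, in total
  \<open>p - 1\<close>. If index 3 were not excluded by \<open>two_step_3\<close>, the bound would
  become p, too large by one.\<close>

lemma few_escape:
  assumes c: "c \<in> P" "c \<notin> lcs G 2" and u: "2 \<le> u"
  shows "card {i \<in> ({2..p} \<union> {u..<u + p}) \<inter> {2..n - 2}. c \<notin> two_step i} < p"
proof -
  define B where "B = {i \<in> {2..n - 2}. c \<notin> two_step i}"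
  have cons: "Suc i \<notin> B" if "i \<in> B" for i
    using that two_step_alternate[OF c, of i] by (auto simp: B_def)
  have B23: "2 \<notin> B" "3 \<notin> B" using c two_step_3[OF c] by (auto simp: B_def)
  have "card (B \<inter> {4..<4 + (p - 3)}) \<le> (p - 3 + 1) div 2"
    by (rule card_no_consecutive) (use cons in auto)
  moreover have "card (B \<inter> {u..<u + p}) \<le> (p + 1) div 2"
    by (rule card_no_consecutive) (use cons in auto)
  moreover have "{i \<in> ({2..p} \<union> {u..<u + p}) \<inter> {2..n - 2}. c \<notin> two_step i}
      \<subseteq> (B \<inter> {4..<4 + (p - 3)}) \<union> (B \<inter> {u..<u + p})"
  proof
    fix i assume i: "i \<in> {i \<in> ({2..p} \<union> {u..<u + p}) \<inter> {2..n - 2}. c \<notin> two_step i}"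
    then have iB: "i \<in> B" by (auto simp: B_def)
    then have "i \<noteq> 2" "i \<noteq> 3" using B23 by auto
    then show "i \<in> (B \<inter> {4..<4 + (p - 3)}) \<union> (B \<inter> {u..<u + p})" using i iB p3 by auto
  qed
  then have "card {i \<in> ({2..p} \<union> {u..<u + p}) \<inter> {2..n - 2}. c \<notin> two_step i}
      \<le> card (B \<inter> {4..<4 + (p - 3)}) + card (B \<inter> {u..<u + p})"
    by (meson card_Un_le card_mono finite_Int finite_UnI finite_atLeastLessThan order_trans)
  moreover have "(p - 3 + 1) div 2 + (p + 1) div 2 < p"
    using odd_p p3 by (elim oddE) auto
  ultimately show ?thesis by linarith
qed

text \<open>Escaping at the indices 2 to p makes \<open>s [^] p\<close> deep; escaping from u on
  lets s measure depth inside \<open>lcs G u\<close>.\<close>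

lemma ex_generic_at:
  assumes "2 \<le> u"
  obtains s where "s \<in> carrier G" "s \<notin> P" "s [^] p \<in> lcs G (Suc p)"
    "\<And>i. u \<le> i \<Longrightarrow> i < u + p \<Longrightarrow> i + 2 \<le> n \<Longrightarrow> s \<notin> two_step i"
proof -
  obtain c where c: "c \<in> P" "c \<notin> lcs G 2" using ex_generators by blast
  obtain s where s: "s \<in> carrier G" "s \<notin> P"
    and I: "\<And>i. i \<in> ({2..p} \<union> {u..<u + p}) \<inter> {2..n - 2} \<Longrightarrow> s \<notin> two_step i"
    using ex_generic[OF c _ few_escape[OF c assms]] by blast
  have "s [^] p \<in> lcs G (Suc p)"
    using np p3 by (intro generic_pow[OF s] I) auto
  moreover have "s \<notin> two_step i" if "u \<le> i" "i < u + p" "i + 2 \<le> n" for i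
    using that assms by (intro I) auto
  ultimately show thesis using that s by blast
qed

lemma iter_comm_lcs:
  assumes "f \<in> lcs G u" "s \<in> carrier G"
  shows "iter_comm f s i \<in> lcs G (u + i)"
proof (induction i)
  case (Suc i)
  then show ?case using comm_lcs_Suc[OF Suc assms(2)] by simp
qed (use assms in simp)

lemma iter_comm_not_in_lcs:
  assumes "2 \<le> u" "f \<in> lcs G u" "f \<notin> lcs G (Suc u)" "s \<in> carrier G"
    and "\<And>j. j < i \<Longrightarrow> s \<notin> two_step (u + j)" and "u + i < n"
  shows "iter_comm f s i \<notin> lcs G (Suc (u + i))"
  using assms(5,6)
proof (induction i)
  case (Suc i)
  have "comm (iter_comm f s i) s \<notin> lcs G (Suc (Suc (u + i)))"
    using Suc.prems Suc.IH assms iter_comm_lcs[OF assms(2,4), of i]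
    by (intro comm_not_in_lcs) auto
  then show ?case by simp
qed (use assms in simp)

text \<open>Truncated subtraction makes levels 0 and 1 coincide, since f has to belong to both. The
  extra one in the commutator condition is paid for by u being at least 2.\<close>

lemma filtered_lcs:
  assumes "2 \<le> u"
  shows "filtered_group G (\<lambda>k. lcs G (u + (k - 1)))"
proof -
  have "comm x y \<in> lcs G (u + (Suc (i + j) - 1))"
    if "x \<in> lcs G (u + (i - 1))" "y \<in> lcs G (u + (j - 1))" for x y i j
    by (rule comm_lcs_le[OF that]) (use assms in simp)
  moreover have "lcs G (u + (Suc k - 1)) \<subseteq> lcs G (u + (k - 1))" for k
    by (rule lcs_antimono) simp
  ultimately show ?thesis
    by (intro filtered_group.intro filtered_group_axioms.intro group_axioms lcs_normal)
qed

text \<open>By induction from the bottom of the series, p-th powers from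
  \<open>lcs G (u + 1)\<close> are negligible, so modulo \<open>lcs G \<mu>\<close> the norm of f
  under a generic s is \<open>f [^] p\<close> times \<open>iter_comm f s (p - 1)\<close>. The norm
  itself lies in \<open>lcs G \<mu>\<close>, so \<open>f [^] p\<close> is inverse to a commutator
  whose depth \<open>u + p - 1\<close> is under control.\<close>

lemma pow_lcs:
  assumes "2 \<le> u" "f \<in> lcs G u"
  shows "f [^] p \<in> lcs G (min (u + p - 1) (n - 1))"
    and "u + p + 1 \<le> n \<Longrightarrow> f \<notin> lcs G (Suc u) \<Longrightarrow> f [^] p \<notin> lcs G (u + p)"
proof -
  have "f [^] p \<in> lcs G (min (u + p - 1) (n - 1))
      \<and> (u + p + 1 \<le> n \<longrightarrow> f \<notin> lcs G (Suc u) \<longrightarrow> f [^] p \<notin> lcs G (u + p))"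
    using assms
  proof (induction "n - u" arbitrary: u f rule: less_induct)
    case less
    show ?case
    proof (cases "u < n")
      case False
      then have "f = \<one>" using less.prems lcs_n[of u] by simp
      then show ?thesis using False by simp
    next
      case True
      note u = \<open>2 \<le> u\<close> and f = \<open>f \<in> lcs G u\<close>
      have fc: "f \<in> carrier G" using f lcs_carrier by blast
      obtain s where s: "s \<in> carrier G" "s \<notin> P" and sp: "s [^] p \<in> lcs G (Suc p)"
        and gen: "\<And>i. u \<le> i \<Longrightarrow> i < u + p \<Longrightarrow> i + 2 \<le> n \<Longrightarrow> s \<notin> two_step i"
        using ex_generic_at[OF u] by blast
      \<comment> \<open>The cap \<open>n - 1\<close> is where depth can no longer be measured: the
        last proper two-step centralizer has index \<open>n - 2\<close>.\<close>
      define \<mu> where "\<mu> = min (u + p) (n - 1)"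
      interpret F: filtered_group G "\<lambda>k. lcs G (u + (k - 1))" by (rule filtered_lcs[OF u])
      let ?g = "norm_seq f s p" and ?i = "iter_comm f s (p - 1)"
      have "\<exists>k\<in>lcs G \<mu>. ?g = f [^] p \<otimes> ?i \<otimes> k"
      proof (rule F.norm_seq_prime[OF p lcs_normal _ _ _ s(1)])
        show "lcs G (u + (Suc p - 1)) \<subseteq> lcs G \<mu>" by (rule lcs_antimono) (simp add: \<mu>_def)
        fix a assume "a \<in> lcs G (u + (2 - 1))"
        then have "a [^] p \<in> lcs G (min (u + 1 + p - 1) (n - 1))"
          using less.hyps[of "u + 1" a] True u by simp
        then show "a [^] p \<in> lcs G \<mu>" by (simp add: \<mu>_def)
      qed (use f iter_comm_lcs[OF f s(1)] in simp_all)
      then obtain k where k: "k \<in> lcs G \<mu>" and g: "?g = f [^] p \<otimes> ?i \<otimes> k" by blast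
      have gu: "?g \<in> lcs G u"
      proof -
        have "norm_seq f s m \<in> lcs G u" for m
          by (induction m) (use normal_conj_by[OF lcs_normal f] s lcs_m_closed in auto)
        then show ?thesis .
      qed
      have "u \<le> \<mu>" using True p3 by (simp add: \<mu>_def)
      \<comment> \<open>If the norm had exact depth w, its commutator with s would have exact depth
        \<open>w + 1\<close>; but it is the product of the commutator of the norm with f and that of
        f with \<open>s [^] p\<close>, both of depth at least \<open>w + 2\<close>.\<close>
      have "?g \<in> lcs G w" if "u \<le> w" "w \<le> \<mu>" for w
        using that
      proof (induction w rule: dec_induct)
        case base
        show ?case using gu .
      next
        case (step w)
        have w: "?g \<in> lcs G w" "w < u + p" "w + 2 \<le> n" using step by (auto simp: \<mu>_def)
        show ?case
        proof (rule ccontr)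
          assume "?g \<notin> lcs G (Suc w)"
          then have "comm ?g s \<notin> lcs G (Suc (Suc w))"
            using w gen[of w] step.hyps u s by (intro comm_not_in_lcs) auto
          moreover have "comm ?g f \<in> lcs G (Suc (Suc w))"
            by (rule comm_lcs_le[OF w(1) f]) (use u in simp)
          moreover have "comm f (s [^] p) \<in> lcs G (Suc (Suc w))"
            by (rule comm_lcs_le[OF f sp]) (use w in simp)
          ultimately show False using lcs_m_closed comm_norm_seq[OF fc s(1)] by metis
        qed
      qed
      then have "?g \<in> lcs G \<mu>" using \<open>u \<le> \<mu>\<close> by simp
      then have fi: "f [^] p \<otimes> ?i \<in> lcs G \<mu>"
        using normal_mult_iff(2)[OF lcs_normal k] g fc s by simp
      have ii: "?i \<in> lcs G (u + p - 1)" using iter_comm_lcs[OF f s(1), of "p - 1"] p3 by simp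
      have "f [^] p \<in> lcs G (min (u + p - 1) (n - 1))"
      proof -
        have "f [^] p \<otimes> ?i \<in> lcs G (min (u + p - 1) (n - 1))"
          using fi by (rule lcs_antimonoD) (auto simp: \<mu>_def)
        moreover have "?i \<in> lcs G (min (u + p - 1) (n - 1))"
          using ii by (rule lcs_antimonoD) simp
        ultimately show ?thesis using normal_mult_iff(2)[OF lcs_normal] fc by blast
      qed
      moreover have "f [^] p \<notin> lcs G (u + p)" if "u + p + 1 \<le> n" "f \<notin> lcs G (Suc u)"
      proof
        assume "f [^] p \<in> lcs G (u + p)"
        moreover have "\<mu> = u + p" using that by (simp add: \<mu>_def)
        ultimately have "?i \<in> lcs G (u + p)"
          using fi normal_mult_iff(1)[OF lcs_normal] fc s by simp
        moreover have "?i \<notin> lcs G (Suc (u + (p - 1)))"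
          using that p3 by (intro iter_comm_not_in_lcs u f s gen) auto
        ultimately show False using p3 by simp
      qed
      ultimately show ?thesis by blast
    qed
  qed
  then show "f [^] p \<in> lcs G (min (u + p - 1) (n - 1))"
    and "u + p + 1 \<le> n \<Longrightarrow> f \<notin> lcs G (Suc u) \<Longrightarrow> f [^] p \<notin> lcs G (u + p)"
    by blast+
qed

text \<open>\<open>pow_lcs\<close> starts at depth 2, so the roles are exchanged: the computation is
  made for \<open>y = [s, f]\<close>, of exact depth 2, with f as the conjugating element. The norm
  of y is trivial, and since f lies in \<open>P\<close> the iterated commutators are one step too
  deep to balance \<open>y [^] p\<close>.\<close>

lemma exponent_p_not_top:
  assumes f: "f \<in> P" "f [^] p = \<one>"
  shows "f \<in> lcs G 2"
proof (rule ccontr)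
  assume f2: "f \<notin> lcs G 2"
  obtain s where s: "s \<in> carrier G" "s \<notin> P" using ex_generators by blast
  have fc: "f \<in> carrier G" using f two_step_carrier by blast
  define y where "y = comm s f"
  have y: "y \<in> lcs G 2" using comm_lcs_Suc[of s 1 f] s fc by (simp add: y_def numeral_2_eq_2)
  have yc: "y \<in> carrier G" using y lcs_carrier by blast
  have y3: "y \<notin> lcs G (Suc 2)" using comm_generators[OF f(1) f2 s] normal_comm_swap[OF lcs_normal fc s(1)]
    by (simp add: y_def numeral_3_eq_3 numeral_2_eq_2)
  have "norm_seq y f p = \<one>"
  proof -
    \<comment> \<open>By \<open>norm_seq_eq\<close> the norm is a p-th power of
      \<open>y f^-1\<close>, which is a conjugate of \<open>f^-1\<close>, times
      \<open>f [^] p\<close>.\<close>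
    have "y \<otimes> inv f = conj_by (inv f) s" using s fc by (simp add: y_def group_word)
    then have "(y \<otimes> inv f) [^] p = conj_by (inv f [^] p) s" using s fc by (simp add: conj_by_pow)
    also have "\<dots> = \<one>" using f fc s by (simp add: nat_pow_inv)
    finally show ?thesis using norm_seq_eq[OF yc fc] f by simp
  qed
  have it: "iter_comm y f (Suc i) \<in> lcs G (4 + i)" for i
  proof (induction i)
    case 0
    then show ?case using two_stepD[OF f(1) y] by simp
  next
    case (Suc i)
    show ?case using comm_lcs_Suc[OF Suc fc] by simp
  qed
  interpret F: filtered_group G "\<lambda>k. lcs G (2 + (k - 1))" by (rule filtered_lcs) simp
  have "\<exists>k\<in>lcs G (p + 2). norm_seq y f p = y [^] p \<otimes> iter_comm y f (p - 1) \<otimes> k"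
  proof (rule F.norm_seq_prime[OF p lcs_normal _ _ _ fc])
    show "lcs G (2 + (Suc p - 1)) \<subseteq> lcs G (p + 2)" by (rule lcs_antimono) simp
    fix a assume "a \<in> lcs G (2 + (2 - 1))"
    then have "a [^] p \<in> lcs G (min (3 + p - 1) (n - 1))" using pow_lcs(1)[of 3 a] by simp
    then show "a [^] p \<in> lcs G (p + 2)" by (rule lcs_antimonoD) (use np in simp)
  qed (use y iter_comm_lcs[OF y fc] in simp_all)
  then obtain k where k: "k \<in> lcs G (p + 2)" "\<one> = y [^] p \<otimes> iter_comm y f (p - 1) \<otimes> k"
    using \<open>norm_seq y f p = \<one>\<close> by auto
  have "iter_comm y f (p - 1) \<in> lcs G (p + 2)"
    using it[of "p - 2"] p3 by (simp add: Suc_diff_Suc eval_nat_numeral)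
  then have "iter_comm y f (p - 1) \<otimes> k \<in> lcs G (p + 2)" using k lcs_m_closed by blast
  moreover have "y [^] p \<otimes> (iter_comm y f (p - 1) \<otimes> k) = \<one>"
    using k(2)[symmetric] yc fc lcs_carrier[OF k(1)] by (simp only: m_assoc nat_pow_closed iter_comm_closed)
  ultimately have "y [^] p \<in> lcs G (p + 2)"
    using normal_mult_iff(2)[OF lcs_normal, of _ _ "y [^] p"] yc lcs_one_closed by (metis nat_pow_closed)
  then show False using pow_lcs(2)[OF _ y _ y3] np by (simp add: add.commute)
qed

lemma exponent_p_in_lcs:
  assumes f: "f \<in> P" "f [^] p = \<one>"
  shows "f \<in> lcs G (n - p)"
proof -
  have "f \<in> lcs G u" if "2 \<le> u" "u \<le> n - p" for u
    using that
  proof (induction u rule: dec_induct)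
    case base
    then show ?case using exponent_p_not_top[OF f] by simp
  next
    case (step u)
    then show ?case using pow_lcs(2)[of u f] f np by fastforce
  qed
  then show ?thesis using np by simp
qed

end

section \<open>Quadratic subgroups in groups of maximal class\<close>

lemma (in group) card_mult_le:
  assumes fin: "finite (carrier G)" and E: "subgroup E G" and L: "subgroup L G" and H: "subgroup H G"
    and "E \<subseteq> H" "L \<subseteq> H" "E \<inter> L = {\<one>}"
  shows "card E * card L \<le> card H"
    and "card E * card L = card H \<Longrightarrow> h \<in> H \<Longrightarrow> \<exists>e\<in>E. \<exists>x\<in>L. h = e \<otimes> x"
proof -
  have finH: "finite H" using fin H by (meson finite_subset subgroup.subset)
  have Ec: "e \<in> carrier G" if "e \<in> E" for e using E that by (rule subgroup.mem_carrier)
  have Lc: "e \<in> carrier G" if "e \<in> L" for e using L that by (rule subgroup.mem_carrier)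
  let ?f = "\<lambda>(e, x). e \<otimes> x"
  have inj: "inj_on ?f (E \<times> L)"
  proof (rule inj_onI, clarify)
    fix e x e' x' assume ex: "e \<in> E" "x \<in> L" "e' \<in> E" "x' \<in> L" and eq: "e \<otimes> x = e' \<otimes> x'"
    have "inv e' \<otimes> e = x' \<otimes> inv x"
    proof -
      have "inv e' \<otimes> (e \<otimes> x) \<otimes> inv x = inv e' \<otimes> e"
        using ex Ec Lc by (simp add: m_assoc)
      moreover have "inv e' \<otimes> (e' \<otimes> x') \<otimes> inv x = x' \<otimes> inv x"
        using ex Ec Lc by (simp add: m_assoc cancel_inv_left)
      ultimately show ?thesis using eq by simp
    qed
    moreover have "inv e' \<otimes> e \<in> E" "x' \<otimes> inv x \<in> L"
      using ex E L by (simp_all add: subgroup.m_closed subgroup.m_inv_closed)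
    ultimately have "inv e' \<otimes> e = \<one>" "x' \<otimes> inv x = \<one>" using \<open>E \<inter> L = {\<one>}\<close> by auto
    then show "e = e' \<and> x = x'" using ex Ec Lc
      by (metis inv_closed inv_equality inv_inv)
  qed
  have sub: "?f ` (E \<times> L) \<subseteq> H" using assms by (auto intro: subgroup.m_closed)
  have c: "card (?f ` (E \<times> L)) = card E * card L"
    using card_image[OF inj] by (simp add: card_cartesian_product)
  show "card E * card L \<le> card H"
    using card_mono[OF finH sub] c by simp
  assume "card E * card L = card H" "h \<in> H"
  then have "?f ` (E \<times> L) = H" using c sub finH by (simp add: card_subset_eq)
  then have "h \<in> ?f ` (E \<times> L)" using \<open>h \<in> H\<close> by simp
  then show "\<exists>e\<in>E. \<exists>x\<in>L. h = e \<otimes> x" by auto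
qed

text \<open>\<open>Q\<close> abstracts the elements acting quadratically on a module: by assumption such an element is
  never central.\<close>

context maximal_class_group
begin

theorem quadratic_subgroup_card:
  assumes odd_p: "odd p" and E: "elementary_abelian_subgroup p G E"
    and QE: "\<And>e. e \<in> E \<Longrightarrow> Q e"
    and Q_comm: "\<And>e g. Q e \<Longrightarrow> e \<in> carrier G \<Longrightarrow> g \<in> carrier G \<Longrightarrow>
      comm (comm e g) e = \<one> \<Longrightarrow> comm (comm e g) g = \<one> \<Longrightarrow> Q (comm e g)"
    and Q_center: "\<And>c. Q c \<Longrightarrow> c \<in> center G \<Longrightarrow> c = \<one>"
  shows "card E < p ^ (p - 1)"
proof (rule ccontr)
  assume "\<not> ?thesis"
  then have cE: "p ^ (p - 1) \<le> card E" by simp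
  have p3: "3 \<le> p" using p odd_p prime_ge_2_nat[OF p] by (cases "p = 2") auto
  have p1: "1 < p" using p3 by simp
  have Es: "subgroup E G" and Ep: "\<And>e. e \<in> E \<Longrightarrow> e [^] p = \<one>"
    and Ecomm: "\<And>e f. e \<in> E \<Longrightarrow> f \<in> E \<Longrightarrow> e \<otimes> f = f \<otimes> e"
    using E unfolding elementary_abelian_subgroup_def by blast+
  have Ec: "e \<in> carrier G" if "e \<in> E" for e using Es that by (rule subgroup.mem_carrier)
  have "1 < p ^ (p - 1)" using p1 p3 by (intro one_less_power) auto
  then have "card E \<noteq> 1" using cE by simp
  then have "E \<noteq> {\<one>}" by auto
  then obtain e0 where e0: "e0 \<in> E" "e0 \<noteq> \<one>"
    using subgroup.one_closed[OF Es] by fastforce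
  have centerI: "c \<in> center G" if "c \<in> carrier G" "\<And>g. g \<in> carrier G \<Longrightarrow> comm c g = \<one>" for c
    using that comm_eq_one_iff unfolding center_def by simp
  have center_lcs: "c \<in> center G" if "c \<in> lcs G (n - 1)" for c
  proof (rule centerI)
    show "c \<in> carrier G" using that lcs_carrier by blast
    show "comm c g = \<one>" if "g \<in> carrier G" for g
      using comm_lcs_Suc[OF \<open>c \<in> lcs G (n - 1)\<close> that] lcs_n[of n] n2 by simp
  qed
  have kill_center: "comm e g = \<one>" if "Q e" "e \<in> carrier G" "g \<in> carrier G" "comm e g \<in> center G" for e g
  proof (rule Q_center[OF Q_comm])
    have c: "comm e g \<in> carrier G" using that by simp
    have "comm (comm e g) h = \<one>" if "h \<in> carrier G" for h
      using \<open>comm e g \<in> center G\<close> comm_eq_one_iff[OF c that] that by (simp add: center_def)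
    then show "comm (comm e g) e = \<one>" "comm (comm e g) g = \<one>" using that by blast+
  qed (use that in simp_all)
  \<comment> \<open>Commutators with q land in the central term \<open>lcs G (n - 1)\<close>, so
    \<open>kill_center\<close> makes q central.\<close>
  have kill: "q = \<one>" if "Q q" "q \<in> lcs G (n - 2)" for q
  proof -
    have qc: "q \<in> carrier G" using that lcs_carrier by blast
    have "comm q g = \<one>" if g: "g \<in> carrier G" for g
    proof (rule kill_center[OF \<open>Q q\<close> qc g center_lcs])
      show "comm q g \<in> lcs G (n - 1)"
        using comm_lcs_Suc[OF \<open>q \<in> lcs G (n - 2)\<close> g] n2 by (simp add: Suc_diff_le numeral_2_eq_2 Suc_diff_Suc)
    qed
    then show ?thesis using centerI qc Q_center that by blast
  qed
  \<comment> \<open>For smaller n all commutators are central, so the non-trivial \<open>e0\<close>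
    would be central.\<close>
  have n4: "4 \<le> n"
  proof (rule ccontr)
    assume "\<not> 4 \<le> n"
    then have "lcs G 3 = {\<one>}" by (intro lcs_n) simp
    have "comm e0 g = \<one>" if g: "g \<in> carrier G" for g
    proof (rule kill_center[OF QE[OF e0(1)] Ec[OF e0(1)] g centerI])
      show "comm e0 g \<in> carrier G" using Ec[OF e0(1)] g by simp
      have c: "comm e0 g \<in> lcs G 2" using comm_lcs_Suc[of e0 1 g] Ec[OF e0(1)] g by (simp add: numeral_2_eq_2)
      show "comm (comm e0 g) h = \<one>" if "h \<in> carrier G" for h
        using comm_lcs_Suc[OF c that] \<open>lcs G 3 = {\<one>}\<close> by (simp add: eval_nat_numeral)
    qed
    then have "e0 \<in> center G" using centerI Ec[OF e0(1)] by blast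
    then show False using Q_center QE e0 by blast
  qed
  interpret maximal_class_group4 G p n by unfold_locales (rule n4)
  \<comment> \<open>\<open>?L\<close> plays the part of the second center and \<open>?C\<close> is
    its centralizer.\<close>
  let ?L = "lcs G (n - 2)" and ?C = "two_step (n - 2)"
  have cL: "card ?L = p ^ 2" using card_lcs[of "n - 2"] n4 by simp
  have EL1: "E \<inter> ?L = {\<one>}"
    using kill QE subgroup.one_closed[OF Es] by auto
  have EL: "comm e x = \<one>" if "e \<in> E" "x \<in> ?L" for e x
  proof (rule kill_center[OF QE[OF that(1)] Ec[OF that(1)] lcs_carrier[OF that(2)] center_lcs])
    have "comm e x \<in> lcs G (1 + (n - 2))" by (rule comm_lcs) (use that Ec in simp_all)
    then show "comm e x \<in> lcs G (n - 1)" using n4 by (simp add: Suc_diff_Suc numeral_2_eq_2)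
  qed
  have EC: "E \<subseteq> ?C"
  proof
    fix e assume e: "e \<in> E"
    have "comm x e = \<one>" if "x \<in> ?L" for x
      using EL[OF e that] inv_comm[OF Ec[OF e] lcs_carrier[OF that]] by simp
    then show "e \<in> ?C" using Ec[OF e] by (simp add: two_step_def)
  qed
  have LC: "?L \<subseteq> ?C"
    using lcs_antimono[of 2 "n - 2"] n4 by (intro order_trans[OF _ lcs_2_two_step]) simp
  have Cproper: "?C \<noteq> carrier G" using two_step_proper[of "n - 2"] n4 by simp
  have cC: "card ?C \<le> p ^ (n - 1)"
  proof -
    have "p * card ?C \<le> p ^ n"
      using proper_subgroup_card_le[OF two_step_subgroup subgroup_self _ Cproper] two_step_carrier card_G by auto
    moreover have "p ^ n = p * p ^ (n - 1)" using n4 by (cases n) auto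
    ultimately show ?thesis using p1 by simp
  qed
  \<comment> \<open>The exponent is \<open>(p - 1) + 2\<close>: products of elements of
    \<open>E\<close> and \<open>?L\<close> are all distinct.\<close>
  have low: "p ^ (p + 1) \<le> card H" if "subgroup H G" "E \<subseteq> H" "?L \<subseteq> H" for H
  proof -
    have "p ^ (p + 1) = p ^ (p - 1) * p ^ 2" using p1 by (simp flip: power_add)
    also have "\<dots> \<le> card E * card ?L" using cE cL by simp
    also have "\<dots> \<le> card H" by (rule card_mult_le(1)[OF finite_G Es lcs_subgroup that EL1])
    finally show ?thesis .
  qed
  have "p ^ (p + 1) \<le> p ^ (n - 1)" using low[OF two_step_subgroup EC LC] cC by linarith
  then have np2: "p + 2 \<le> n" using p1 n4 by (simp add: power_increasing_iff del: power_Suc)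
  show False
  proof (cases "n = p + 2")
    case False
    then interpret maximal_class_group_large G p n
      by unfold_locales (use np2 odd_p in auto)
    have EP: "E \<subseteq> P"
    proof
      fix e assume e: "e \<in> E"
      \<comment> \<open>Commutators of \<open>E\<close> with \<open>lcs G (n - 3)\<close> fall into
        \<open>?L\<close>, where \<open>kill\<close> applies. As e then lies in two consecutive
        two-step centralizers, \<open>two_step_alternate\<close> provides one that also contains c,
        and such a centralizer lies in \<open>P\<close>.\<close>
      have "e \<in> two_step (n - 3)"
      proof -
        have "comm x e = \<one>" if x: "x \<in> lcs G (n - 3)" for x
        proof -
          have xc: "x \<in> carrier G" using x lcs_carrier by blast
          have q: "comm e x \<in> ?L"
          proof -
            have "comm e x \<in> lcs G (1 + (n - 3))" by (rule comm_lcs) (use e Ec x in simp_all)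
            moreover have "1 + (n - 3) = n - 2" using n4 by simp
            ultimately show ?thesis by simp
          qed
          have "comm e x = \<one>"
          proof (rule kill[OF Q_comm q])
            show "comm (comm e x) e = \<one>"
              using EL[OF e q] inv_comm[OF Ec[OF e] lcs_carrier[OF q]] by simp
            have "comm (comm e x) x \<in> lcs G n"
              by (rule comm_lcs_le[OF q x]) (use np p3 in simp)
            then show "comm (comm e x) x = \<one>" using lcs_n[of n] by simp
          qed (use e xc QE Ec in simp_all)
          then show ?thesis using inv_comm[OF Ec[OF e] xc] by simp
        qed
        then show ?thesis using Ec[OF e] by (simp add: two_step_def)
      qed
      obtain c s where c: "c \<in> P" "c \<notin> lcs G 2" and s: "s \<in> carrier G" "s \<notin> P" using ex_generators .
      have "c \<in> two_step (n - 3) \<or> c \<in> two_step (Suc (n - 3))"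
        by (rule two_step_alternate[OF c]) (use np p3 in auto)
      moreover have "Suc (n - 3) = n - 2" using n4 by simp
      ultimately obtain i where i: "i = n - 3 \<or> i = n - 2" "c \<in> two_step i" by auto
      have i2: "2 \<le> i" "i + 2 \<le> n" using i(1) np p3 by linarith+
      have "e \<in> two_step i" using i(1) \<open>e \<in> two_step (n - 3)\<close> EC e by blast
      then show "e \<in> P"
        using two_step_generators[OF i2 c i(2) Ec[OF e]] by blast
    qed
    then have "E \<subseteq> lcs G (n - p)" using exponent_p_in_lcs Ep by blast
    moreover have "?L \<subseteq> lcs G (n - p)" using p3 by (intro lcs_antimono) simp
    ultimately have "p ^ (p + 1) \<le> card (lcs G (n - p))" using low[OF lcs_subgroup] by blast
    also have "\<dots> = p ^ p" using card_lcs[of "n - p"] np by simp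
    finally show False using p1 by simp
  next
    case True
    \<comment> \<open>Here the lower bound is attained, so \<open>?C\<close> consists of the
      products of \<open>E\<close> and \<open>?L\<close> and is an abelian maximal subgroup.\<close>
    have "card ?C \<le> p ^ (p + 1)" using cC True by simp
    moreover have "p ^ (p - 1) * p ^ 2 = p ^ (p + 1)" using p1 by (simp flip: power_add)
    moreover have "p ^ (p - 1) * p ^ 2 \<le> card E * card ?L" using cE cL by simp
    moreover have "card E * card ?L \<le> card ?C" by (rule card_mult_le(1)[OF finite_G Es lcs_subgroup two_step_subgroup EC LC EL1])
    ultimately have cEL: "card E * card ?L = card ?C" by linarith
    have Cabel: "x \<otimes> y = y \<otimes> x" if xy: "x \<in> ?C" "y \<in> ?C" for x y
    proof -
      obtain e a where ea: "e \<in> E" "a \<in> ?L" "x = e \<otimes> a"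
        using card_mult_le(2)[OF finite_G Es lcs_subgroup two_step_subgroup EC LC EL1 cEL xy(1)] by blast
      obtain f b where fb: "f \<in> E" "b \<in> ?L" "y = f \<otimes> b"
        using card_mult_le(2)[OF finite_G Es lcs_subgroup two_step_subgroup EC LC EL1 cEL xy(2)] by blast
      have c: "e \<in> carrier G" "f \<in> carrier G" "a \<in> carrier G" "b \<in> carrier G"
        using ea fb Ec lcs_carrier by blast+
      have "comm a b \<in> lcs G n" by (rule comm_lcs_le[OF ea(2) fb(2)]) (use n4 in simp)
      then have ab: "a \<otimes> b = b \<otimes> a" using lcs_n[of n] c comm_eq_one_iff by simp
      have ef: "e \<otimes> f = f \<otimes> e" using Ecomm ea fb by blast
      have eb: "e \<otimes> b = b \<otimes> e" and fa: "f \<otimes> a = a \<otimes> f"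
        using EL ea fb c comm_eq_one_iff by blast+
      have "x \<otimes> y = e \<otimes> (a \<otimes> f) \<otimes> b" using ea fb c by (simp add: m_assoc)
      also have "\<dots> = (e \<otimes> f) \<otimes> (a \<otimes> b)" using c by (simp add: m_assoc flip: fa)
      also have "\<dots> = f \<otimes> (e \<otimes> b) \<otimes> a" unfolding ef ab using c by (simp add: m_assoc)
      also have "\<dots> = y \<otimes> x" unfolding eb using ea fb c by (simp add: m_assoc)
      finally show ?thesis .
    qed
    have Csub: "?C \<subseteq> two_step i" if "2 \<le> i" for i
    proof
      fix c assume c: "c \<in> ?C"
      have cc: "c \<in> carrier G" using c two_step_carrier by blast
      have "comm x c = \<one>" if "x \<in> lcs G i" for x
      proof -
        have "x \<in> ?C" using lcs_2_two_step[of "n - 2"] lcs_antimono[OF \<open>2 \<le> i\<close>] that by blast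
        then show ?thesis using Cabel[OF _ c] comm_eq_one_iff two_step_carrier cc by blast
      qed
      then show "c \<in> two_step i" using cc by (simp add: two_step_def)
    qed
    have C_index: "card (carrier G) \<le> p * card ?C"
      using low[OF two_step_subgroup EC LC] card_G True p1 by simp
    obtain s where s: "s \<in> carrier G" "s \<notin> ?C" using Cproper two_step_carrier by blast
    have s2: "s \<notin> two_step i" if "2 \<le> i" "i + 2 \<le> n" for i
    proof
      assume "s \<in> two_step i"
      then have "two_step i = carrier G"
        using prime_index_subgroup_eq[OF finite_G p two_step_subgroup[of "n - 2"] two_step_subgroup[of i]
            subgroup_self Csub[OF that(1)] _ _ C_index card_G] s(2) two_step_carrier by blast
      then show False using two_step_proper[of i] that by simp
    qed
    have "\<not> E \<subseteq> lcs G 2"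
    proof
      assume "E \<subseteq> lcs G 2"
      moreover have "?L \<subseteq> lcs G 2" using n4 by (intro lcs_antimono) simp
      ultimately have "p ^ (p + 1) \<le> card (lcs G 2)" using low[OF lcs_subgroup] by blast
      then show False using card_lcs[of 2] n4 True p1 by simp
    qed
    then obtain f where f: "f \<in> E" "f \<notin> lcs G 2" by blast
    have fc: "f \<in> carrier G" using f Ec by blast
    have fC: "f \<in> ?C" using f EC by blast
    have C_normal: "?C \<lhd> G" by (rule normal_if_lcs_2[OF two_step_subgroup lcs_2_two_step])
    \<comment> \<open>Intersecting the lower central series with these elements gives a filtration
      that can start with f outside \<open>lcs G 2\<close>, because all commutators and all p-th
      powers inside \<open>\<Omega>\<close> are trivial.\<close>
    define \<Omega> where "\<Omega> = {x \<in> ?C. x [^] p = \<one>}"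
    have pow_mult: "(x \<otimes> y) [^] p = x [^] p \<otimes> y [^] p" if "x \<in> ?C" "y \<in> ?C" for x y
      using that Cabel two_step_carrier by (intro pow_mult_distrib) auto
    have \<Omega>_sub: "subgroup \<Omega> G"
    proof (rule subgroupI)
      show "\<Omega> \<subseteq> carrier G" unfolding \<Omega>_def using two_step_carrier by blast
      show "\<Omega> \<noteq> {}" unfolding \<Omega>_def using subgroup.one_closed[OF two_step_subgroup] nat_pow_one by blast
      fix a b assume "a \<in> \<Omega>" "b \<in> \<Omega>"
      then show "a \<otimes> b \<in> \<Omega>" unfolding \<Omega>_def
        using pow_mult subgroup.m_closed[OF two_step_subgroup] by simp
    next
      fix a assume "a \<in> \<Omega>"
      then show "inv a \<in> \<Omega>" unfolding \<Omega>_def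
        using subgroup.m_inv_closed[OF two_step_subgroup] two_step_carrier by (auto simp: nat_pow_inv)
    qed
    have \<Omega>: "\<Omega> \<lhd> G"
    proof (rule normalI_conj_by[OF \<Omega>_sub])
      fix x g assume x: "x \<in> \<Omega>" and g: "g \<in> carrier G"
      have xc: "x \<in> carrier G" using \<Omega>_sub x by (rule subgroup.mem_carrier)
      have "conj_by x g \<in> ?C" using normal_conj_by[OF C_normal _ g] x by (simp add: \<Omega>_def)
      moreover have "conj_by x g [^] p = \<one>" using conj_by_pow[OF xc g, of p] x g by (simp add: \<Omega>_def)
      ultimately show "conj_by x g \<in> \<Omega>" by (simp add: \<Omega>_def)
    qed
    have f\<Omega>: "f \<in> \<Omega>" using fC Ep f by (simp add: \<Omega>_def)
    have comm\<Omega>: "comm x y = \<one>" if "x \<in> \<Omega>" "y \<in> ?C" for x y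
      using that Cabel comm_eq_one_iff two_step_carrier unfolding \<Omega>_def by blast
    interpret F: filtered_group G "\<lambda>k. \<Omega> \<inter> lcs G k"
    proof (intro filtered_group.intro filtered_group_axioms.intro group_axioms)
      show "\<Omega> \<inter> lcs G k \<lhd> G" for k using normal_subgroup_intersect[OF \<Omega> lcs_normal] .
      show "\<Omega> \<inter> lcs G (Suc k) \<subseteq> \<Omega> \<inter> lcs G k" for k using lcs_Suc_subset by blast
      show "comm x y \<in> \<Omega> \<inter> lcs G (Suc (i + j))" if "x \<in> \<Omega> \<inter> lcs G i" "y \<in> \<Omega> \<inter> lcs G j" for x y i j
        using that comm\<Omega>[of x y] subgroup.one_closed[OF \<Omega>_sub] by (simp add: \<Omega>_def)
    qed
    have it: "iter_comm f s i \<in> \<Omega> \<inter> lcs G (Suc i)" for i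
    proof (induction i)
      case 0
      then show ?case using f\<Omega> fc by simp
    next
      case (Suc i)
      then show ?case using comm_lcs_Suc[of _ "Suc i" s] normal_comm_left[OF \<Omega>] s by simp
    qed
    have "\<exists>k\<in>lcs G (Suc p). norm_seq f s p = f [^] p \<otimes> iter_comm f s (p - 1) \<otimes> k"
      by (rule F.norm_seq_prime[OF p lcs_normal]) (use it s f\<Omega> fc in \<open>auto simp: \<Omega>_def\<close>)
    then obtain k where k: "k \<in> lcs G (Suc p)" "norm_seq f s p = iter_comm f s (p - 1) \<otimes> k"
      using f Ep fc s by auto
    have it': "iter_comm f s (Suc i) \<notin> lcs G (3 + i)" if "i + 2 \<le> p" for i
      using that
    proof (induction i)
      case 0
      have "s \<notin> P" using s2[of 2] n4 by simp
      then show ?case using comm_generators[of f s] f s Csub[of 2] fC by auto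
    next
      case (Suc i)
      have "comm (iter_comm f s (Suc i)) s \<notin> lcs G (Suc (Suc (Suc (Suc i))))"
        by (rule comm_not_in_lcs) (use Suc it[of "Suc i"] s s2[of "Suc (Suc i)"] True in \<open>auto simp: eval_nat_numeral\<close>)
      then show ?case by (simp add: eval_nat_numeral)
    qed
    have "iter_comm f s (p - 1) \<notin> lcs G (Suc p)" using it'[of "p - 2"] p3
      by (simp add: Suc_diff_Suc eval_nat_numeral)
    then have gn: "norm_seq f s p \<notin> lcs G (Suc p)"
      using k normal_mult_iff(2)[OF lcs_normal k(1)] fc s by simp
    have gp: "norm_seq f s p \<in> lcs G p"
    proof -
      have "iter_comm f s (p - 1) \<in> lcs G p" using it[of "p - 1"] p1 by simp
      then show ?thesis using k lcs_Suc_subset[of p] lcs_m_closed by auto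
    qed
    \<comment> \<open>The norm has exact depth \<open>p = n - 2\<close>, so s cannot commute with
      it; yet f, the norm and \<open>s [^] p\<close> lie in the abelian \<open>?C\<close>, and then
      \<open>comm_norm_seq\<close> says that it does.\<close>
    have "comm (norm_seq f s p) s \<notin> lcs G (Suc (Suc p))"
      by (rule comm_not_in_lcs[OF _ _ gp gn s(1) s2]) (use True p3 in auto)
    moreover have "comm (norm_seq f s p) s = \<one>"
    proof -
      have "norm_seq f s m \<in> \<Omega>" for m
        by (induction m) (use normal_conj_by[OF \<Omega> f\<Omega>] s \<Omega>_sub in \<open>auto intro: subgroup.m_closed subgroup.one_closed\<close>)
      then have "comm (norm_seq f s p) f = \<one>" using comm\<Omega> fC by blast
      moreover have "s [^] p \<in> ?C"
        by (rule maximal_subgroup_pow[OF two_step_subgroup lcs_2_two_step C_index s(1)])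
      then have "comm f (s [^] p) = \<one>" using comm\<Omega> f\<Omega> by blast
      ultimately show ?thesis using comm_norm_seq[OF fc s(1)] by simp
    qed
    ultimately show False by simp
  qed
qed

end

section \<open>Evaluating polynomials at a linear endomorphism\<close>

context vector_space
begin

lemma poly_endo_altdef:
  assumes "degree f \<le> n"
  shows "poly_endo scale f T v = (\<Sum>i\<le>n. scale (coeff f i) ((T ^^ i) v))"
  unfolding poly_endo_def
  by (rule sum.mono_neutral_left) (use assms in \<open>auto simp: coeff_eq_0\<close>)

lemma poly_endo_pCons: "poly_endo scale (pCons a q) T v = scale a v + poly_endo scale q T (T v)"
proof -
  have "poly_endo scale (pCons a q) T v = (\<Sum>i\<le>Suc (degree q). scale (coeff (pCons a q) i) ((T ^^ i) v))"
    by (rule poly_endo_altdef) (rule degree_pCons_le)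
  also have "\<dots> = scale a v + (\<Sum>i\<le>degree q. scale (coeff q i) ((T ^^ i) (T v)))"
    by (simp add: sum.atMost_Suc_shift funpow_swap1 del: sum.atMost_Suc)
  finally show ?thesis by (simp add: poly_endo_def)
qed

lemma poly_endo_0 [simp]: "poly_endo scale 0 T v = 0"
  by (simp add: poly_endo_def)

lemma poly_endo_add: "poly_endo scale (f + g) T v = poly_endo scale f T v + poly_endo scale g T v"
proof -
  let ?n = "max (degree f) (degree g)"
  have "degree (f + g) \<le> ?n" by (rule degree_add_le_max)
  then show ?thesis
    by (simp add: poly_endo_altdef[of _ ?n] scale_left_distrib sum.distrib)
qed

lemma poly_endo_smult: "poly_endo scale (Polynomial.smult a f) T v = scale a (poly_endo scale f T v)"
  by (simp add: poly_endo_altdef[of _ "degree f"] degree_smult_le scale_sum_right)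

context
  fixes T :: "'b \<Rightarrow> 'b"
  assumes T: "Vector_Spaces.linear scale scale T"
begin

interpretation T: Vector_Spaces.linear scale scale T by (rule T)

lemma poly_endo_apply: "poly_endo scale f T (T v) = T (poly_endo scale f T v)"
  by (induction f arbitrary: v) (simp_all add: poly_endo_pCons T.add T.scale T.zero)

lemma poly_endo_mult: "poly_endo scale (f * g) T v = poly_endo scale f T (poly_endo scale g T v)"
proof (induction f arbitrary: v)
  case (pCons a f)
  have "poly_endo scale (pCons a f * g) T v
      = scale a (poly_endo scale g T v) + poly_endo scale f T (poly_endo scale g T (T v))"
    using pCons by (simp add: poly_endo_add poly_endo_smult poly_endo_pCons)
  then show ?case by (simp add: poly_endo_pCons poly_endo_apply)
qed simp

lemma poly_endo_power_minus_one: "poly_endo scale ([:-1, 1:] ^ k) T v = ((\<lambda>v. T v - v) ^^ k) v"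
proof (induction k arbitrary: v)
  case 0
  then show ?case by (simp add: poly_endo_def)
next
  case (Suc k)
  have "poly_endo scale [:-1, 1:] T w = T w - w" for w
    by (simp add: poly_endo_pCons)
  then show ?case unfolding power_Suc poly_endo_mult Suc by simp
qed

lemma minimal_polynomial_nilpotent_degree:
  assumes "is_minimal_polynomial scale T f" and "\<And>v. ((\<lambda>v. T v - v) ^^ k) v = 0"
  shows "degree f \<le> k"
proof -
  have "[:-1, 1:] ^ k \<noteq> (0 :: 'a poly)" by simp
  moreover have "\<forall>v. poly_endo scale ([:-1, 1:] ^ k) T v = 0"
    using assms(2) poly_endo_power_minus_one by simp
  ultimately have "degree f \<le> degree ([:-1, 1:] ^ k :: 'a poly)"
    using assms(1) unfolding is_minimal_polynomial_def by blast
  then show ?thesis by (simp add: degree_linear_power)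
qed

text \<open>In characteristic q, \<open>(X - 1)^q\<close> is \<open>X^q + (-1)^q\<close>, and q is
  odd.\<close>

lemma funpow_minus_one_char:
  assumes "prime q" "odd q" and char: "CHAR('a) = q"
  shows "((\<lambda>v. T v - v) ^^ q) v = (T ^^ q) v - v"
proof -
  have "[:-1, 1 :: 'a:] ^ q = (monom 1 1 + (- 1)) ^ q"
    by (simp add: monom_altdef one_pCons)
  also have "\<dots> = monom 1 1 ^ q + (- 1) ^ q"
    using assms by (intro freshmans_dream) simp_all
  also have "(- 1 :: 'a poly) ^ q = - 1" using \<open>odd q\<close> by simp
  also have "(- 1 :: 'a poly) = [:- 1:]" by (simp add: one_pCons)
  finally have *: "[:-1, 1:] ^ q = monom 1 q + [:- 1 :: 'a:]"
    by (simp add: monom_power)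
  have "poly_endo scale (monom 1 q) T v = (T ^^ q) v"
    by (simp add: poly_endo_altdef[of _ q] degree_monom_le if_distrib[of "\<lambda>c. scale c _"] sum.delta cong: if_cong)
  then show ?thesis
    unfolding poly_endo_power_minus_one[symmetric] * by (simp add: poly_endo_add poly_endo_pCons)
qed

end

lemma card_subspace_mult:
  assumes X: "subspace X" and Y: "subspace Y" and "X \<subseteq> Y" "X \<noteq> Y" "finite Y"
  shows "card (UNIV :: 'a set) * card X \<le> card Y"
proof -
  obtain y where y: "y \<in> Y" "y \<notin> X" using assms by blast
  let ?f = "\<lambda>(k, x). scale k y + x"
  have inj: "inj_on ?f (UNIV \<times> X)"
  proof (rule inj_onI, clarify)
    fix k k' x x' assume x: "x \<in> X" "x' \<in> X" and eq: "scale k y + x = scale k' y + x'"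
    have d: "scale (k - k') y = x' - x" using eq by (simp add: algebra_simps)
    have "k = k'"
    proof (rule ccontr)
      assume "k \<noteq> k'"
      then have "y = scale (inverse (k - k')) (x' - x)" unfolding d[symmetric] by simp
      then have "y \<in> X" using x X by (simp add: subspace_scale subspace_diff)
      then show False using y by simp
    qed
    then show "k = k' \<and> x = x'" using eq by simp
  qed
  have "?f ` (UNIV \<times> X) \<subseteq> Y"
  proof clarify
    fix k x assume "x \<in> X"
    then have "x \<in> Y" using \<open>X \<subseteq> Y\<close> by blast
    then show "scale k y + x \<in> Y" using y(1) by (intro subspace_add[OF Y] subspace_scale[OF Y])
  qed
  then have "card ((UNIV :: 'a set) \<times> X) \<le> card Y" by (rule card_inj_on_le[OF inj _ \<open>finite Y\<close>])
  then show ?thesis by (simp add: card_cartesian_product)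
qed

end

section \<open>Quadratic elements and offenders\<close>

context right_FpG_module
begin

lemma char_field: "CHAR('k) = p"
proof -
  have "CHAR('k) dvd p" using CHAR_dvd_CARD[where ?'a = 'k] card_field by simp
  then show ?thesis using prime_p by (metis CHAR_not_1 prime_nat_iff One_nat_def)
qed

lemma act_add: "g \<in> carrier G \<Longrightarrow> act (u + v) g = act u g + act v g"
  using act_linear[of g] by (simp add: Vector_Spaces.linear_iff)

lemma act_scale: "g \<in> carrier G \<Longrightarrow> act (scale k v) g = scale k (act v g)"
  using act_linear[of g] by (simp add: Vector_Spaces.linear_iff)

lemma act_zero [simp]: "g \<in> carrier G \<Longrightarrow> act 0 g = 0"
  using act_scale[of g 0 0] by simp

lemma act_minus: "g \<in> carrier G \<Longrightarrow> act (- v) g = - act v g"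
  using act_scale[of g "- 1" v] by simp

lemma act_diff: "g \<in> carrier G \<Longrightarrow> act (u - v) g = act u g - act v g"
  using act_add[of g u "- v"] by (simp add: act_minus)

lemma act_inv: "g \<in> carrier G \<Longrightarrow> act (act v g) (inv g) = v" "g \<in> carrier G \<Longrightarrow> act (act v (inv g)) g = v"
  by (simp_all add: act_mult[symmetric] act_one)

lemma funpow_act: "g \<in> carrier G \<Longrightarrow> ((\<lambda>v. act v g) ^^ k) v = act v (g [^] k)"
  by (induction k) (simp_all add: act_one act_mult)

definition delta :: "'g \<Rightarrow> 'v \<Rightarrow> 'v" where
  "delta g v = act v g - v"

lemma delta_add: "g \<in> carrier G \<Longrightarrow> delta g (u + v) = delta g u + delta g v"
  by (simp add: delta_def act_add)

lemma delta_diff: "g \<in> carrier G \<Longrightarrow> delta g (u - v) = delta g u - delta g v"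
  by (simp add: delta_def act_diff)

lemma delta_scale: "g \<in> carrier G \<Longrightarrow> delta g (scale k v) = scale k (delta g v)"
  by (simp add: delta_def act_scale scale_right_diff_distrib)

lemma delta_zero [simp]: "g \<in> carrier G \<Longrightarrow> delta g 0 = 0"
  by (simp add: delta_def)

lemma delta_eq_0_iff: "delta g v = 0 \<longleftrightarrow> act v g = v"
  by (simp add: delta_def)

lemma funpow_delta_add: "g \<in> carrier G \<Longrightarrow> (delta g ^^ k) (u + v) = (delta g ^^ k) u + (delta g ^^ k) v"
  by (induction k) (simp_all add: delta_add)

lemma funpow_delta_scale: "g \<in> carrier G \<Longrightarrow> (delta g ^^ k) (scale c v) = scale c ((delta g ^^ k) v)"
  by (induction k) (simp_all add: delta_scale)

lemma funpow_delta_zero [simp]: "g \<in> carrier G \<Longrightarrow> (delta g ^^ k) 0 = 0"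
  by (induction k) simp_all

lemma delta_commute:
  assumes "g \<in> carrier G" "h \<in> carrier G" "g \<otimes> h = h \<otimes> g"
  shows "delta g (delta h v) = delta h (delta g v)"
  using assms by (simp add: delta_def act_diff act_mult[symmetric])

lemma funpow_delta_commute:
  assumes "g \<in> carrier G" "h \<in> carrier G" "g \<otimes> h = h \<otimes> g"
  shows "delta g ((delta h ^^ k) v) = (delta h ^^ k) (delta g v)"
  by (induction k) (simp_all add: delta_commute[OF assms])

lemma act_delta_conj_by:
  assumes "y \<in> carrier G" "h \<in> carrier G"
  shows "act (delta y v) h = delta (conj_by y h) (act v h)"
  using assms by (simp add: delta_def act_diff act_mult[symmetric] conj_by_def cancel_left_inv m_assoc)

lemma act_funpow_delta_conj_by:
  assumes "y \<in> carrier G" "h \<in> carrier G"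
  shows "act ((delta y ^^ k) v) h = (delta (conj_by y h) ^^ k) (act v h)"
  by (induction k) (simp_all add: act_delta_conj_by[OF assms])

end

section \<open>Quadratic elements under the hypothesis on the center\<close>

locale odd_FpG_module = right_FpG_module p G scale act
  for p :: nat and G :: "('g, 'm) monoid_scheme" (structure)
    and scale :: "'k::field \<Rightarrow> 'v::ab_group_add \<Rightarrow> 'v" and act :: "'v \<Rightarrow> 'g \<Rightarrow> 'v" +
  assumes odd_p: "odd p"
    and faithful: "Defs.faithful_action G act"
    and Omega_minimal_polynomial: "\<And>z. z \<in> Omega1_center p G \<Longrightarrow> z \<noteq> \<one> \<Longrightarrow>
           is_minimal_polynomial scale (\<lambda>v. act v z) (monom 1 p - 1)"
    and p_group_G: "p_group p G"
begin

lemma p3: "3 \<le> p"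
  using prime_p odd_p prime_ge_2_nat[OF prime_p] by (cases "p = 2") auto

definition group_exp :: nat where "group_exp = (SOME n. card (carrier G) = p ^ n)"

lemma card_G: "card (carrier G) = p ^ group_exp"
  unfolding group_exp_def using p_group_G by (auto simp: p_group_def intro: someI)

lemma finite_G: "finite (carrier G)"
  using card_G prime_p by (metis card.infinite not_prime_0 power_not_zero)

lemma pow_group_exp: "g \<in> carrier G \<Longrightarrow> g [^] (p ^ group_exp) = \<one>"
  using pow_order_eq_1[of g] card_G by (simp add: Coset.order_def)

lemma faithfulD: "g \<in> carrier G \<Longrightarrow> (\<And>v. delta g v = 0) \<Longrightarrow> g = \<one>"
  using faithful by (simp add: Defs.faithful_action_def delta_def)

lemma two_neq_0: "(v :: 'v) + v = 0 \<Longrightarrow> v = 0"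
proof -
  assume "v + v = 0"
  then have "scale (1 + 1) v = 0" by (simp only: scale_left_distrib scale_one)
  moreover have "(1 + 1 :: 'k) \<noteq> 0"
  proof
    assume "(1 + 1 :: 'k) = 0"
    then have "of_nat 2 = (0 :: 'k)" by simp
    then have "p dvd 2" using of_nat_eq_0_iff_char_dvd char_field by metis
    then show False using p3 by (auto dest: dvd_imp_le)
  qed
  ultimately show ?thesis by simp
qed

lemma funpow_delta_p: "g \<in> carrier G \<Longrightarrow> (delta g ^^ p) v = delta (g [^] p) v"
  using funpow_minus_one_char[OF act_linear[of g] prime_p odd_p char_field, of v]
  by (simp add: delta_def[abs_def] funpow_act)

lemma funpow_delta_mult_p: "g \<in> carrier G \<Longrightarrow> (delta g ^^ (p * k)) v = (delta (g [^] p) ^^ k) v"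
proof -
  assume g: "g \<in> carrier G"
  have "(delta g ^^ p) = delta (g [^] p)" using funpow_delta_p[OF g] by blast
  then show ?thesis by (simp add: funpow_mult[symmetric])
qed

lemma delta_nilpotent:
  assumes "g \<in> carrier G"
  shows "\<exists>k. \<forall>v. (delta g ^^ k) v = 0"
proof -
  have "(delta g ^^ (p ^ k)) v = delta (g [^] (p ^ k)) v" if "g \<in> carrier G" for k g v
    using that
  proof (induction k arbitrary: g)
    case (Suc k)
    then show ?case by (simp add: funpow_delta_mult_p nat_pow_pow)
  qed simp
  then show ?thesis using pow_group_exp[OF assms] assms by (metis act_one delta_eq_0_iff)
qed

definition quad :: "'g \<Rightarrow> bool" where
  "quad g \<longleftrightarrow> (\<forall>v. delta g (delta g v) = 0)"

lemma quad_iff: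
  "g \<in> carrier G \<Longrightarrow> quad g \<longleftrightarrow> (\<forall>v. act v (g \<otimes> g) - act v g - act v g + v = 0)"
  by (simp add: quad_def delta_def act_diff act_mult algebra_simps)

lemma quad_conj_by:
  assumes "quad e" "e \<in> carrier G" "h \<in> carrier G"
  shows "quad (conj_by e h)"
  unfolding quad_def
proof
  fix v
  have "delta (conj_by e h) (delta (conj_by e h) (act (act v (inv h)) h)) = 0"
    using assms by (simp add: act_delta_conj_by[symmetric] quad_def)
  then show "delta (conj_by e h) (delta (conj_by e h) v) = 0" using assms by (simp add: act_inv)
qed

text \<open>If \<open>c = [e, g]\<close> commutes with \<open>e\<close> and \<open>g\<close> then \<open>e c\<close> and \<open>e c\<^sup>-\<^sup>1\<close> are conjugates of \<open>e\<close>; adding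
  the relations expressing that both are quadratic leaves \<open>2 e (c - 1)\<^sup>2 = 0\<close>.\<close>

lemma quad_comm:
  assumes q: "quad e" and e: "e \<in> carrier G" and g: "g \<in> carrier G"
    and ce: "comm (comm e g) e = \<one>" and cg: "comm (comm e g) g = \<one>"
  shows "quad (comm e g)"
proof -
  define c where "c = comm e g"
  have c: "c \<in> carrier G" using e g by (simp add: c_def)
  have ec: "c \<otimes> e = e \<otimes> c" using ce comm_eq_one_iff[OF c e] by (simp add: c_def)
  have gc: "c \<otimes> g = g \<otimes> c" using cg comm_eq_one_iff[OF c g] by (simp add: c_def)
  have c1: "conj_by e g = e \<otimes> c" using e g by (simp add: c_def conj_by_eq)
  have c2: "conj_by e (inv g) = e \<otimes> inv c"
  proof -
    have "conj_by c (inv g) = c" using c g gc by (simp add: conj_by_def m_assoc flip: gc)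
    have "e = conj_by (conj_by e g) (inv g)" using e g by (simp add: conj_by_conj_by)
    also have "\<dots> = conj_by e (inv g) \<otimes> c"
      unfolding c1 using e g c \<open>conj_by c (inv g) = c\<close> by (simp add: conj_by_mult)
    finally show ?thesis using e g c by (metis conj_by_closed inv_closed inv_solve_right)
  qed
  have comm2: "c \<otimes> (e \<otimes> x) = e \<otimes> (c \<otimes> x)" if "x \<in> carrier G" for x
    using ec that e c by (metis m_assoc)
  have "quad c" unfolding quad_iff[OF c]
  proof
    fix u
    define v where "v = act u (inv e)"
    have u: "u = act v e" using e by (simp add: v_def act_inv)
    \<comment> \<open>\<open>e^2 = 2 e - 1\<close> removes the squares of e from both
      relations.\<close>
    have qe: "act w (e \<otimes> e) = act w e + act w e - w" for w
      using q quad_iff[OF e] by (simp add: algebra_simps eq_diff_eq)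
    have "quad (e \<otimes> c)" using quad_conj_by[OF q e g] c1 by simp
    then have A: "act v (e \<otimes> c \<otimes> (e \<otimes> c)) - act v (e \<otimes> c) - act v (e \<otimes> c) + v = 0"
      using quad_iff e c by simp
    have "quad (e \<otimes> inv c)" using quad_conj_by[OF q e] g c2 by (metis inv_closed)
    then have B: "act w (e \<otimes> inv c \<otimes> (e \<otimes> inv c)) - act w (e \<otimes> inv c) - act w (e \<otimes> inv c) + w = 0" for w
      using quad_iff e c by simp
    have a1: "e \<otimes> c \<otimes> (e \<otimes> c) = (e \<otimes> e) \<otimes> (c \<otimes> c)" using e c by (simp add: m_assoc comm2 ec)
    have b1: "(c \<otimes> c) \<otimes> (e \<otimes> inv c \<otimes> (e \<otimes> inv c)) = e \<otimes> e"
      using e c by (simp add: m_assoc comm2 ec cancel_left_inv)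
    have b2: "(c \<otimes> c) \<otimes> (e \<otimes> inv c) = e \<otimes> c"
      using e c by (simp add: m_assoc comm2 ec cancel_left_inv)
    have A': "act (act v e) (c \<otimes> c) + act (act v e) (c \<otimes> c) - act v (c \<otimes> c)
        - act (act v e) c - act (act v e) c + v = 0"
      using A unfolding a1 using e c by (simp add: act_mult[of "e \<otimes> e"] act_mult[of e c] qe act_add act_diff)
    \<comment> \<open>Evaluated at \<open>v c^2\<close>, the relation for \<open>e c^-1\<close>
      becomes free of inverses.\<close>
    have B': "act v e + act v e - v - act (act v e) c - act (act v e) c + act v (c \<otimes> c) = 0"
      using B[of "act v (c \<otimes> c)"] e c
      by (simp add: act_mult[symmetric, of "c \<otimes> c"] b1 b2 qe del: act_mult) (simp add: act_mult[of e c])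
    let ?x = "act u (c \<otimes> c) - act u c - act u c + u"
    have "?x + ?x
      = (act (act v e) (c \<otimes> c) + act (act v e) (c \<otimes> c) - act v (c \<otimes> c)
          - act (act v e) c - act (act v e) c + v)
        + (act v e + act v e - v - act (act v e) c - act (act v e) c + act v (c \<otimes> c))"
      unfolding u by (simp add: algebra_simps)
    also have "\<dots> = 0" unfolding A' B' by simp
    finally have "?x + ?x = 0" .
    then show "?x = 0" by (rule two_neq_0)
  qed
  then show ?thesis by (simp add: c_def)
qed

text \<open>Since p is at least 2, \<open>c^p - 1 = (c - 1)^p\<close> vanishes on the module. This
  brings central quadratic elements under the hypothesis on \<open>Omega1_center\<close>.\<close>

lemma quad_pow_p:
  assumes "quad c" "c \<in> carrier G"
  shows "c [^] p = \<one>"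
proof (rule faithfulD)
  fix v
  have "2 \<le> p" using p3 by simp
  then obtain q where "p = q + 2" by (metis le_add_diff_inverse2)
  then have "(delta c ^^ p) v = delta c (delta c ((delta c ^^ q) v))"
    by (simp add: funpow_add numeral_2_eq_2)
  then show "delta (c [^] p) v = 0"
    using assms by (simp add: funpow_delta_p[symmetric] quad_def)
qed (use assms in simp)

lemma center_normal: "center G \<lhd> G"
proof -
  have "center G = {y \<in> carrier G. \<forall>x\<in>carrier G. comm y x \<in> {\<one>}}"
    using comm_eq_one_iff by (auto simp: center_def)
  moreover have "subgroup {y \<in> carrier G. \<forall>x\<in>carrier G. comm y x \<in> {\<one>}} G"
    using one_is_normal by (rule subgroup_comm_in) simp
  ultimately have "subgroup (center G) G" by simp
  then show ?thesis
  proof (rule normalI_conj_by)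
    fix x g assume x: "x \<in> center G" and g: "g \<in> carrier G"
    then have "conj_by x g = x" by (simp add: center_def conj_by_def m_assoc cancel_inv_left)
    then show "conj_by x g \<in> center G" using x by simp
  qed
qed

lemma center_subgroup: "subgroup (center G) G"
  using center_normal by (rule normal_imp_subgroup)

lemma centerD: "z \<in> center G \<Longrightarrow> g \<in> carrier G \<Longrightarrow> z \<otimes> g = g \<otimes> z" "z \<in> center G \<Longrightarrow> z \<in> carrier G"
  by (simp_all add: center_def)

lemma central_nilpotent_degree:
  assumes z: "z \<in> center G" "z [^] p = \<one>" "z \<noteq> \<one>" and nil: "\<And>v. (delta z ^^ k) v = 0"
  shows "p \<le> k"
proof -
  have zc: "z \<in> carrier G" using z centerD by blast
  have "z \<in> Omega1_center p G" unfolding Omega1_center_def using z by (intro generate.incl) simp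
  then have "is_minimal_polynomial scale (\<lambda>v. act v z) (monom 1 p - 1)"
    using z Omega_minimal_polynomial by blast
  then have "degree (monom 1 p - 1 :: 'k poly) \<le> k"
    using nil by (intro minimal_polynomial_nilpotent_degree[OF act_linear[OF zc]]) (simp_all add: delta_def[abs_def])
  moreover have "degree (monom 1 p - 1 :: 'k poly) = p"
  proof -
    have "degree (monom 1 p + (- 1) :: 'k poly) = degree (monom 1 p :: 'k poly)"
      using p3 by (intro degree_add_eq_left) (simp add: degree_monom_eq)
    then show ?thesis by (simp add: degree_monom_eq)
  qed
  ultimately show ?thesis by simp
qed

lemma quad_center:
  assumes "quad c" "c \<in> center G"
  shows "c = \<one>"
proof (rule ccontr)
  assume "c \<noteq> \<one>"
  moreover have "(delta c ^^ 2) v = 0" for v using assms(1) by (simp add: quad_def numeral_2_eq_2)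
  ultimately have "p \<le> 2"
    using assms centerD quad_pow_p by (intro central_nilpotent_degree) auto
  then show False using p3 by simp
qed

text \<open>\<open>[e, g]\<close> is quadratic by \<open>quad_comm\<close> and central by
  assumption, hence trivial. For g in the second center this applies to every quadratic e.\<close>

lemma quad_comm_center:
  assumes "quad e" "e \<in> carrier G" "g \<in> carrier G" "comm e g \<in> center G"
  shows "e \<otimes> g = g \<otimes> e"
proof -
  have h: "comm (comm e g) h = \<one>" if "h \<in> carrier G" for h
    using centerD(1)[OF assms(4) that] comm_eq_one_iff[of "comm e g" h] assms(2,3) that by simp
  have "quad (comm e g)" by (rule quad_comm[OF assms(1-3) h h]) (rule assms(2,3))+
  then have "comm e g = \<one>" using assms(4) by (rule quad_center)
  then show ?thesis using comm_eq_one_iff[OF assms(2,3)] by simp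
qed

end

section \<open>Replacement of an offender by a quadratic one\<close>

context odd_FpG_module
begin

text \<open>Such a v represents a common fixed vector modulo \<open>Y\<close>, found without forming
  a quotient. The operators are added one at a time, replacing v by its last iterate under
  \<open>delta b\<close> outside \<open>Y\<close>; commutativity preserves what was achieved for the
  earlier ones.\<close>

lemma ex_nearly_in_invariant:
  assumes "finite A" "A \<subseteq> carrier G" and comm: "\<And>a b. a \<in> A \<Longrightarrow> b \<in> A \<Longrightarrow> a \<otimes> b = b \<otimes> a"
    and Y0: "0 \<in> Y" and Y: "\<And>a v. a \<in> A \<Longrightarrow> v \<in> Y \<Longrightarrow> delta a v \<in> Y" and "Y \<noteq> UNIV"
  shows "\<exists>v. v \<notin> Y \<and> (\<forall>a\<in>A. delta a v \<in> Y)"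
proof -
  have "\<exists>v. v \<notin> Y \<and> (\<forall>a\<in>B. delta a v \<in> Y)" if "finite B" "B \<subseteq> A" for B
    using that
  proof (induction B)
    case empty
    then show ?case using \<open>Y \<noteq> UNIV\<close> by auto
  next
    case (insert b B)
    then obtain v where v: "v \<notin> Y" "\<forall>a\<in>B. delta a v \<in> Y" by auto
    have b: "b \<in> A" "b \<in> carrier G" using insert assms(2) by auto
    obtain N where "\<forall>v. (delta b ^^ N) v = 0" using delta_nilpotent[OF b(2)] by blast
    then have ex: "(delta b ^^ N) v \<in> Y" using Y0 by simp
    define k where "k = (LEAST k. (delta b ^^ k) v \<in> Y)"
    have k: "(delta b ^^ k) v \<in> Y" unfolding k_def using ex by (rule LeastI)
    then have "k \<noteq> 0" using v by (metis funpow_0)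
    then obtain l where l: "k = Suc l" by (cases k) auto
    have "(delta b ^^ l) v \<notin> Y" using not_less_Least[of l "\<lambda>k. (delta b ^^ k) v \<in> Y"] l by (simp add: k_def)
    moreover have "delta a ((delta b ^^ l) v) \<in> Y" if a: "a \<in> insert b B" for a
    proof (cases "a = b")
      case True
      then show ?thesis using k l by simp
    next
      case False
      then have aB: "a \<in> B" using a by simp
      then have aA: "a \<in> A" "a \<in> carrier G" using insert assms(2) by auto
      have "(delta b ^^ l) (delta a v) \<in> Y"
      proof (induction l)
        case 0 show ?case using v aB by simp
      next
        case (Suc l) then show ?case using Y[OF b(1)] by simp
      qed
      then show ?thesis using funpow_delta_commute[OF aA(2) b(2) comm[OF aA(1) b(1)]] by simp
    qed
    ultimately show ?case by blast
  qed
  then show ?thesis using assms(1) by blast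
qed

text \<open>On an infinite module \<open>card\<close> is 0 and division by 0 gives 0, so
  \<open>j_value\<close> cannot reach 1; finiteness therefore comes with the offender.\<close>

lemma offender_card:
  "offender p G act E \<longleftrightarrow> elementary_abelian_subgroup p G E \<and> E \<noteq> {\<one>} \<and> finite (UNIV :: 'v set) \<and>
     card (UNIV :: 'v set) \<le> card E * card (fixed_points act E)"
proof (cases "finite (UNIV :: 'v set)")
  case True
  then have "0 < real (card (UNIV :: 'v set))" by (simp add: card_gt_0_iff)
  then show ?thesis using True
    by (simp add: offender_def j_value_def le_divide_eq_1 flip: of_nat_mult)
qed (simp add: offender_def j_value_def)

lemma subgroup_elementary_abelian:
  assumes "elementary_abelian_subgroup p G E" "subgroup B G" "B \<subseteq> E"
  shows "elementary_abelian_subgroup p G B"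
  using assms unfolding elementary_abelian_subgroup_def by blast

text \<open>Timmesfeld's replacement argument: \<open>B\<close> is the centralizer in \<open>E\<close> of the commutators of a vector
  \<open>v\<close> with \<open>E\<close>, and it is again an offender because commutators that agree modulo the fixed points
  of \<open>E\<close> come from the same coset of \<open>B\<close>.\<close>

lemma ex_quadratic_offender:
  assumes "F_module p G act"
  shows "\<exists>E. offender p G act E \<and> (\<forall>e\<in>E. quad e)"
proof -
  define E where "E = arg_min card (offender p G act)"
  have off: "offender p G act E" and min: "\<And>B. offender p G act B \<Longrightarrow> card E \<le> card B"
    using assms arg_min_nat_lemma[of "offender p G act" _ card] unfolding F_module_def E_def by blast+
  then have el: "elementary_abelian_subgroup p G E" and finV: "finite (UNIV :: 'v set)"
    and cV: "card (UNIV :: 'v set) \<le> card E * card (fixed_points act E)"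
    by (simp_all add: offender_card)
  have Es: "subgroup E G" and Ecomm: "\<And>e f. e \<in> E \<Longrightarrow> f \<in> E \<Longrightarrow> e \<otimes> f = f \<otimes> e"
    using el unfolding elementary_abelian_subgroup_def by blast+
  have Ec: "e \<in> carrier G" if "e \<in> E" for e using Es that by (rule subgroup.mem_carrier)
  have finE: "finite E" using Ec finite_G by (meson finite_subset subsetI)
  have dcomm: "delta a (delta b v) = delta b (delta a v)" if "a \<in> E" "b \<in> E" for a b v
    using that Ec Ecomm by (intro delta_commute) auto
  \<comment> \<open>Mixed products are included, not only squares: \<open>Y\<close> consists of the
    vectors fixed by \<open>E\<close> modulo the fixed points of \<open>E\<close>, and is therefore
    invariant.\<close>
  define Y where "Y = {v. \<forall>a\<in>E. \<forall>b\<in>E. delta b (delta a v) = 0}"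
  have "Y = UNIV"
  proof (rule ccontr)
    assume "Y \<noteq> UNIV"
    have "\<exists>v. v \<notin> Y \<and> (\<forall>a\<in>E. delta a v \<in> Y)"
    proof (rule ex_nearly_in_invariant[OF finE _ Ecomm _ _ \<open>Y \<noteq> UNIV\<close>])
      show "E \<subseteq> carrier G" using Ec by blast
      show "0 \<in> Y" using Ec by (simp add: Y_def)
      show "delta a v \<in> Y" if "a \<in> E" "v \<in> Y" for a v
        using that dcomm Ec by (simp add: Y_def)
    qed
    then obtain v where v: "v \<notin> Y" "\<And>a. a \<in> E \<Longrightarrow> delta a v \<in> Y" by blast
    let ?C = "fixed_points act E"
    have C: "c \<in> ?C \<longleftrightarrow> (\<forall>a\<in>E. delta a c = 0)" for c by (simp add: fixed_points_def delta_eq_0_iff)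
    define B where "B = {a \<in> E. \<forall>x\<in>E. delta a (delta x v) = 0}"
    have B_sub: "subgroup B G"
    proof (rule subgroupI)
      show "B \<subseteq> carrier G" using Ec by (auto simp: B_def)
      have "\<one> \<in> B" using subgroup.one_closed[OF Es] by (simp add: B_def delta_eq_0_iff act_one)
      then show "B \<noteq> {}" by blast
      fix a b assume ab: "a \<in> B" "b \<in> B"
      then show "a \<otimes> b \<in> B" using Ec subgroup.m_closed[OF Es]
        by (simp add: B_def delta_eq_0_iff act_mult)
    next
      fix a assume a: "a \<in> B"
      have "act w (inv a) = w" if "act w a = w" for w
        using that a Ec act_inv(1)[of a w] by (simp add: B_def)
      then show "inv a \<in> B" using a subgroup.m_inv_closed[OF Es] by (simp add: B_def delta_eq_0_iff)
    qed
    have BE: "B \<subseteq> E" by (auto simp: B_def)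
    define \<phi> where "\<phi> a = (\<lambda>c. delta a v + c) ` ?C" for a
    \<comment> \<open>A common element means that \<open>delta a v\<close> and
      \<open>delta b v\<close> differ by a vector fixed by \<open>E\<close>; as \<open>E\<close> is
      abelian, \<open>a b^-1\<close> then fixes every \<open>delta x v\<close>.\<close>
    have same: "a \<otimes> inv b \<in> B" if ab: "a \<in> E" "b \<in> E" "x \<in> \<phi> a" "x \<in> \<phi> b" for a b x
    proof -
      obtain c d where cd: "c \<in> ?C" "d \<in> ?C" "delta a v + c = delta b v + d"
        using ab by (auto simp: \<phi>_def)
      have "delta a v - delta b v = d - c" using cd(3) by (simp add: algebra_simps)
      then have eq: "delta x (delta a v) = delta x (delta b v)" if "x \<in> E" for x
        using cd(1,2) C that Ec delta_diff[of x "delta a v" "delta b v"] delta_diff[of x d c] by simp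
      have "delta (a \<otimes> inv b) (delta x v) = 0" if x: "x \<in> E" for x
      proof -
        have "delta a (delta x v) = delta b (delta x v)" using eq[OF x] dcomm ab x by simp
        then have "act (delta x v) a = act (delta x v) b" by (simp add: delta_def)
        then show ?thesis using ab Ec by (simp add: delta_eq_0_iff act_mult act_inv)
      qed
      then show ?thesis using ab Es by (simp add: B_def subgroup.m_closed subgroup.m_inv_closed)
    qed
    interpret GE: group "G\<lparr>carrier := E\<rparr>" using Es by (rule subgroup_imp_group)
    have C0: "0 \<in> ?C" using C Ec by simp
    have cE: "card E \<le> card (\<phi> ` E) * card B"
    proof -
      have "subgroup B (G\<lparr>carrier := E\<rparr>)" using B_sub Es BE by (simp add: subgroup_incl)
      then have "card (carrier (G\<lparr>carrier := E\<rparr>)) \<le> card (\<phi> ` carrier (G\<lparr>carrier := E\<rparr>)) * card B"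
      proof (rule GE.card_rcosets_le[rotated])
        fix g h assume gh: "g \<in> carrier (G\<lparr>carrier := E\<rparr>)" "h \<in> carrier (G\<lparr>carrier := E\<rparr>)" "\<phi> g = \<phi> h"
        have "delta g v + 0 \<in> \<phi> g" unfolding \<phi>_def using C0 by blast
        then have "g \<otimes> inv h \<in> B" using gh same[of g h] by auto
        then show "g \<otimes>\<^bsub>G\<lparr>carrier := E\<rparr>\<^esub> inv\<^bsub>G\<lparr>carrier := E\<rparr>\<^esub> h \<in> B"
          using gh Es by (simp add: m_inv_consistent)
      qed (use finE in simp)
      then show ?thesis by simp
    qed
    have cS: "card ?C * card (\<phi> ` E) = card (\<Union> (\<phi> ` E))"
    proof (rule card_partition)
      show "finite (\<phi> ` E)" using finE by simp
      show "finite (\<Union> (\<phi> ` E))" using finV by (rule finite_subset[rotated]) simp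
      show "card c = card ?C" if "c \<in> \<phi> ` E" for c
        using that by (auto simp: \<phi>_def card_image)
      fix c1 c2 assume c: "c1 \<in> \<phi> ` E" "c2 \<in> \<phi> ` E" "c1 \<noteq> c2"
      then obtain a b where ab: "a \<in> E" "b \<in> E" "c1 = \<phi> a" "c2 = \<phi> b" by blast
      show "c1 \<inter> c2 = {}"
      proof (rule ccontr)
        assume "c1 \<inter> c2 \<noteq> {}"
        then obtain x where "x \<in> \<phi> a" "x \<in> \<phi> b" using ab by blast
        then obtain c d where cd: "c \<in> ?C" "d \<in> ?C" "delta a v + c = delta b v + d"
          by (auto simp: \<phi>_def)
        have "delta b v - delta a v \<in> ?C"
        proof -
          have "delta b v - delta a v = c - d" using cd(3) by (simp add: algebra_simps)
          then show ?thesis using cd C Ec delta_diff by simp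
        qed
        then have shift: "\<And>c. c \<in> ?C \<Longrightarrow> (delta b v - delta a v) + c \<in> ?C" "\<And>c. c \<in> ?C \<Longrightarrow> c - (delta b v - delta a v) \<in> ?C"
          using C Ec delta_add delta_diff by simp_all
        have "\<phi> a = \<phi> b"
        proof
          show "\<phi> a \<subseteq> \<phi> b"
          proof
            fix y assume "y \<in> \<phi> a"
            then obtain u where u: "u \<in> ?C" "y = delta a v + u" by (auto simp: \<phi>_def)
            then have "y = delta b v + (u - (delta b v - delta a v))" by simp
            then show "y \<in> \<phi> b" unfolding \<phi>_def using shift(2)[OF u(1)] by blast
          qed
          show "\<phi> b \<subseteq> \<phi> a"
          proof
            fix y assume "y \<in> \<phi> b"
            then obtain u where u: "u \<in> ?C" "y = delta b v + u" by (auto simp: \<phi>_def)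
            then have "y = delta a v + ((delta b v - delta a v) + u)" by simp
            then show "y \<in> \<phi> a" unfolding \<phi>_def using shift(1)[OF u(1)] by blast
          qed
        qed
        then show False using c ab by simp
      qed
    qed
    have "card E * card ?C \<le> (card (\<phi> ` E) * card B) * card ?C"
      using cE by (rule mult_le_mono1)
    also have "\<dots> = card B * card (\<Union> (\<phi> ` E))" unfolding cS[symmetric] by (simp add: ac_simps)
    finally have "card E * card ?C \<le> card B * card (\<Union> (\<phi> ` E))" .
    then have big: "card (UNIV :: 'v set) \<le> card B * card (\<Union> (\<phi> ` E))" using cV by linarith
    \<comment> \<open>\<open>B\<close> fixes each \<open>delta a v\<close> by definition and
      \<open>?C\<close> as a subset of \<open>E\<close>; with \<open>big\<close> this is the
      offender inequality for \<open>B\<close>.\<close>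
    have sub: "\<Union> (\<phi> ` E) \<subseteq> fixed_points act B"
    proof clarify
      fix y a assume a: "a \<in> E" and "y \<in> \<phi> a"
      then obtain c where c: "c \<in> ?C" "y = delta a v + c" by (auto simp: \<phi>_def)
      have "delta b y = 0" if "b \<in> B" for b
      proof -
        have b: "b \<in> E" using that BE by blast
        have "delta b c = 0" using c(1) C b by blast
        then show ?thesis using that a c(2) b Ec by (simp add: B_def delta_add)
      qed
      then show "y \<in> fixed_points act B" by (simp add: fixed_points_def delta_eq_0_iff)
    qed
    show False
    proof (cases "B = {\<one>}")
      case False
      have "card (\<Union> (\<phi> ` E)) \<le> card (fixed_points act B)"
        using sub finV by (meson card_mono finite_subset subset_UNIV)
      then have "card (UNIV :: 'v set) \<le> card B * card (fixed_points act B)"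
        using big by (meson mult_le_mono2 order_trans)
      then have "offender p G act B"
        using False finV subgroup_elementary_abelian[OF el B_sub BE] by (simp add: offender_card)
      then have "B = E" using min BE finE by (simp add: card_seteq)
      then have "v \<in> Y" using dcomm by (auto simp: Y_def B_def)
      then show False using v by simp
    next
      \<comment> \<open>A trivial \<open>B\<close> is no offender, but then the cosets fill the
        module and v itself is \<open>delta x v + c\<close>; both summands lie in \<open>Y\<close>,
        hence so does v.\<close>
      case True
      then have "card (UNIV :: 'v set) \<le> card (\<Union> (\<phi> ` E))" using big by simp
      then have U: "\<Union> (\<phi> ` E) = UNIV" using finV by (simp add: card_seteq)
      have "delta b (delta a v) = 0" if ab: "a \<in> E" "b \<in> E" for a b
      proof -
        have "v \<in> \<Union> (\<phi> ` E)" using U by simp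
        then obtain x where x: "x \<in> E" "v \<in> \<phi> x" by blast
        then obtain c where "c \<in> ?C" "v = delta x v + c" unfolding \<phi>_def by blast
        note xc = x(1) this
        have "delta b (delta a v) = delta b (delta a (delta x v)) + delta b (delta a c)"
          using ab Ec by (subst xc(3)) (simp add: delta_add)
        also have "\<dots> = 0" using v(2)[OF xc(1)] ab xc(2) C Ec by (simp add: Y_def)
        finally show ?thesis .
      qed
      then have "v \<in> Y" by (simp add: Y_def)
      then show False using v by simp
    qed
  qed
  then have "quad e" if "e \<in> E" for e using that unfolding Y_def quad_def by blast
  then show ?thesis using off by blast
qed

end

section \<open>Rank of elementary abelian subgroups\<close>

context group
begin

lemma elementary_abelian_mult:
  assumes A: "elementary_abelian_subgroup q G A" and B: "elementary_abelian_subgroup q G B"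
    and comm: "\<And>a b. a \<in> A \<Longrightarrow> b \<in> B \<Longrightarrow> a \<otimes> b = b \<otimes> a"
  shows "elementary_abelian_subgroup q G {x. \<exists>a\<in>A. \<exists>b\<in>B. x = a \<otimes> b}"
proof -
  have As: "subgroup A G" and Bs: "subgroup B G"
    and Ac: "\<And>x y. x \<in> A \<Longrightarrow> y \<in> A \<Longrightarrow> x \<otimes> y = y \<otimes> x" and Bc: "\<And>x y. x \<in> B \<Longrightarrow> y \<in> B \<Longrightarrow> x \<otimes> y = y \<otimes> x"
    and Ap: "\<And>x. x \<in> A \<Longrightarrow> x [^] q = \<one>" and Bp: "\<And>x. x \<in> B \<Longrightarrow> x [^] q = \<one>"
    using A B unfolding elementary_abelian_subgroup_def by blast+
  have Ain: "x \<in> carrier G" if "x \<in> A" for x using As that by (rule subgroup.mem_carrier)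
  have Bin: "x \<in> carrier G" if "x \<in> B" for x using Bs that by (rule subgroup.mem_carrier)
  let ?S = "{x. \<exists>a\<in>A. \<exists>b\<in>B. x = a \<otimes> b}"
  have mult: "(a \<otimes> b) \<otimes> (c \<otimes> d) = (a \<otimes> c) \<otimes> (b \<otimes> d)" if "a \<in> A" "b \<in> B" "c \<in> A" "d \<in> B" for a b c d
  proof -
    have "(a \<otimes> b) \<otimes> (c \<otimes> d) = a \<otimes> (b \<otimes> c) \<otimes> d" using that Ain Bin by (simp add: m_assoc)
    also have "b \<otimes> c = c \<otimes> b" using comm that by simp
    finally show ?thesis using that Ain Bin by (simp add: m_assoc)
  qed
  have "subgroup ?S G"
  proof (rule subgroupI)
    show "?S \<subseteq> carrier G" using Ain Bin by blast
    show "?S \<noteq> {}" using subgroup.one_closed[OF As] subgroup.one_closed[OF Bs] by blast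
    fix x assume "x \<in> ?S"
    then obtain a b where ab: "a \<in> A" "b \<in> B" "x = a \<otimes> b" by blast
    then have "x = b \<otimes> a" using comm by simp
    then have "inv x = inv a \<otimes> inv b" using ab Ain Bin by (simp add: inv_mult_group)
    then show "inv x \<in> ?S" using ab subgroup.m_inv_closed[OF As] subgroup.m_inv_closed[OF Bs] by blast
  next
    fix x y assume "x \<in> ?S" "y \<in> ?S"
    then obtain a b c d where ab: "a \<in> A" "b \<in> B" "x = a \<otimes> b" and cd: "c \<in> A" "d \<in> B" "y = c \<otimes> d" by blast
    have "x \<otimes> y = (a \<otimes> c) \<otimes> (b \<otimes> d)" unfolding ab cd using mult ab cd by blast
    moreover have "a \<otimes> c \<in> A" "b \<otimes> d \<in> B"
      using ab cd subgroup.m_closed[OF As] subgroup.m_closed[OF Bs] by simp_all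
    ultimately show "x \<otimes> y \<in> ?S" by blast
  qed
  moreover have "x \<otimes> y = y \<otimes> x" if x: "x \<in> ?S" and y: "y \<in> ?S" for x y
  proof -
    obtain a b where ab: "a \<in> A" "b \<in> B" "x = a \<otimes> b" using x by blast
    obtain c d where cd: "c \<in> A" "d \<in> B" "y = c \<otimes> d" using y by blast
    have "x \<otimes> y = (a \<otimes> c) \<otimes> (b \<otimes> d)" unfolding ab cd using mult ab cd by blast
    also have "\<dots> = (c \<otimes> a) \<otimes> (d \<otimes> b)" using Ac[of a c] Bc[of b d] ab cd by simp
    also have "\<dots> = y \<otimes> x" unfolding ab cd using mult[of c d a b] ab cd by simp
    finally show ?thesis .
  qed
  moreover have "x [^] q = \<one>" if x: "x \<in> ?S" for x
  proof -
    obtain a b where ab: "a \<in> A" "b \<in> B" "x = a \<otimes> b" using x by blast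
    have "(a \<otimes> b) [^] q = a [^] q \<otimes> b [^] q"
      by (rule pow_mult_distrib[OF comm Ain Bin]) (rule ab)+
    then show ?thesis using ab Ap Bp by simp
  qed
  ultimately show ?thesis unfolding elementary_abelian_subgroup_def by blast
qed

lemma elementary_abelian_cyclic:
  assumes y: "y \<in> carrier G" "y [^] q = \<one>" and q: "0 < q"
  shows "elementary_abelian_subgroup q G (range (\<lambda>i::nat. y [^] i))"
proof -
  have "subgroup (range (\<lambda>i::nat. y [^] i)) G"
  proof (rule subgroupI)
    fix a assume "a \<in> range (\<lambda>i::nat. y [^] i)"
    then obtain i :: nat where i: "a = y [^] i" by blast
    have "y [^] (i * (q - 1)) \<otimes> a = y [^] (i * q)"
      unfolding i using y q by (simp add: nat_pow_mult algebra_simps)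
    also have "\<dots> = \<one>" using y by (simp add: nat_pow_pow[symmetric] mult.commute[of i])
    finally have "inv a = y [^] (i * (q - 1))" using i y by (simp add: inv_equality)
    then show "inv a \<in> range (\<lambda>i::nat. y [^] i)" by blast
  next
    fix a b assume "a \<in> range (\<lambda>i::nat. y [^] i)" "b \<in> range (\<lambda>i::nat. y [^] i)"
    then obtain i j :: nat where "a = y [^] i" "b = y [^] j" by blast
    then have "a \<otimes> b = y [^] (i + j)" using y by (simp add: nat_pow_mult)
    then show "a \<otimes> b \<in> range (\<lambda>i::nat. y [^] i)" by blast
  qed (use y in auto)
  moreover have "a \<otimes> b = b \<otimes> a" if "a \<in> range (\<lambda>i::nat. y [^] i)" "b \<in> range (\<lambda>i::nat. y [^] i)" for a b
    using that y by (auto simp: nat_pow_mult add.commute)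
  moreover have "a [^] q = \<one>" if a: "a \<in> range (\<lambda>i::nat. y [^] i)" for a
  proof -
    obtain i :: nat where "a = y [^] i" using a by blast
    then have "a [^] q = y [^] (q * i)" using y(1) by (simp add: nat_pow_pow mult.commute)
    also have "\<dots> = (y [^] q) [^] i" using y(1) by (simp only: nat_pow_pow)
    finally show ?thesis using y(2) by simp
  qed
  ultimately show ?thesis unfolding elementary_abelian_subgroup_def by blast
qed

lemma card_Fp_basis:
  assumes "Fp_basis q G E B" "finite E"
  shows "card E = q ^ card B"
proof -
  have "finite B" using assms finite_subset unfolding Fp_basis_def by blast
  have "card (B \<rightarrow>\<^sub>E {0..<q}) = card E"
    using assms unfolding Fp_basis_def by (blast intro: bij_betw_same_card)
  then show ?thesis using card_PiE[OF \<open>finite B\<close>, of "\<lambda>_. {0..<q}"] by simp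
qed

text \<open>A maximal subset with injective coordinate map is a basis: an element \<open>e\<close> outside of the image,
  which is a subgroup, could be adjoined.\<close>

lemma ex_Fp_basis:
  assumes G: "card (carrier G) = q ^ n" and q: "prime q" and el: "elementary_abelian_subgroup q G E"
  shows "\<exists>B. Fp_basis q G E B"
proof -
  have Es: "subgroup E G" and Ec: "\<And>x y. x \<in> E \<Longrightarrow> y \<in> E \<Longrightarrow> x \<otimes> y = y \<otimes> x"
    and Eq: "\<And>x. x \<in> E \<Longrightarrow> x [^] q = \<one>"
    using el unfolding elementary_abelian_subgroup_def by blast+
  have Ein: "x \<in> carrier G" if "x \<in> E" for x using Es that by (rule subgroup.mem_carrier)
  have q1: "1 < q" using q by (rule prime_gt_1_nat)
  have "finite (carrier G)" using G q by (metis card.infinite not_prime_0 power_not_zero)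
  then have finE: "finite E" using Ein by (meson finite_subset subsetI)
  let ?H = "G\<lparr>carrier := E\<rparr>"
  interpret H: group ?H using Es by (rule subgroup_imp_group)
  interpret H: comm_group ?H by (rule H.group_comm_groupI) (use Ec in simp)
  have powE: "x [^] (k::nat) \<in> E" if "x \<in> E" for x k using Es that by (rule subgroup_nat_pow_closed)
  have powmod: "x [^] (k mod q) = x [^] k" if x: "x \<in> E" for x and k :: nat
  proof -
    have "x [^] k = x [^] (q * (k div q) + k mod q)" by simp
    also have "\<dots> = (x [^] q) [^] (k div q) \<otimes> x [^] (k mod q)"
      using Ein[OF x] by (simp only: nat_pow_mult nat_pow_pow)
    also have "\<dots> = x [^] (k mod q)" using Ein[OF x] Eq[OF x] by simp
    finally show ?thesis by simp
  qed
  define f where "f B c = finprod ?H (\<lambda>b. b [^] (c b :: nat)) B" for B c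
  let ?D = "\<lambda>B. B \<rightarrow>\<^sub>E {0..<q}"
  have fE: "f B c \<in> E" if "B \<subseteq> E" for B c
    unfolding f_def using H.finprod_closed[of "\<lambda>b. b [^] (c b :: nat)" B] that powE by (simp add: Pi_def subset_iff)
  define S where "S = {B. B \<subseteq> E \<and> inj_on (f B) (?D B)}"
  have "finite S" unfolding S_def using finE by simp
  moreover have "{} \<in> S" by (simp add: S_def)
  ultimately obtain B where "B \<in> S" and max: "\<And>B'. B' \<in> S \<Longrightarrow> B \<subseteq> B' \<Longrightarrow> B' = B"
    using finite_has_maximal[of S] by blast
  then have BE: "B \<subseteq> E" and inj: "inj_on (f B) (?D B)" by (simp_all add: S_def)
  have finB: "finite B" using BE finE by (rule finite_subset)
  let ?I = "f B ` ?D B"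
  have I_mult: "x \<otimes> y \<in> ?I" if xI: "x \<in> ?I" and yI: "y \<in> ?I" for x y
  proof -
    obtain c where c: "c \<in> ?D B" "x = f B c" using xI by blast
    obtain d where d: "d \<in> ?D B" "y = f B d" using yI by blast
    note cd = c d
    let ?e = "\<lambda>b\<in>B. (c b + d b) mod q"
    have "f B ?e = finprod ?H (\<lambda>b. b [^] c b \<otimes>\<^bsub>?H\<^esub> b [^] d b) B"
      unfolding f_def
    proof (rule H.finprod_cong')
      show "(\<lambda>b. b [^] c b \<otimes>\<^bsub>?H\<^esub> b [^] d b) \<in> B \<rightarrow> carrier ?H"
        using BE powE subgroup.m_closed[OF Es] by auto
      show "b [^] ?e b = b [^] c b \<otimes>\<^bsub>?H\<^esub> b [^] d b" if "b \<in> B" for b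
        using that BE powmod[of b "c b + d b"] Ein by (auto simp: nat_pow_mult)
    qed simp
    also have "\<dots> = x \<otimes>\<^bsub>?H\<^esub> y" unfolding cd f_def
      using BE powE by (intro H.finprod_multf) auto
    finally have "x \<otimes> y = f B ?e" by simp
    moreover have "?e \<in> ?D B" using q1 by auto
    ultimately show ?thesis by blast
  qed
  have I_one: "\<one> \<in> ?I"
  proof -
    have "f B (\<lambda>b\<in>B. 0) = \<one>\<^bsub>?H\<^esub>"
      unfolding f_def by (rule H.finprod_one_eqI) simp
    moreover have "(\<lambda>b\<in>B. 0) \<in> ?D B" using q1 by auto
    ultimately show ?thesis by (intro image_eqI[of _ _ "\<lambda>b\<in>B. 0"]) simp_all
  qed
  have I_pow: "x [^] (k::nat) \<in> ?I" if "x \<in> ?I" for x k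
    using that by (induction k) (auto intro: I_one I_mult)
  have IE: "?I \<subseteq> E" using fE[OF BE] by blast
  have I_inv: "inv x = x [^] (q - 1)" if "x \<in> E" for x
  proof (rule inv_equality)
    have "x [^] (q - 1) \<otimes> x = x [^] (Suc (q - 1))" by simp
    then show "x [^] (q - 1) \<otimes> x = \<one>" using Eq[OF that] q1 by simp
  qed (use Ein that in simp_all)
  have I_sub: "subgroup ?I G"
  proof (rule subgroupI)
    show "?I \<subseteq> carrier G" using IE Ein by blast
    show "?I \<noteq> {}" using I_one by blast
    show "inv a \<in> ?I" if "a \<in> ?I" for a using I_inv[of a] I_pow[OF that] IE that by auto
  qed (rule I_mult)
  have "?I = E"
  proof (rule ccontr)
    assume "?I \<noteq> E"
    then obtain e where e: "e \<in> E" "e \<notin> ?I" using IE by blast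
    have eB: "e \<notin> B"
    proof
      assume "e \<in> B"
      have "f B (\<lambda>b\<in>B. if e = b then 1 else 0) = finprod ?H (\<lambda>b. if e = b then b else \<one>\<^bsub>?H\<^esub>) B"
        unfolding f_def
      proof (rule H.finprod_cong')
        show "(\<lambda>b. if e = b then b else \<one>\<^bsub>?H\<^esub>) \<in> B \<rightarrow> carrier ?H"
          using BE subgroup.one_closed[OF Es] by auto
        show "b [^] (\<lambda>b\<in>B. if e = b then 1 else 0 :: nat) b = (if e = b then b else \<one>\<^bsub>?H\<^esub>)" if "b \<in> B" for b
          using that BE Ein by auto
      qed simp
      also have "\<dots> = e" using \<open>e \<in> B\<close> finB BE by (intro H.finprod_singleton) auto
      finally have fe: "f B (\<lambda>b\<in>B. if e = b then 1 else 0) = e" .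
      have "(\<lambda>b\<in>B. if e = b then 1 else 0) \<in> ?D B" using q1 by auto
      then have "f B (\<lambda>b\<in>B. if e = b then 1 else 0) \<in> ?I" by (rule imageI)
      then show False using e(2) unfolding fe by simp
    qed
    have ins: "f (insert e B) c = e [^] c e \<otimes> f B (restrict c B)" for c
    proof -
      have "f (insert e B) c = e [^] c e \<otimes>\<^bsub>?H\<^esub> finprod ?H (\<lambda>b. b [^] c b) B"
        unfolding f_def using finB eB BE e powE by (intro H.finprod_insert) auto
      also have "finprod ?H (\<lambda>b. b [^] c b) B = f B (restrict c B)"
        unfolding f_def using BE powE by (intro H.finprod_cong') auto
      finally show ?thesis by simp
    qed
    \<comment> \<open>Taking \<open>c e \<le> d e\<close> keeps the difference of exponents a
      natural number. It is less than q, so if it were positive, e would itself lie in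
      \<open>?I\<close>.\<close>
    have one_sided: "c = d"
      if c: "c \<in> ?D (insert e B)" and d: "d \<in> ?D (insert e B)" and eq: "f (insert e B) c = f (insert e B) d" and le: "c e \<le> d e"
      for c d
    proof -
      let ?x = "f B (restrict c B)" and ?y = "f B (restrict d B)"
      have cB: "restrict c B \<in> ?D B" and dB: "restrict d B \<in> ?D B" using c d by auto
      have xy: "?x \<in> carrier G" "?y \<in> carrier G" using fE[OF BE] Ein by blast+
      have ec: "e \<in> carrier G" using e Ein by blast
      have "e [^] d e = e [^] c e \<otimes> e [^] (d e - c e)" using le ec by (simp add: nat_pow_mult)
      then have "e [^] c e \<otimes> ?x = e [^] c e \<otimes> (e [^] (d e - c e) \<otimes> ?y)"
        using eq ec xy by (simp add: ins m_assoc)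
      then have x: "?x = e [^] (d e - c e) \<otimes> ?y" using ec xy by simp
      have "c e = d e"
      proof (rule ccontr)
        assume "c e \<noteq> d e"
        have "e [^] (d e - c e) = ?x \<otimes> inv ?y" using x ec xy by (simp add: m_assoc)
        then have "e [^] (d e - c e) \<in> ?I"
          using cB dB I_sub by (simp add: subgroup.m_closed subgroup.m_inv_closed)
        moreover have "d e < q" using d by auto
        ultimately have "e \<in> ?I"
          using pow_coprime_in_subgroup[OF ec I_sub G q, of "d e - c e"] le \<open>c e \<noteq> d e\<close> by simp
        then show False using e by simp
      qed
      then have "?x = ?y" using x xy by simp
      then have r: "restrict c B = restrict d B" using inj cB dB by (simp add: inj_on_def)
      show "c = d"
      proof (rule PiE_ext[OF c d])
        fix b assume "b \<in> insert e B"
        then show "c b = d b" using \<open>c e = d e\<close> r by (metis insertE restrict_apply')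
      qed
    qed
    have "inj_on (f (insert e B)) (?D (insert e B))"
    proof (rule inj_onI)
      fix c d assume "c \<in> ?D (insert e B)" "d \<in> ?D (insert e B)" "f (insert e B) c = f (insert e B) d"
      then show "c = d" using one_sided[of c d] one_sided[of d c] by (metis nle_le)
    qed
    then have "insert e B \<in> S" using e BE by (simp add: S_def)
    then show False using max[of "insert e B"] eB by blast
  qed
  then have "Fp_basis q G E B"
    unfolding Fp_basis_def bij_betw_def using BE inj by (simp add: f_def[abs_def])
  then show ?thesis by blast
qed

text \<open>Every basis \<open>B\<close> satisfies \<open>card E = q ^ card B\<close>, so the choice
  made in \<open>Fp_rank\<close> does not affect the value.\<close>

lemma card_elementary_abelian_le:
  assumes G: "card (carrier G) = q ^ n" and q: "prime q" and el: "elementary_abelian_subgroup q G E"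
  shows "card E \<le> q ^ p_rank q G"
proof -
  have finG: "finite (carrier G)" using G q by (metis card.infinite not_prime_0 power_not_zero)
  have "finite E" using el finG finite_subset subgroup.subset unfolding elementary_abelian_subgroup_def by metis
  moreover have "Fp_basis q G E (SOME B. Fp_basis q G E B)"
    using ex_Fp_basis[OF assms] by (rule someI_ex)
  ultimately have "card E = q ^ Fp_rank q G E" unfolding Fp_rank_def using card_Fp_basis by blast
  moreover have "Fp_rank q G E \<le> p_rank q G"
    unfolding p_rank_def
  proof (rule Max_ge)
    have "{E. elementary_abelian_subgroup q G E} \<subseteq> Pow (carrier G)"
      using subgroup.subset unfolding elementary_abelian_subgroup_def by blast
    then show "finite (Fp_rank q G ` {E. elementary_abelian_subgroup q G E})"
      using finG by (meson finite_Pow_iff finite_imageI finite_subset)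
  qed (use el in blast)
  ultimately show ?thesis using prime_gt_1_nat[OF q] by (simp add: power_increasing)
qed

end

section \<open>Quadratic offenders and the center\<close>

lemma (in group) ex_pow_enters:
  assumes H: "subgroup H G" and G: "card (carrier G) = p ^ n" and y: "y \<in> carrier G" "y \<notin> H"
  shows "\<exists>k. y [^] (p ^ k) \<notin> H \<and> (y [^] (p ^ k)) [^] p \<in> H"
proof -
  have "y [^] (p ^ n) = \<one>" using pow_order_eq_1[OF y(1)] G by (simp add: Coset.order_def)
  then have ex: "y [^] (p ^ n) \<in> H" using subgroup.one_closed[OF H] by simp
  define j where "j = (LEAST j. y [^] (p ^ j) \<in> H)"
  have j: "y [^] (p ^ j) \<in> H" unfolding j_def using ex by (rule LeastI)
  then have "j \<noteq> 0" using y by (auto intro!: Nat.gr0I)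
  then obtain k where k: "j = Suc k" by (cases j) auto
  have "y [^] (p ^ k) \<notin> H" using not_less_Least[of k "\<lambda>j. y [^] (p ^ j) \<in> H"] k by (simp add: j_def)
  moreover have "(y [^] (p ^ k)) [^] p \<in> H" using j y by (simp add: k nat_pow_pow mult.commute)
  ultimately show ?thesis by blast
qed

context odd_FpG_module
begin

lemma subspace_fixed_points:
  assumes "E \<subseteq> carrier G"
  shows "subspace (fixed_points act E)"
  unfolding fixed_points_def
  by (rule subspaceI) (use assms in \<open>auto simp: act_add act_scale subset_iff\<close>)

text \<open>Modulo the fixed points of \<open>E\<close> the module has dimension at most r, so a
  nilpotent operator has index at most r there. Instead of a quotient, the proof counts the
  preimages \<open>V i\<close>: each strict step of the chain multiplies the order by at least p,
  and a chain that stalls is already everything.\<close>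

lemma funpow_delta_fixed_points:
  assumes E: "E \<subseteq> carrier G" and y: "y \<in> carrier G" and comm: "\<And>e. e \<in> E \<Longrightarrow> y \<otimes> e = e \<otimes> y"
    and fin: "finite (UNIV :: 'v set)" and card: "card (UNIV :: 'v set) \<le> p ^ r * card (fixed_points act E)"
  shows "(delta y ^^ r) v \<in> fixed_points act E"
proof -
  let ?W = "fixed_points act E"
  define V where "V i = {v. (delta y ^^ i) v \<in> ?W}" for i
  have W: "subspace ?W" using E by (rule subspace_fixed_points)
  have W_delta: "delta y w \<in> ?W" if "w \<in> ?W" for w
  proof -
    have "delta e (delta y w) = 0" if "e \<in> E" for e
    proof -
      have "delta e w = 0" using \<open>w \<in> ?W\<close> that by (simp add: fixed_points_def delta_eq_0_iff)
      then show ?thesis using delta_commute[of e y w] comm[OF that] that E y by auto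
    qed
    then show ?thesis by (simp add: fixed_points_def delta_eq_0_iff)
  qed
  have sub: "subspace (V i)" for i
    unfolding V_def using W y
    by (intro subspaceI) (auto simp: funpow_delta_add funpow_delta_scale subspace_0 subspace_add subspace_scale)
  have mono: "V i \<subseteq> V (Suc i)" for i unfolding V_def using W_delta by auto
  have stable: "V i = UNIV" if eq: "V (Suc i) = V i" for i
  proof -
    have "V (i + j) = V i" for j
    proof (induction j)
      case (Suc j)
      have "v \<in> V (Suc (i + j)) \<longleftrightarrow> v \<in> V (i + j)" for v
      proof -
        have "v \<in> V (Suc (i + j)) \<longleftrightarrow> (delta y ^^ j) v \<in> V (Suc i)"
          unfolding V_def mem_Collect_eq by (metis add_Suc comp_apply funpow_add)
        also have "\<dots> \<longleftrightarrow> v \<in> V (i + j)"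
          unfolding eq unfolding V_def mem_Collect_eq by (metis comp_apply funpow_add)
        finally show ?thesis .
      qed
      then show ?case using Suc by auto
    qed simp
    moreover obtain N where N: "\<forall>v. (delta y ^^ N) v = 0" using delta_nilpotent[OF y] by blast
    have "V (i + N) = UNIV"
      unfolding V_def using N subspace_0[OF W] y by (auto simp: funpow_add)
    ultimately show ?thesis by metis
  qed
  have "V i = UNIV \<or> p ^ i * card ?W \<le> card (V i)" for i
  proof (induction i)
    case 0
    then show ?case by (simp add: V_def)
  next
    case (Suc i)
    show ?case
    proof (cases "V (Suc i) = V i \<or> V i = UNIV")
      case True
      then have "V i = UNIV" using stable by blast
      then show ?thesis using mono[of i] by blast
    next
      case False
      have "p * card (V i) \<le> card (V (Suc i))"
        using card_subspace_mult[OF sub sub mono] False fin card_field finite_subset[OF subset_UNIV fin] by metis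
      moreover have "p ^ i * card ?W \<le> card (V i)" using Suc False by blast
      ultimately have "p * (p ^ i * card ?W) \<le> card (V (Suc i))" by (meson mult_le_mono2 order_trans)
      then show ?thesis by (simp add: mult.assoc)
    qed
  qed
  then have "V r = UNIV \<or> card (UNIV :: 'v set) \<le> card (V r)" using card le_trans by blast
  then have "V r = UNIV" using fin by (metis card_seteq subset_UNIV)
  then show ?thesis unfolding V_def by blast
qed

definition conj_closure :: "'g set \<Rightarrow> 'g set" where
  "conj_closure E = generate G (\<Union>g\<in>carrier G. (\<lambda>e. conj_by e g) ` E)"

lemma conj_closure_normal:
  assumes "E \<subseteq> carrier G"
  shows "conj_closure E \<lhd> G"
  unfolding conj_closure_def
proof (rule normal_generateI)
  show "(\<Union>g\<in>carrier G. (\<lambda>e. conj_by e g) ` E) \<subseteq> carrier G" using assms by auto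
  fix h g assume h: "h \<in> (\<Union>g\<in>carrier G. (\<lambda>e. conj_by e g) ` E)" and g: "g \<in> carrier G"
  then obtain e k where ek: "e \<in> E" "k \<in> carrier G" "h = conj_by e k" by auto
  have eq: "g \<otimes> h \<otimes> inv g = conj_by e (k \<otimes> inv g)"
    using ek g assms by (auto simp: group_word)
  show "g \<otimes> h \<otimes> inv g \<in> (\<Union>g\<in>carrier G. (\<lambda>e. conj_by e g) ` E)"
    unfolding eq using ek g by (intro UN_I[of "k \<otimes> inv g"] imageI) auto
qed

lemma subset_conj_closure: "E \<subseteq> carrier G \<Longrightarrow> E \<subseteq> conj_closure E"
proof
  fix e assume "E \<subseteq> carrier G" "e \<in> E"
  then have "e = conj_by e \<one>" by auto
  then show "e \<in> conj_closure E" unfolding conj_closure_def using \<open>e \<in> E\<close> by (intro generate.incl) blast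
qed

text \<open>Acting by \<open>inv g\<close> turns the claim about \<open>conj_by e g\<close> into one
  about e, with y replaced by a conjugate of y. All conjugates of y commute with \<open>E\<close>,
  so \<open>funpow_delta_fixed_points\<close> applies to each.\<close>

lemma conj_closure_fixes:
  assumes E: "E \<subseteq> carrier G" and y: "y \<in> carrier G"
    and comm: "\<And>e g. e \<in> E \<Longrightarrow> g \<in> carrier G \<Longrightarrow> conj_by y g \<otimes> e = e \<otimes> conj_by y g"
    and fin: "finite (UNIV :: 'v set)" and card: "card (UNIV :: 'v set) \<le> p ^ r * card (fixed_points act E)"
    and x: "x \<in> conj_closure E"
  shows "delta x ((delta y ^^ r) v) = 0"
proof -
  let ?S = "{x \<in> carrier G. \<forall>v. act ((delta y ^^ r) v) x = (delta y ^^ r) v}"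
  have "subgroup ?S G"
  proof (rule subgroupI)
    have "\<one> \<in> ?S" by (simp add: act_one)
    then show "?S \<noteq> {}" by blast
    fix a assume a: "a \<in> ?S"
    have "act ((delta y ^^ r) v) (inv a) = (delta y ^^ r) v" for v
      using a act_inv(1)[of a "(delta y ^^ r) v"] by simp
    then show "inv a \<in> ?S" using a by simp
  qed (auto simp: act_mult)
  moreover have "conj_by e g \<in> ?S" if e: "e \<in> E" and g: "g \<in> carrier G" for e g
  proof -
    have ec: "e \<in> carrier G" using e E by blast
    have "act ((delta y ^^ r) v) (conj_by e g) = (delta y ^^ r) v" for v
    proof -
      let ?w = "act ((delta y ^^ r) v) (inv g)"
      have w: "?w = (delta (conj_by y (inv g)) ^^ r) (act v (inv g))"
        using y g by (simp add: act_funpow_delta_conj_by)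
      have "?w \<in> fixed_points act E"
        unfolding w using comm y g by (intro funpow_delta_fixed_points[OF E _ _ fin card]) auto
      then have "act ?w e = ?w" using e by (simp add: fixed_points_def)
      then have "act (act ?w e) g = (delta y ^^ r) v" using g by (simp add: act_inv)
      then show ?thesis using ec g by (simp add: conj_by_def act_mult)
    qed
    then show ?thesis using ec g by simp
  qed
  ultimately have "conj_closure E \<subseteq> ?S"
    unfolding conj_closure_def by (intro generate_subgroup_incl) auto
  then show ?thesis using x by (auto simp: delta_eq_0_iff)
qed

text \<open>The center being abelian, this set is already the subgroup that
  \<open>Omega1_center\<close> generates.\<close>

definition Omega_center :: "'g set" where
  "Omega_center = {z \<in> center G. z [^] p = \<one>}"

lemma Omega_center_elementary: "elementary_abelian_subgroup p G Omega_center"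
proof -
  have "subgroup Omega_center G"
  proof (rule subgroupI)
    show "Omega_center \<subseteq> carrier G" using centerD by (auto simp: Omega_center_def)
    show "Omega_center \<noteq> {}" using subgroup.one_closed[OF center_subgroup] by (auto simp: Omega_center_def intro!: exI[of _ \<one>])
    fix a assume a: "a \<in> Omega_center"
    then show "inv a \<in> Omega_center" using subgroup.m_inv_closed[OF center_subgroup] centerD
      by (simp add: Omega_center_def nat_pow_inv)
    fix b assume b: "b \<in> Omega_center"
    show "a \<otimes> b \<in> Omega_center" using a b subgroup.m_closed[OF center_subgroup] centerD pow_mult_distrib[of a b p]
      by (simp add: Omega_center_def)
  qed
  then show ?thesis unfolding elementary_abelian_subgroup_def Omega_center_def using centerD by simp
qed

lemma normal_meets_Omega_center:
  assumes N: "N \<lhd> G" and "N \<noteq> {\<one>}"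
  shows "\<exists>z\<in>N. z \<noteq> \<one> \<and> z \<in> Omega_center"
proof -
  obtain z where z: "z \<in> N" "z \<noteq> \<one>" "z \<in> center G"
    using normal_meets_center[OF card_G prime_p assms] by blast
  have zc: "z \<in> carrier G" using z centerD by blast
  have "subgroup {\<one>} G" by (rule triv_subgroup)
  from ex_pow_enters[OF this card_G zc] z
  obtain k where k: "z [^] (p ^ k) \<noteq> \<one>" "(z [^] (p ^ k)) [^] p = \<one>" by auto
  moreover have "z [^] (p ^ k) \<in> N" "z [^] (p ^ k) \<in> center G"
    using subgroup_nat_pow_closed[OF normal_imp_subgroup[OF N] z(1)]
      subgroup_nat_pow_closed[OF center_subgroup z(3)] by blast+
  ultimately show ?thesis unfolding Omega_center_def by blast
qed

end

section \<open>The rank of a quadratic offender\<close>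

locale quadratic_offender = odd_FpG_module +
  fixes E :: "'a set"
  assumes offender: "offender p G act E" and quad_E: "\<And>e. e \<in> E \<Longrightarrow> quad e"
begin

lemma E_elementary: "elementary_abelian_subgroup p G E"
  and E_nontrivial: "E \<noteq> {\<one>}" and finite_V: "finite (UNIV :: 'd set)"
  and card_V: "card (UNIV :: 'd set) \<le> card E * card (fixed_points act E)"
  using offender by (simp_all add: offender_card)

lemma E_subgroup: "subgroup E G"
  using E_elementary unfolding elementary_abelian_subgroup_def by blast

lemma E_carrier: "e \<in> E \<Longrightarrow> e \<in> carrier G"
  using E_subgroup by (rule subgroup.mem_carrier)

lemma E_subset: "E \<subseteq> carrier G"
  using E_carrier by blast

lemma E_center: "e \<in> E \<Longrightarrow> e \<in> center G \<Longrightarrow> e = \<one>"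
  using quad_E quad_center by blast

lemma ex_Omega_conj_closure:
  obtains z where "z \<in> conj_closure E" "z \<noteq> \<one>" "z \<in> Omega_center"
proof -
  have "conj_closure E \<noteq> {\<one>}"
    using subset_conj_closure[OF E_subset] E_nontrivial subgroup.one_closed[OF E_subgroup] by blast
  then show thesis
    using normal_meets_Omega_center[OF conj_closure_normal[OF E_subset]] that by blast
qed

lemma card_E_ge: "p ^ (p - 1) \<le> card E"
proof -
  have "card E dvd p ^ group_exp"
    using subgroup_card_dvd[OF E_subgroup subgroup_self E_subset] card_G by simp
  then obtain r where r: "card E = p ^ r" using prime_p divides_primepow_nat by metis
  obtain z where z: "z \<in> conj_closure E" "z \<noteq> \<one>" "z \<in> Omega_center" by (rule ex_Omega_conj_closure)
  have zZ: "z \<in> center G" and zp: "z [^] p = \<one>" using z by (simp_all add: Omega_center_def)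
  have zc: "z \<in> carrier G" using zZ centerD by blast
  have conj: "conj_by z g = z" if "g \<in> carrier G" for g
    using centerD(1)[OF zZ that] that zc by (simp add: conj_by_def m_assoc cancel_inv_left)
  \<comment> \<open>z serves both as the operator and as the element of the normal closure fixing
    its image.\<close>
  have "delta z ((delta z ^^ r) v) = 0" for v
  proof (rule conj_closure_fixes[OF E_subset zc _ finite_V _ z(1)])
    show "conj_by z g \<otimes> e = e \<otimes> conj_by z g" if "e \<in> E" "g \<in> carrier G" for e g
      using conj that centerD(1)[OF zZ] E_carrier by simp
    show "card (UNIV :: 'd set) \<le> p ^ r * card (fixed_points act E)" using card_V r by simp
  qed
  then have "p \<le> Suc r" using z zp zZ by (intro central_nilpotent_degree[of z]) simp_all
  then show ?thesis using r prime_gt_1_nat[OF prime_p] by (simp add: power_increasing)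
qed

lemma not_small_rank:
  assumes small: "\<And>A. elementary_abelian_subgroup p G A \<Longrightarrow> card A \<le> p ^ p"
  shows False
proof -
  have p1: "1 < p" using p3 by simp
  let ?Z = Omega_center and ?N = "conj_closure E"
  have Zs: "subgroup ?Z G" using Omega_center_elementary unfolding elementary_abelian_subgroup_def by blast
  have ZD: "z \<in> center G" "z \<in> carrier G" "z [^] p = \<one>" if "z \<in> ?Z" for z
    using that centerD by (auto simp: Omega_center_def)
  obtain z0 where z0: "z0 \<in> ?N" "z0 \<noteq> \<one>" "z0 \<in> ?Z" by (rule ex_Omega_conj_closure)
  \<comment> \<open>\<open>A\<close> has order at least \<open>p^(p - 1) * p\<close>, so the
    assumption forces equality throughout: \<open>?Z\<close> has order p, \<open>E\<close> has order
    \<open>p^(p - 1)\<close>, and \<open>A\<close> attains the maximal order.\<close>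
  define A where "A = {x. \<exists>e\<in>E. \<exists>z\<in>?Z. x = e \<otimes> z}"
  have EZ: "e \<otimes> z = z \<otimes> e" if "e \<in> E" "z \<in> ?Z" for e z
    using centerD(1)[OF ZD(1)[OF that(2)] E_carrier[OF that(1)]] by simp
  have A: "elementary_abelian_subgroup p G A"
    unfolding A_def by (rule elementary_abelian_mult[OF E_elementary Omega_center_elementary EZ])
  have As: "subgroup A G" using A unfolding elementary_abelian_subgroup_def by blast
  have EA: "E \<subseteq> A" unfolding A_def using subgroup.one_closed[OF Zs] E_carrier by force
  have ZA: "?Z \<subseteq> A" unfolding A_def using subgroup.one_closed[OF E_subgroup] ZD by force
  have "E \<inter> ?Z = {\<one>}"
    using E_center ZD subgroup.one_closed[OF E_subgroup] subgroup.one_closed[OF Zs] by blast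
  then have EZA: "card E * card ?Z \<le> card A"
    using card_mult_le(1)[OF finite_G E_subgroup Zs As EA ZA] by blast
  have "card ?Z dvd p ^ group_exp"
    using subgroup_card_dvd[OF Zs subgroup_self subgroup.subset[OF Zs]] card_G by simp
  then obtain a where a: "card ?Z = p ^ a" using prime_p divides_primepow_nat by metis
  have "card ?Z \<noteq> 1"
  proof
    assume "card ?Z = 1"
    then obtain u where "?Z = {u}" by (auto simp: card_1_singleton_iff)
    then show False using z0 subgroup.one_closed[OF Zs] by auto
  qed
  then have "a \<noteq> 0" using a by auto
  obtain p' where p': "p = Suc p'" using p1 by (cases p) auto
  then have pp: "p ^ p = p ^ (p - 1) * p" by (simp add: mult.commute)
  have le: "p ^ (p - 1) * card ?Z \<le> card A"
    using mult_le_mono1[OF card_E_ge] EZA by (rule le_trans)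
  then have "p ^ (p - 1) * p ^ a \<le> p ^ p" using small[OF A] a by simp
  then have "p ^ (p - 1 + a) \<le> p ^ p" by (simp only: power_add)
  then have "p - 1 + a \<le> p" using p1 by (simp only: power_increasing_iff)
  then have "a = 1" using \<open>a \<noteq> 0\<close> p1 by simp
  then have cZ: "card ?Z = p" using a by simp
  have cA: "card A = p ^ p"
    using le small[OF A] unfolding cZ pp by (rule antisym[rotated])
  have "card E * p \<le> p ^ (p - 1) * p"
    using EZA small[OF A] unfolding cZ pp by (rule le_trans)
  then have cE: "card E = p ^ (p - 1)" using card_E_ge p1 by simp
  \<comment> \<open>As \<open>?Z\<close> has prime order, \<open>z0\<close> brings all of it into
    the normal closure.\<close>
  have ZN: "?Z \<subseteq> ?N"
  proof -
    have Ns: "subgroup ?N G" using conj_closure_normal[OF E_subset] by (rule normal_imp_subgroup)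
    have "?N \<inter> ?Z = ?Z"
      using z0 subgroup.one_closed[OF Ns] subgroup.one_closed[OF Zs] cZ
      by (intro prime_index_subgroup_eq[OF finite_G prime_p triv_subgroup _ Zs, where n = 1]
          subgroups_Inter_pair Ns Zs) auto
    then show ?thesis by blast
  qed
  text \<open>For such a \<open>y\<close> the operator \<open>(y - 1)\<^bsup>2p-1\<^esup>\<close> vanishes on the module, while \<open>(y\<^sup>p - 1)\<^bsup>p-1\<^esup>\<close> is a
    power of \<open>y - 1\<close> with an exponent at least as large.\<close>
  have second: "y [^] p = \<one>"
    if y: "y \<in> carrier G" and yc: "\<And>g. g \<in> carrier G \<Longrightarrow> comm y g \<in> center G" and yp: "y [^] p \<in> ?Z" for y
  proof (rule ccontr)
    assume ne: "y [^] p \<noteq> \<one>"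
    have ye: "y \<otimes> e = e \<otimes> y" if e: "e \<in> E" for e
    proof -
      have "comm e y \<in> center G"
        using yc[OF E_carrier[OF e]] normal_comm_swap[OF center_normal E_carrier[OF e] y] by blast
      then show ?thesis using quad_comm_center[OF quad_E[OF e] E_carrier[OF e] y] by simp
    qed
    have conj: "conj_by y g \<otimes> e = e \<otimes> conj_by y g" if e: "e \<in> E" and g: "g \<in> carrier G" for e g
    proof -
      have c: "comm y g \<in> center G" using yc g by blast
      have cc: "comm y g \<in> carrier G" using y g by simp
      have "conj_by y g \<otimes> e = y \<otimes> (e \<otimes> comm y g)"
        using centerD(1)[OF c E_carrier[OF e]] y g E_carrier[OF e] by (simp add: conj_by_eq m_assoc)
      also have "\<dots> = e \<otimes> conj_by y g"
        using ye[OF e] y g E_carrier[OF e] cc by (simp add: conj_by_eq m_assoc[symmetric])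
      finally show ?thesis .
    qed
    have "delta (y [^] p) ((delta y ^^ (p - 1)) v) = 0" for v
      by (rule conj_closure_fixes[OF E_subset y conj finite_V]) (use card_V cE yp ZN in auto)
    then have z: "(delta y ^^ (p + (p - 1))) v = 0" for v
      using funpow_delta_p[OF y] by (simp add: funpow_add)
    have "p + (p - 1) \<le> p * (p - 1)"
    proof -
      obtain q where "p = q + 3" using p3 by (metis le_add_diff_inverse2)
      then show ?thesis by (simp add: algebra_simps)
    qed
    then obtain l where l: "p * (p - 1) = l + (p + (p - 1))" by (metis le_add_diff_inverse2)
    have "(delta (y [^] p) ^^ (p - 1)) v = 0" for v
      unfolding funpow_delta_mult_p[OF y, symmetric] l using z y by (simp add: funpow_add)
    then have "p \<le> p - 1" using ZD[OF yp] ne by (intro central_nilpotent_degree[of "y [^] p"]) auto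
    then show False using p1 by simp
  qed
  \<comment> \<open>Otherwise the center would contain an element of order \<open>p^2\<close>,
    against \<open>second\<close>. This guarantees \<open>y [^] p \<in> ?Z\<close> for the y chosen
    below.\<close>
  have Z_elem: "w \<in> ?Z" if w: "w \<in> center G" for w
  proof (rule ccontr)
    assume "w \<notin> ?Z"
    have wc: "w \<in> carrier G" using w centerD by blast
    from ex_pow_enters[OF Zs card_G wc \<open>w \<notin> ?Z\<close>] obtain k
      where k: "w [^] (p ^ k) \<notin> ?Z" "(w [^] (p ^ k)) [^] p \<in> ?Z" by blast
    let ?y = "w [^] (p ^ k)"
    have yZ: "?y \<in> center G" using subgroup_nat_pow_closed[OF center_subgroup w] .
    have "?y [^] p = \<one>"
    proof (rule second[OF _ _ k(2)])
      show "comm ?y g \<in> center G" if "g \<in> carrier G" for g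
        using normal_comm_left[OF center_normal yZ that] .
    qed (use wc in simp)
    then show False using k(1) yZ by (simp add: Omega_center_def)
  qed
  \<comment> \<open>A non-trivial central element of the quotient by the center is lifted; the
    quotient is non-trivial because the center meets \<open>E\<close> trivially.\<close>
  have "\<exists>y\<in>carrier G. y \<notin> center G \<and> (\<forall>g\<in>carrier G. comm y g \<in> center G)"
  proof -
    interpret Z: normal "center G" G by (rule center_normal)
    let ?Q = "G Mod (center G)"
    interpret Q: group ?Q by (rule Z.factorgroup_is_group)
    have "card (carrier ?Q) * card (center G) = p ^ group_exp"
      using lagrange[OF center_subgroup] card_G by (simp add: Coset.order_def FactGroup_def)
    then obtain m where m: "card (carrier ?Q) = p ^ m"
      using prime_p divides_primepow_nat by (metis dvd_triv_left)
    obtain e where e: "e \<in> E" "e \<noteq> \<one>" using E_nontrivial subgroup.one_closed[OF E_subgroup] by blast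
    have cos: "center G #> x = center G \<longleftrightarrow> x \<in> center G" if "x \<in> carrier G" for x
      using that rcos_self[OF that center_subgroup] coset_join2[OF that center_subgroup] by blast
    have "center G #> e \<in> carrier ?Q" "center G #> e \<noteq> center G"
      using e E_center E_carrier cos by (auto simp: carrier_FactGroup)
    then have "carrier ?Q \<noteq> {\<one>\<^bsub>?Q\<^esub>}" by auto
    from Q.normal_meets_center[OF m prime_p Q.normal_self this]
    obtain c where c: "c \<in> carrier ?Q" "c \<noteq> center G" "c \<in> center ?Q" by auto
    obtain y where y: "y \<in> carrier G" "c = center G #> y" using c(1) by (auto simp: carrier_FactGroup)
    have cc: "c \<otimes>\<^bsub>?Q\<^esub> q = q \<otimes>\<^bsub>?Q\<^esub> c" if "q \<in> carrier ?Q" for q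
      using c(3) that unfolding center_def[of ?Q] by blast
    have "comm y g \<in> center G" if g: "g \<in> carrier G" for g
    proof -
      have "center G #> g \<in> carrier ?Q" using g by (auto simp: carrier_FactGroup)
      then have "(center G #> y) <#> (center G #> g) = (center G #> g) <#> (center G #> y)"
        using cc y(2) by simp
      then have "center G #> (y \<otimes> g) = center G #> (g \<otimes> y)" using y g by (simp add: Z.rcos_sum)
      then have "y \<otimes> g \<in> center G #> (g \<otimes> y)" using rcos_self[OF _ center_subgroup, of "y \<otimes> g"] y g by simp
      then have "(y \<otimes> g) \<otimes> inv (g \<otimes> y) \<in> center G"
        using subgroup.rcos_module_imp[OF center_subgroup group_axioms] y g by simp
      then have "conj_by ((y \<otimes> g) \<otimes> inv (g \<otimes> y)) (g \<otimes> y) \<in> center G"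
        using normal_conj_by[OF center_normal] y g by simp
      moreover have "conj_by ((y \<otimes> g) \<otimes> inv (g \<otimes> y)) (g \<otimes> y) = comm y g"
        using y g by (simp add: group_word)
      ultimately show ?thesis by simp
    qed
    then show ?thesis using y c(2) cos by auto
  qed
  then obtain w where w: "w \<in> carrier G" "w \<notin> center G" "\<And>g. g \<in> carrier G \<Longrightarrow> comm w g \<in> center G" by blast
  obtain k where k: "w [^] (p ^ k) \<notin> center G" "(w [^] (p ^ k)) [^] p \<in> center G"
    using ex_pow_enters[OF center_subgroup card_G w(1,2)] by blast
  define y where "y = w [^] (p ^ k)"
  have y: "y \<in> carrier G" "y \<notin> center G" "y [^] p \<in> ?Z" using w k Z_elem by (auto simp: y_def)
  have yc: "comm y g \<in> center G" if "g \<in> carrier G" for g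
  proof -
    have "subgroup {y \<in> carrier G. \<forall>x\<in>carrier G. comm y x \<in> center G} G"
      by (rule subgroup_comm_in[OF center_normal]) simp
    from subgroup_nat_pow_closed[OF this, of w "p ^ k"] show ?thesis using w that by (auto simp: y_def)
  qed
  have yp: "y [^] p = \<one>" by (rule second[OF y(1) yc y(3)])
  have ye: "y \<otimes> e = e \<otimes> y" if e: "e \<in> E" for e
  proof -
    have "comm e y \<in> center G"
      using yc[OF E_carrier[OF e]] normal_comm_swap[OF center_normal E_carrier[OF e] y(1)] by blast
    then show ?thesis using quad_comm_center[OF quad_E[OF e] E_carrier[OF e] y(1)] by simp
  qed
  \<comment> \<open>y commutes with \<open>A\<close> and has order p, so outside \<open>A\<close> it
    would enlarge an elementary abelian subgroup of maximal order.\<close>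
  have yA: "y \<in> A"
  proof (rule ccontr)
    assume "y \<notin> A"
    let ?R = "range (\<lambda>i::nat. y [^] i)"
    define B where "B = {x. \<exists>a\<in>A. \<exists>b\<in>?R. x = a \<otimes> b}"
    have Ain: "a \<in> carrier G" if "a \<in> A" for a using As that by (rule subgroup.mem_carrier)
    have Ay: "a \<otimes> y = y \<otimes> a" if a: "a \<in> A" for a
    proof -
      obtain e z where ez: "e \<in> E" "z \<in> ?Z" "a = e \<otimes> z" using a by (auto simp: A_def)
      have c: "e \<in> carrier G" "z \<in> carrier G" using ez E_carrier ZD by blast+
      have "a \<otimes> y = e \<otimes> (y \<otimes> z)" using ez c y centerD(1)[OF ZD(1)[OF ez(2)] y(1)] by (simp add: m_assoc)
      also have "\<dots> = y \<otimes> a" using ez c y ye[OF ez(1)] by (simp add: m_assoc[symmetric])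
      finally show ?thesis .
    qed
    have "elementary_abelian_subgroup p G B"
      unfolding B_def
    proof (rule elementary_abelian_mult[OF A elementary_abelian_cyclic[OF y(1) yp]])
      show "a \<otimes> b = b \<otimes> a" if a: "a \<in> A" and b: "b \<in> ?R" for a b
      proof -
        obtain i :: nat where "b = y [^] i" using b by blast
        moreover have "a \<otimes> y [^] i = y [^] i \<otimes> a"
          using group_commutes_pow[OF Ay[OF a, symmetric] y(1) Ain[OF a]] by simp
        ultimately show ?thesis by simp
      qed
    qed (use p1 in simp)
    then have "card B \<le> card A" using small cA by simp
    moreover have "A \<subseteq> B"
    proof
      fix a assume a: "a \<in> A"
      have "\<one> \<in> ?R" by (rule range_eqI[of _ _ 0]) simp
      moreover have "a = a \<otimes> \<one>" using Ain[OF a] by simp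
      ultimately show "a \<in> B" unfolding B_def using a by blast
    qed
    moreover have "y \<in> B"
    proof -
      have "y \<in> ?R" by (rule range_eqI[of _ _ 1]) (use y in simp)
      moreover have "y = \<one> \<otimes> y" using y(1) by simp
      ultimately show ?thesis unfolding B_def using subgroup.one_closed[OF As] by blast
    qed
    moreover have "finite B"
    proof -
      have "B \<subseteq> carrier G" unfolding B_def using Ain y by auto
      then show ?thesis using finite_G by (rule finite_subset)
    qed
    ultimately have "A = B" by (simp add: card_seteq)
    then show False using \<open>y \<in> B\<close> \<open>y \<notin> A\<close> by simp
  qed
  \<comment> \<open>The factor e lies in the second center as y does, so it is central and therefore
    trivial; this would make y central.\<close>
  then obtain e z where ez: "e \<in> E" "z \<in> ?Z" "y = e \<otimes> z" by (auto simp: A_def)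
  have ec: "e \<in> carrier G" and zc: "z \<in> carrier G" using ez E_carrier ZD by blast+
  have "e \<otimes> g = g \<otimes> e" if g: "g \<in> carrier G" for g
  proof -
    have "comm (e \<otimes> z) g = conj_by (comm e g) z \<otimes> comm z g" using ec zc g by (rule comm_mult_left)
    moreover have "comm z g = \<one>" using comm_eq_one_iff[OF zc g] centerD(1)[OF ZD(1)[OF ez(2)] g] by simp
    ultimately have "conj_by (comm e g) z \<in> center G" using yc[OF g] ez(3) ec zc g by simp
    then have "comm e g \<in> center G" using normal_conj_by_iff[OF center_normal] ec zc g by simp
    then show ?thesis using quad_comm_center[OF quad_E[OF ez(1)] ec g] by simp
  qed
  then have "e \<in> center G" using ec by (simp add: center_def)
  then have "y = z" using E_center[OF ez(1)] ez(3) zc by simp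
  then show False using y(2) ZD(1)[OF ez(2)] by simp
qed

end

theorem theorem1p3:
  fixes p :: nat
    and G :: "('g, 'm) monoid_scheme"
    and scale :: "'k::field \<Rightarrow> 'v::ab_group_add \<Rightarrow> 'v"
    and act :: "'v \<Rightarrow> 'g \<Rightarrow> 'v"
  assumes "prime p" and "odd p"
    and "p_group p G"
    and "right_FpG_module p G scale act"
    and "faithful_action G act"
    and "\<And>z. z \<in> Omega1_center p G \<Longrightarrow> z \<noteq> \<one>\<^bsub>G\<^esub> \<Longrightarrow>
           is_minimal_polynomial scale (\<lambda>v. act v z) (monom 1 p - 1)"
    and "maximal_class p G \<or> p_rank p G \<le> p"
  shows "\<not> F_module p G act"
proof
  assume "F_module p G act"
  interpret odd_FpG_module p G scale act
    using assms by (intro odd_FpG_module.intro odd_FpG_module_axioms.intro)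
  obtain E where E: "offender p G act E" "\<forall>e\<in>E. quad e"
    using ex_quadratic_offender[OF \<open>F_module p G act\<close>] by blast
  interpret quadratic_offender p G scale act E
    by unfold_locales (use E in auto)
  show False
    using assms(7)
  proof
    assume "maximal_class p G"
    then obtain n where n: "2 \<le> n" "card (carrier G) = p ^ n" "has_nilpotence_class G (n - 1)"
      unfolding maximal_class_def by blast
    interpret M: maximal_class_group G p n
      by unfold_locales (use n prime_p in auto)
    have "card E < p ^ (p - 1)"
      by (rule M.quadratic_subgroup_card[where Q = quad, OF odd_p E_elementary quad_E quad_comm quad_center])
    then show False using card_E_ge by simp
  next
    assume "p_rank p G \<le> p"
    then have "p ^ p_rank p G \<le> p ^ p" using p3 by (simp add: power_increasing)
    then show False
      using not_small_rank card_elementary_abelian_le[OF card_G prime_p] le_trans by blast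
  qed
qed

end
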